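(* Let $\mathsf{A}\subset \mathbf{M}_d(\mathbb{C})$ be a compact set with positive joint spectral radius, and let $\mathcal{I}$ be an index set for $\mathsf{A}$. Define the Mather set $Z_{\mathsf{A}} \subseteq \Sigma_{\mathcal{I}}$ associated to $\mathsf{A}$ by \[Z_{\mathsf{A}}:= \bigcup_{\mu \in \mathcal{M}_{\max}(\mathsf{A})} \mathrm{supp}\, \mu.\] Then $Z_{\mathsf{A}}$ has the following properties: (i) $Z_{\mathsf{A}}$ is equal to the support of some measure $\hat\mu \in \mathcal{M}_\sigma$. In particular, $Z_{\mathsf{A}}$ is compact and nonempty and satisfies $\sigma Z_{\mathsf{A}}=Z_{\mathsf{A}}$. (ii) For every $\mu \in \mathcal{M}_\sigma$ we have $\mu \in \mathcal{M}_{\max}(\mathsf{A})$ if and only if $\mu(Z_{\mathsf{A}})=1$. (iii) Every $x \in Z_{\mathsf{A}}$ which is recurrent with respect to $\sigma$ satisfies $\limsup_{n \to \infty} \varrho(\mathsf{A})^{-n}\rho(\mathcal{L}_{\mathsf{A}}(x,n))=1$. (iv) Every $x \in Z_{\mathsf{A}}$ is strongly extremal. If in addition $\mathsf{A}$ is relatively product bounded, then for every extremal norm $|\!|\!| \cdot |\!|\!|$ for $\mathsf{A}$ we have $|\!|\!|\mathcal{L}_{\mathsf{A}}(x,n)|\!|\!| = \varrho(\mathsf{A})^n$ for all $x \in Z_{\mathsf{A}}$ and $n \geq 1$. (v) Let $\mathrm{d}$ be a metric which generates the topology of $\Sigma_{\mathcal{I}}$, and define $\mathrm{dist}(x,Z_{\mathsf{A}}):=\inf\{\mathrm{d}(x,y)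 \colon y \in Z_{\mathsf{A}}\}$ for every $x \in \Sigma_{\mathcal{I}}$. If $z \in \Sigma_{\mathcal{I}}$ is weakly extremal, then $\lim_{n \to \infty}\frac1n\sum_{k=0}^{n-1}\mathrm{dist}(\sigma^kz,Z_{\mathsf{A}}) = 0$.
   Context: $\mathbf{M}_d(\mathbb{C})$ is the set of $d\times d$ complex matrices; $\|\cdot\|$ is the Euclidean norm on $\mathbb{C}^d$ and the induced operator norm on $\mathbf{M}_d(\mathbb{C})$; $\rho(B)$ is the spectral radius of a matrix $B$. Convention: $\log 0=-\infty$. The joint spectral radius of a bounded set $\mathsf{A}$ is $\varrho(\mathsf{A})=\lim_{n\to\infty}\sup\{\|A_1\cdots A_n\|^{1/n}\colon A_1,\dots,A_n\in\mathsf{A}\}$. An index set for a compact set $\mathsf{A}$ is a compact metric space $\mathcal{I}$ equipped with a continuous surjection $\mathcal{I}\to\mathsf{A}$, $i\mapsto A_i$ (not necessarily injective). $\Sigma_{\mathcal{I}}=\mathcal{I}^{\mathbb{N}}$ is the space of one-sided sequences $x=(x_i)_{i=1}^\infty$ with the product topology, and $\sigma$ is the shift $(x_i)_{i\ge1}\mapsto(x_{i+1})_{i\ge1}$. $\mathcal{M}_\sigma$ is the set of $\sigma$-invariant Borel probability measures on $\Sigma_{\mathcal{I}}$. For $x\in\Sigma_{\mathcal{I}}$ and $n\ge1$, $\mathcal{L}_{\mathsf{A}}(x,n):=A_{x_n}A_{x_{n-1}}\cdots A_{x_1}$. The set of maximising measures is $$\mathcal{M}_{\max}(\mathsf{A}):=\left\{\mu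 \in \mathcal{M}_\sigma \colon \inf_{n \geq 1}\frac{1}{n}\int \log \|\mathcal{L}_{\mathsf{A}}(x,n)\|\,d\mu(x) = \log \varrho(\mathsf{A})\right\}.$$ A point $x\in\Sigma_{\mathcal{I}}$ is strongly extremal if there exists $\varepsilon>0$ such that $\|\mathcal{L}_{\mathsf{A}}(x,n)\|\ge\varepsilon\varrho(\mathsf{A})^n$ for every $n\ge1$, and weakly extremal if $\lim_{n\to\infty}\|\mathcal{L}_{\mathsf{A}}(x,n)\|^{1/n}=\varrho(\mathsf{A})$. $\mathsf{A}$ is relatively product bounded if there is $C>1$ such that $\|A_{1}\cdots A_{n}\|\le C\varrho(\mathsf{A})^n$ for all $n\ge1$ and $A_1,\dots,A_n\in\mathsf{A}$. A norm $|\!|\!|\cdot|\!|\!|$ on $\mathbb{C}^d$ is an extremal norm for $\mathsf{A}$ if the induced operator norm (denoted the same way) satisfies $|\!|\!|A|\!|\!|\le\varrho(\mathsf{A})$ for all $A\in\mathsf{A}$. A point $x$ is recurrent if $\sigma^{n_j}x\to x$ along some strictly increasing sequence $(n_j)$ of positive integers. *)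

theory Defs
  imports "HOL-Probability.Probability"
begin

text \<open>The norm of \<^typ>\<open>complex ^ 'd\<close> is the Euclidean one, so \<^const>\<open>onorm\<close> below yields the
  induced operator norm.\<close>

abbreviation mat_onorm :: "complex ^ 'd ^ 'd \<Rightarrow> real" where
  "mat_onorm A \<equiv> onorm ((*v) A)"

text \<open>Ordered products are taken with \<open>**\<close>; the operation \<open>*\<close> on \<^typ>\<open>complex ^ 'd ^ 'd\<close> is the
  entrywise product.\<close>

definition mat_prod :: "(complex ^ 'd ^ 'd) list \<Rightarrow> complex ^ 'd ^ 'd" where
  "mat_prod As = foldr (**) As (mat 1)"

definition mat_spectral_radius :: "complex ^ 'd ^ 'd \<Rightarrow> real" where
  "mat_spectral_radius B = Max {cmod c |c. \<exists>v. v \<noteq> 0 \<and> B *v v = c *s v}"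

definition joint_spectral_radius :: "(complex ^ 'd ^ 'd) set \<Rightarrow> real" where
  "joint_spectral_radius AA =
     lim (\<lambda>n. Sup {root n (mat_onorm (mat_prod As)) |As. length As = n \<and> set As \<subseteq> AA})"

definition relatively_product_bounded :: "(complex ^ 'd ^ 'd) set \<Rightarrow> bool" where
  "relatively_product_bounded AA \<longleftrightarrow>
     (\<exists>C>1. \<forall>n\<ge>1. \<forall>As. length As = n \<and> set As \<subseteq> AA \<longrightarrow>
        mat_onorm (mat_prod As) \<le> C * joint_spectral_radius AA ^ n)"

definition is_norm :: "(complex ^ 'd \<Rightarrow> real) \<Rightarrow> bool" where
  "is_norm N \<longleftrightarrow>
     (\<forall>v. 0 \<le> N v) \<and> (\<forall>v. N v = 0 \<longleftrightarrow> v = 0) \<and>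
     (\<forall>c v. N (c *s v) = cmod c * N v) \<and> (\<forall>v w. N (v + w) \<le> N v + N w)"

text \<open>Same shape as \<^const>\<open>onorm\<close>; the vector 0 contributes the harmless value \<open>0 / 0 = 0\<close>.\<close>

definition induced_norm :: "(complex ^ 'd \<Rightarrow> real) \<Rightarrow> complex ^ 'd ^ 'd \<Rightarrow> real" where
  "induced_norm N A = (SUP v. N (A *v v) / N v)"

definition extremal_norm :: "(complex ^ 'd ^ 'd) set \<Rightarrow> (complex ^ 'd \<Rightarrow> real) \<Rightarrow> bool" where
  "extremal_norm AA N \<longleftrightarrow> is_norm N \<and> (\<forall>A\<in>AA. induced_norm N A \<le> joint_spectral_radius AA)"

text \<open>The index set is a whole type \<open>'i\<close>, and the sequence space is \<^typ>\<open>nat \<Rightarrow> 'i\<close> with its library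
  (product) topology. Indexing starts at 0: the entry \<open>x k\<close> here is $x_{k+1}$ in the usual
  1-based notation.\<close>

definition index_set_for :: "('i::metric_space \<Rightarrow> complex ^ 'd ^ 'd) \<Rightarrow> (complex ^ 'd ^ 'd) set \<Rightarrow> bool" where
  "index_set_for A AA \<longleftrightarrow> compact (UNIV :: 'i set) \<and> continuous_on UNIV A \<and> range A = AA"

definition shift :: "(nat \<Rightarrow> 'i) \<Rightarrow> nat \<Rightarrow> 'i" where
  "shift x = (\<lambda>k. x (Suc k))"

primrec cocycle :: "('i \<Rightarrow> complex ^ 'd ^ 'd) \<Rightarrow> (nat \<Rightarrow> 'i) \<Rightarrow> nat \<Rightarrow> complex ^ 'd ^ 'd" where
  "cocycle A x 0 = mat 1"
| "cocycle A x (Suc n) = A (x n) ** cocycle A x n"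

definition strongly_extremal :: "('i \<Rightarrow> complex ^ 'd ^ 'd) \<Rightarrow> (nat \<Rightarrow> 'i) \<Rightarrow> bool" where
  "strongly_extremal A x \<longleftrightarrow>
     (\<exists>\<epsilon>>0. \<forall>n\<ge>1. mat_onorm (cocycle A x n) \<ge> \<epsilon> * joint_spectral_radius (range A) ^ n)"

definition weakly_extremal :: "('i \<Rightarrow> complex ^ 'd ^ 'd) \<Rightarrow> (nat \<Rightarrow> 'i) \<Rightarrow> bool" where
  "weakly_extremal A x \<longleftrightarrow>
     (\<lambda>n. root n (mat_onorm (cocycle A x n))) \<longlonglongrightarrow> joint_spectral_radius (range A)"

definition recurrent :: "(nat \<Rightarrow> 'i::topological_space) \<Rightarrow> bool" where
  "recurrent x \<longleftrightarrow>
     (\<exists>r::nat \<Rightarrow> nat. strict_mono r \<and> (\<forall>j. 0 < r j) \<and> (\<lambda>j. (shift ^^ r j) x) \<longlonglongrightarrow> x)"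

definition invariant_measures :: "(nat \<Rightarrow> 'i::topological_space) measure set" where
  "invariant_measures = {\<mu>. prob_space \<mu> \<and> sets \<mu> = sets borel \<and> distr \<mu> borel shift = \<mu>}"

definition elog :: "real \<Rightarrow> ereal" where
  "elog t = (if t = 0 then -\<infinity> else ereal (ln t))"

text \<open>Integral of an extended real function as the difference of the integrals of its positive and
  negative parts (\<^const>\<open>e2ennreal\<close> truncates negative values to 0). It is meaningful when one of the
  two is finite; for the logarithms of norms below the positive part is bounded.\<close>

definition ereal_integral :: "'a measure \<Rightarrow> ('a \<Rightarrow> ereal) \<Rightarrow> ereal" where
  "ereal_integral M f =
     enn2ereal (\<integral>\<^sup>+ x. e2ennreal (f x) \<partial>M) - enn2ereal (\<integral>\<^sup>+ x. e2ennreal (- f x) \<partial>M)"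

definition maximising_measures ::
    "('i::topological_space \<Rightarrow> complex ^ 'd ^ 'd) \<Rightarrow> (nat \<Rightarrow> 'i) measure set" where
  "maximising_measures A =
     {\<mu> \<in> invariant_measures.
        (INF n\<in>{1..}. ereal (1 / real n) * ereal_integral \<mu> (\<lambda>x. elog (mat_onorm (cocycle A x n))))
          = elog (joint_spectral_radius (range A))}"

definition msupport :: "'a::topological_space measure \<Rightarrow> 'a set" where
  "msupport \<mu> = {x. \<forall>U. open U \<and> x \<in> U \<longrightarrow> 0 < emeasure \<mu> U}"

definition mather_set :: "('i::topological_space \<Rightarrow> complex ^ 'd ^ 'd) \<Rightarrow> (nat \<Rightarrow> 'i) set" where
  "mather_set A = (\<Union>\<mu>\<in>maximising_measures A. msupport \<mu>)"

end

theory Submission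
  imports Defs "HOL-Complex_Analysis.Complex_Analysis"
begin

text \<open>Let \<open>r\<close> be the joint spectral radius. Adding to an invariant subspace \<open>V\<close> all vectors whose orbits
  modulo \<open>V\<close> grow at most like \<open>r\<^sup>n\<close> strictly enlarges \<open>V\<close>, so iteration yields a finite flag with an extremal
  seminorm on each quotient. On each block the operator seminorm of the cocycle is at most \<open>r\<^sup>n\<close>. Weighting the
  blocks suitably gives norms on the whole space for which the norm of a product of fixed length is
  arbitrarily close to the maximum over the blocks. Hence a measure is maximising iff it lives on the
  closed set of extremal points, those \<open>x\<close> for which the seminorm of one fixed block equals
  \<open>r\<^sup>n\<close> for all \<open>n\<close>.

  Maximising measures are obtained, and averages along weakly extremal orbits are controlled, by weak
  limits of empirical measures. A countable convex combination of maximising measures has support equal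
  to the Mather set.

  At a recurrent extremal point the normalised blocks accumulate, along return times, at a compact
  semigroup of nonzero matrices. It contains an idempotent, and the eigenvalue 1 of the idempotent is
  approximated by eigenvalues of the normalised blocks.\<close>

section \<open>Measures on compact metric spaces\<close>

text \<open>The obstacle is that the matrices need not be relatively product bounded, so the whole
  space may carry no extremal norm. Growth beyond \<open>r ^ n\<close> then comes from the parts of
  the cocycle off the block diagonal, and weights make these small for one length at a time only. A
  second obstacle is that the logarithm of the norm may be -\<infinity>, so its integral does not
  pass to weak limits. The condition \<open>supercritical\<close> therefore tests a measure only
  against continuous functions that bound the growth over a fixed time. Maximising measures and weak
  limits of empirical measures with nearly maximal growth both satisfy it, and it gives information
  about every point of the support. Telescoping over all starting times takes the place of a
  subadditive ergodic theorem. Weak limits are taken on the real line, where tightness yields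
  convergence; this is why a compact metric space is first written as a continuous image of a
  compact set of reals. Spectral radii can be read off a block because a nonzero eigenvalue of a
  block is an eigenvalue of the full product.\<close>

lemma compact_PiE_UNIV:
  fixes S :: "'a \<Rightarrow> 'b::topological_space set"
  assumes "\<And>i. compact (S i)"
  shows "compact (PiE UNIV S)"
proof -
  have "compactin (product_topology (\<lambda>i::'a. euclidean) UNIV) (PiE UNIV S)"
    by (subst compactin_PiE) (use assms in auto)
  then show ?thesis
    by (simp add: euclidean_product_topology)
qed

lemma compact_UNIV_fun:
  "compact (UNIV :: 'b::topological_space set) \<Longrightarrow> compact (UNIV :: ('a \<Rightarrow> 'b) set)"
  using compact_PiE_UNIV[of "\<lambda>_. UNIV"] by (simp add: PiE_UNIV_domain)

lemma compact_dense_sequence: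
  assumes "compact (UNIV :: 'a::metric_space set)"
  obtains D :: "nat \<Rightarrow> 'a::metric_space" where "\<And>x e. 0 < e \<Longrightarrow> \<exists>n. dist x (D n) < e"
proof -
  have "\<exists>F. finite F \<and> (UNIV::'a set) \<subseteq> (\<Union>x\<in>F. ball x (inverse (real (Suc k))))" for k
  proof -
    obtain F where "finite F" "F \<subseteq> UNIV" "(UNIV::'a set) \<subseteq> (\<Union>x\<in>F. ball x (inverse (real (Suc k))))"
      by (rule compactE_image[OF assms, of UNIV "\<lambda>x. ball x (inverse (real (Suc k)))"]) auto
    then show ?thesis by blast
  qed
  then obtain F where F: "\<And>k. finite (F k)"
      "\<And>k. (UNIV::'a set) \<subseteq> (\<Union>x\<in>F k. ball x (inverse (real (Suc k))))"
    by metis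
  have cnt: "countable (\<Union>k. F k)"
    using F(1) by (intro countable_UN) (auto intro: countable_finite)
  have *: "\<exists>y\<in>(\<Union>k. F k). dist x y < e" if e: "0 < e" for x e
  proof -
    obtain k where k: "inverse (real (Suc k)) < e"
      using reals_Archimedean[OF e] by blast
    have "x \<in> (\<Union>x\<in>F k. ball x (inverse (real (Suc k))))" using F(2)[of k] by blast
    then obtain y where "y \<in> F k" "dist y x < inverse (real (Suc k))" by auto
    with k show ?thesis by (intro bexI[of _ y]) (auto simp: dist_commute)
  qed
  have ne: "(\<Union>k. F k) \<noteq> {}" using *[of 1] zero_less_one by blast
  show ?thesis
  proof
    fix x :: 'a and e :: real assume "0 < e"
    with * obtain y where "y \<in> (\<Union>k. F k)" "dist x y < e" by blast
    then show "\<exists>n. dist x (from_nat_into (\<Union>k. F k) n) < e"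
      using from_nat_into_surj[OF cnt] by metis
  qed
qed

text \<open>Serves twice: to exhaust the complement of a support by countably many null sets, and to
  reduce the union over all maximising measures to countably many of them.\<close>

lemma compact_countable_base:
  assumes "compact (UNIV :: 'a::metric_space set)"
  obtains U :: "nat \<Rightarrow> 'a::metric_space set" where "\<And>n. open (U n)"
    "\<And>V x. open V \<Longrightarrow> x \<in> V \<Longrightarrow> \<exists>n. x \<in> U n \<and> U n \<subseteq> V"
proof -
  obtain D :: "nat \<Rightarrow> 'a" where D: "\<And>x e. 0 < e \<Longrightarrow> \<exists>n. dist x (D n) < e"
    using compact_dense_sequence[OF assms] by blast
  define U where "U j = (case prod_decode j of (n, k) \<Rightarrow> ball (D n) (inverse (real (Suc k))))" for j
  show ?thesis
  proof
    show "open (U j)" for j by (simp add: U_def split: prod.split)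
    fix V and x :: 'a assume "open V" "x \<in> V"
    then obtain e where e: "0 < e" "ball x e \<subseteq> V" using open_contains_ball by blast
    then obtain k where k: "inverse (real (Suc k)) < e / 2"
      using reals_Archimedean[of "e/2"] by auto
    obtain n where n: "dist x (D n) < inverse (real (Suc k))" using D[of "inverse (real (Suc k))"] by auto
    have "U (prod_encode (n, k)) \<subseteq> ball x e"
      using n k by (auto simp: U_def intro: dist_triangle_half_l simp: dist_commute) (smt (verit) dist_triangle dist_commute)
    moreover have "x \<in> U (prod_encode (n, k))" using n by (simp add: U_def dist_commute)
    ultimately show "\<exists>n. x \<in> U n \<and> U n \<subseteq> V" using e by blast
  qed
qed

text \<open>Base 3 avoids the ambiguity of base 2: at the first differing digit n the sums differ by
  \<open>(1/3) ^ n\<close>, and all later digits together contribute at most half of that.\<close>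

lemma binary_expansion_in_base_3:
  fixes b b' :: "nat \<Rightarrow> real"
  assumes b: "\<And>n. b n = 0 \<or> b n = 1" and b': "\<And>n. b' n = 0 \<or> b' n = 1"
    and eq: "(\<Sum>n. b n * (1/3)^n) = (\<Sum>n. b' n * (1/3)^n)"
  shows "b = b'"
proof (rule ccontr)
  assume "b \<noteq> b'"
  then have ex: "\<exists>n. b n \<noteq> b' n" by auto
  define n where "n = (LEAST n. b n \<noteq> b' n)"
  have n: "b n \<noteq> b' n" unfolding n_def using ex by (rule LeastI_ex)
  have lt: "b k = b' k" if "k < n" for k using that not_less_Least unfolding n_def by blast
  define c where "c k = b k - b' k" for k
  have c: "\<bar>c k\<bar> \<le> 1" for k using b[of k] b'[of k] by (auto simp: c_def)
  have cn: "\<bar>c n\<bar> = 1" using b[of n] b'[of n] n by (auto simp: c_def)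
  have geo: "summable (\<lambda>k. (1/3::real)^k)" by (rule summable_geometric) simp
  have sb: "summable (\<lambda>k. d k * (1/3::real)^k)" if "\<And>k. \<bar>d k\<bar> \<le> 1" for d :: "nat \<Rightarrow> real"
    by (rule summable_comparison_test'[OF geo]) (use that in \<open>auto simp: abs_mult intro: mult_left_le_one_le\<close>)
  have s1: "summable (\<lambda>k. b k * (1/3)^k)" "summable (\<lambda>k. b' k * (1/3)^k)"
    by (rule sb, use b in \<open>smt (verit)\<close>) (rule sb, use b' in \<open>smt (verit)\<close>)
  have sc: "summable (\<lambda>k. c k * (1/3)^k)" using sb c by blast
  have "0 = (\<Sum>k. c k * (1/3)^k)"
    using eq suminf_diff[OF s1] by (simp add: c_def algebra_simps)
  also have "\<dots> = (\<Sum>k. c (k + Suc n) * (1/3)^(k + Suc n)) + (\<Sum>k<Suc n. c k * (1/3)^k)"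
    by (rule suminf_split_initial_segment[OF sc])
  also have "(\<Sum>k<Suc n. c k * (1/3)^k) = c n * (1/3)^n"
    by (simp add: lt c_def)
  finally have e: "\<bar>c n * (1/3)^n\<bar> = \<bar>\<Sum>k. c (k + Suc n) * (1/3)^(k + Suc n)\<bar>" by linarith
  have sg: "summable (\<lambda>k. (1/3::real)^(k + Suc n))" using geo by (subst summable_iff_shift)
  have "\<bar>\<Sum>k. c (k + Suc n) * (1/3)^(k + Suc n)\<bar> \<le> (\<Sum>k. (1/3)^(k + Suc n))"
    using norm_suminf_le[of "\<lambda>k. c (k + Suc n) * (1/3)^(k + Suc n)" "\<lambda>k. (1/3::real)^(k + Suc n)"] sg c
    by (auto simp: abs_mult intro!: mult_left_le_one_le)
  also have "\<dots> = (\<Sum>k. (1/3)^k) * (1/3::real)^Suc n"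
    by (subst suminf_mult2[OF geo]) (simp add: power_add)
  also have "\<dots> = (1/3)^n / 2" by (subst suminf_geometric) auto
  finally have "\<bar>c n * (1/3)^n\<bar> \<le> (1/3)^n / 2" using e by simp
  moreover have "(0::real) < (1/3)^n" by simp
  ultimately show False by (simp add: abs_mult cn)
qed

text \<open>A point is coded by recording in which of countably many balls it lies, and the code is
  read as a base-3 expansion. Points on the boundary of a ball get both digits, so the coding is a
  relation rather than a map; its graph \<open>\<Gamma>\<close> is compact and embeds into the
  reals. The second projection, transported along this embedding, is \<open>h\<close>.\<close>

lemma compact_metric_image_of_real_compact:
  assumes cpt: "compact (UNIV :: 'a::metric_space set)"
  obtains C :: "real set" and h :: "real \<Rightarrow> 'a::metric_space"
  where "compact C" "continuous_on C h" "h ` C = UNIV"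
proof -
  obtain D :: "nat \<Rightarrow> 'a" where D: "\<And>x e. 0 < e \<Longrightarrow> \<exists>n. dist x (D n) < e"
    using compact_dense_sequence[OF cpt] by blast
  define p where "p j = D (fst (prod_decode j))" for j
  define e where "e j = inverse (real (Suc (snd (prod_decode j))))" for j
  \<comment> \<open>Both inequalities are strict, so the digit j differs even though ties admit
    either digit.\<close>
  have sep: "\<exists>j. dist x (p j) < e j \<and> dist y (p j) > e j" if xy: "x \<noteq> y" for x y
  proof -
    obtain k where k: "inverse (real (Suc k)) < dist x y / 2"
      using reals_Archimedean[of "dist x y / 2"] xy zero_less_dist_iff[of x y] by (auto simp del: of_nat_Suc)
    obtain n where n: "dist x (D n) < inverse (real (Suc k))" using D[of "inverse (real (Suc k))"] by auto
    have "dist x y \<le> dist x (D n) + dist y (D n)" by (rule dist_triangle2)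
    with n k show ?thesis
      by (intro exI[of _ "prod_encode (n, k)"]) (auto simp: p_def e_def)
  qed
  \<comment> \<open>The three conditions say that digits are 0 or 1, that digit 1 forces the
    distance to be at most \<open>e j\<close>, and that digit 0 forces it to be at least
    \<open>e j\<close>. As products they are visibly closed.\<close>
  define \<Gamma> where "\<Gamma> = {q :: (nat \<Rightarrow> real) \<times> 'a. \<forall>j. fst q j * (1 - fst q j) = 0 \<and>
     fst q j * (dist (snd q) (p j) - e j) \<le> 0 \<and> (1 - fst q j) * (e j - dist (snd q) (p j)) \<le> 0}"
  have coord: "continuous_on UNIV (\<lambda>q :: (nat \<Rightarrow> real) \<times> 'a. fst q j)" for j
    by (rule continuous_on_compose2[OF continuous_on_product_coordinates[of j] continuous_on_fst]) auto
  have "closed \<Gamma>"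
    unfolding \<Gamma>_def
    by (intro closed_Collect_all closed_Collect_conj closed_Collect_eq closed_Collect_le)
       (intro continuous_intros coord)+
  moreover have "\<Gamma> \<subseteq> PiE UNIV (\<lambda>_. {0..1}) \<times> UNIV"
    by (auto simp: \<Gamma>_def PiE_UNIV_domain) (metis mult_eq_0_iff order.refl zero_le_one eq_iff_diff_eq_0)+
  moreover have "compact (PiE UNIV (\<lambda>_::nat. {0..1::real}) \<times> (UNIV :: 'a set))"
    by (intro compact_Times compact_PiE_UNIV cpt) auto
  ultimately have cG: "compact \<Gamma>"
    by (metis compact_Int_closed inf.absorb_iff2 inf_commute)
  define t where "t q = (\<Sum>n. fst q n * (1/3)^n)" for q :: "(nat \<Rightarrow> real) \<times> 'a"
  have bin: "fst q n = 0 \<or> fst q n = 1" if "q \<in> \<Gamma>" for q n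
    using that by (auto simp: \<Gamma>_def)
  have "uniform_limit \<Gamma> (\<lambda>n q. \<Sum>i<n. fst q i * (1/3)^i) t sequentially"
    unfolding t_def
  proof (rule Weierstrass_m_test)
    show "norm (fst q n * (1/3)^n) \<le> (1/3)^n" if "q \<in> \<Gamma>" for q n
      using bin[OF that, of n] by auto
  qed (rule summable_geometric, simp)
  then have ct: "continuous_on \<Gamma> t"
    by (rule uniform_limit_theorem[rotated])
       (auto intro!: always_eventually continuous_intros continuous_on_subset[OF coord])
  have inj: "inj_on t \<Gamma>"
  proof (rule inj_onI)
    fix q q' assume q: "q \<in> \<Gamma>" "q' \<in> \<Gamma>" "t q = t q'"
    have 1: "fst q = fst q'"
      by (rule binary_expansion_in_base_3) (use bin q in \<open>auto simp: t_def\<close>)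
    have 2: "snd q = snd q'"
    proof (rule ccontr)
      assume "snd q \<noteq> snd q'"
      then obtain j where j: "dist (snd q) (p j) < e j" "dist (snd q') (p j) > e j" using sep by blast
      have "fst q j * (dist (snd q') (p j) - e j) \<le> 0" "(1 - fst q j) * (e j - dist (snd q) (p j)) \<le> 0"
        using q(1,2) 1 by (simp_all add: \<Gamma>_def)
      with bin[OF q(1), of j] j show False by auto
    qed
    show "q = q'" using 1 2 by (rule prod_eqI)
  qed
  obtain g where g: "\<And>q. q \<in> \<Gamma> \<Longrightarrow> g (t q) = q"
    using that[of "the_inv_into \<Gamma> t"] the_inv_into_f_f[OF inj] by blast
  have cg: "continuous_on (t ` \<Gamma>) g"
    by (rule continuous_on_inv[OF ct cG]) (use g in auto)
  show ?thesis
  proof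
    show "compact (t ` \<Gamma>)" using ct cG by (rule compact_continuous_image)
    show "continuous_on (t ` \<Gamma>) (\<lambda>s. snd (g s))" using cg by (rule continuous_on_snd)
    show "(\<lambda>s. snd (g s)) ` t ` \<Gamma> = UNIV"
    proof safe
      fix x :: 'a
      define q where "q = ((\<lambda>j. if dist x (p j) \<le> e j then 1 else (0::real)), x)"
      have "q \<in> \<Gamma>" by (auto simp: q_def \<Gamma>_def)
      moreover have "x = snd (g (t q))" using g[OF \<open>q \<in> \<Gamma>\<close>] by (simp add: q_def)
      ultimately show "x \<in> (\<lambda>s. snd (g s)) ` t ` \<Gamma>" by blast
    qed auto
  qed
qed

text \<open>The indicator of a closed set is the pointwise limit of the cut-offs
  \<open>max 0 (1 - k * infdist x F)\<close>, and closed sets are an intersection-stable generator.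
  This will show that weak limits of empirical measures are shift-invariant.\<close>

lemma finite_measure_eqI_continuous:
  fixes M N :: "'a::metric_space measure"
  assumes fin: "finite_measure M" "finite_measure N"
    and sets: "sets M = sets borel" "sets N = sets borel"
    and eq: "\<And>f :: 'a \<Rightarrow> real. continuous_on UNIV f \<Longrightarrow> (\<And>x. \<bar>f x\<bar> \<le> 1) \<Longrightarrow> integral\<^sup>L M f = integral\<^sup>L N f"
  shows "M = N"
proof (rule measure_eqI_generator_eq[where E = "Collect closed" and \<Omega> = UNIV and A = "\<lambda>_. UNIV"])
  have b: "sets borel = sigma_sets UNIV (Collect (closed :: 'a set \<Rightarrow> bool))"
    by (subst borel_eq_closed) simp
  show "sets M = sigma_sets UNIV (Collect closed)" "sets N = sigma_sets UNIV (Collect closed)"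
    using b sets by auto
  show "Int_stable (Collect (closed :: 'a set \<Rightarrow> bool))" by (auto simp: Int_stable_def)
  show "emeasure M UNIV \<noteq> \<infinity>" using fin(1) by (simp add: finite_measure.emeasure_finite)
  fix F :: "'a set" assume "F \<in> Collect closed"
  then have F: "closed F" by simp
  show "emeasure M F = emeasure N F"
  \<comment> \<open>By convention \<open>infdist\<close> to the empty set is 0, so the cut-offs
    would be constantly 1 there.\<close>
  proof (cases "F = {}")
    case False
    define f where "f k x = max 0 (1 - real k * infdist x F)" for k x
    have cf: "continuous_on UNIV (f k)" for k
      unfolding f_def by (intro continuous_intros)
    have lim: "(\<lambda>k. f k x) \<longlonglongrightarrow> indicator F x" for x
    proof (cases "x \<in> F")
      case True then show ?thesis by (simp add: f_def)
    next
      case nin: False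
      then have pos: "infdist x F > 0"
        using F False in_closed_iff_infdist_zero[of F x] infdist_nonneg[of x F] by fastforce
      obtain K :: nat where K: "1 / infdist x F < real K" using reals_Archimedean2 by blast
      have "f k x = 0" if "k \<ge> K" for k
      proof -
        have "1 / infdist x F < real k" using K that by linarith
        then have "1 < real k * infdist x F" using pos by (simp add: field_simps)
        then show ?thesis by (simp add: f_def)
      qed
      then have "eventually (\<lambda>k. f k x = indicator F x) sequentially"
        using nin by (auto intro: eventually_sequentiallyI)
      then show ?thesis by (rule tendsto_eventually)
    qed
    have bnd: "\<bar>f k x\<bar> \<le> 1" for k x by (auto simp: f_def infdist_nonneg)
    have *: "(\<lambda>k. integral\<^sup>L P (f k)) \<longlonglongrightarrow> measure P F"
      if P: "finite_measure P" "sets P = sets borel" for P :: "'a measure"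
    proof -
      interpret finite_measure P by fact
      have m: "f k \<in> borel_measurable P" for k
        using borel_measurable_continuous_onI[OF cf[of k]] P(2) by (simp cong: measurable_cong_sets)
      have Fm: "F \<in> sets P" using F P by simp
      have sp: "space P = UNIV" using sets_eq_imp_space_eq[OF P(2)] by simp
      have "(\<lambda>k. integral\<^sup>L P (f k)) \<longlonglongrightarrow> (\<integral>x. indicator F x \<partial>P)"
        by (rule integral_dominated_convergence[where w = "\<lambda>_. 1"])
           (use m lim Fm bnd in auto)
      then show ?thesis using Fm sp by simp
    qed
    have "measure M F = measure N F"
      using *[OF fin(1) sets(1)] *[OF fin(2) sets(2)] eq[OF cf bnd]
      by (simp add: LIMSEQ_unique)
    then show ?thesis
      using fin by (simp add: finite_measure.emeasure_eq_measure)
  qed simp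
qed auto

text \<open>The sample points are lifted to the compact set \<open>C\<close> of reals along a
  section \<open>g\<close> of \<open>h\<close>. The lifted measures are tight because they all live
  on \<open>C\<close>; a weak limit on the line is pushed forward by \<open>h\<close>.\<close>

lemma empirical_measures_cluster:
  fixes y :: "nat \<Rightarrow> nat \<Rightarrow> 'a::metric_space" and n :: "nat \<Rightarrow> nat"
  assumes cpt: "compact (UNIV :: 'a set)" and n: "\<And>k. 0 < n k"
  obtains s \<mu> where "strict_mono (s :: nat \<Rightarrow> nat)" "prob_space \<mu>" "sets \<mu> = sets borel"
    "\<And>f :: 'a \<Rightarrow> real. continuous_on UNIV f \<Longrightarrow>
       (\<lambda>k. (\<Sum>j<n (s k). f (y (s k) j)) / n (s k)) \<longlonglongrightarrow> integral\<^sup>L \<mu> f"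
proof -
  obtain C and h :: "real \<Rightarrow> 'a" where C: "compact C" "continuous_on C h" "h ` C = (UNIV :: 'a set)"
    using compact_metric_image_of_real_compact[OF cpt] by metis
  then have "\<forall>x. \<exists>t\<in>C. h t = x" by (metis UNIV_I imageE)
  then obtain g where g: "\<And>x. g x \<in> C" "\<And>x. h (g x) = x" by metis
  then have Cne: "C \<noteq> {}" by auto
  define \<nu> where "\<nu> k = distr (measure_pmf (pmf_of_set {..<n k})) borel (\<lambda>j. g (y k j))" for k
  have rd: "real_distribution (\<nu> k)" for k
    unfolding \<nu>_def real_distribution_def real_distribution_axioms_def
    by (auto intro!: prob_space.prob_space_distr measure_pmf.prob_space_axioms)
  have ne: "{..<n k} \<noteq> {}" for k using n by (auto simp: lessThan_empty_iff)
  have int: "integral\<^sup>L (\<nu> k) F = (\<Sum>j<n k. F (g (y k j))) / n k" if "continuous_on UNIV F" for F :: "real \<Rightarrow> real" and k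
    unfolding \<nu>_def
    by (subst integral_distr)
       (use that in \<open>auto intro!: borel_measurable_continuous_onI simp: integral_pmf_of_set ne\<close>)
  obtain a where a: "\<And>t. t \<in> C \<Longrightarrow> \<bar>t\<bar> \<le> a"
    using compact_imp_bounded[OF C(1)] by (auto simp: bounded_iff)
  have tight: "tight \<nu>"
    unfolding tight_def
  proof (intro conjI allI impI)
    fix \<epsilon> :: real assume "0 < \<epsilon>"
    have "measure (\<nu> k) {-\<bar>a\<bar> - 1<..\<bar>a\<bar>} = 1" for k
    proof -
      have "(\<lambda>j. g (y k j)) -` {-\<bar>a\<bar> - 1<..\<bar>a\<bar>} = UNIV"
        using a g(1) by (auto simp: vimage_def) (smt (verit))+
      then show ?thesis unfolding \<nu>_def by (subst measure_distr) auto
    qed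
    then show "\<exists>a b. a < b \<and> (\<forall>k. 1 - \<epsilon> < measure (\<nu> k) {a<..b})"
      using \<open>0 < \<epsilon>\<close> by (intro exI[of _ "-\<bar>a\<bar> - 1"] exI[of _ "\<bar>a\<bar>"]) auto
  qed (rule rd)
  obtain s M where s: "strict_mono (s :: nat \<Rightarrow> nat)" and M: "real_distribution M"
    and w: "weak_conv_m (\<nu> \<circ> s) M"
    using tight_imp_convergent_subsubsequence[OF tight strict_mono_id] by (auto simp: comp_def)
  interpret M: real_distribution M by fact
  have conv: "(\<lambda>k. (\<Sum>j<n (s k). F (g (y (s k) j))) / n (s k)) \<longlonglongrightarrow> integral\<^sup>L M F"
    if F: "continuous_on UNIV F" "\<And>t. \<bar>F t\<bar> \<le> B" for F :: "real \<Rightarrow> real" and B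
  proof -
    interpret \<nu>: real_distribution "(\<nu> \<circ> s) k" for k using rd by simp
    have "(\<lambda>k. integral\<^sup>L ((\<nu> \<circ> s) k) F) \<longlonglongrightarrow> integral\<^sup>L M F"
      by (rule weak_conv_imp_integral_bdd_continuous_conv[OF _ _ w, of _ B])
         (use F rd in \<open>auto simp: continuous_on_eq_continuous_at M\<close>)
    then show ?thesis by (simp add: int[OF F(1)])
  qed
  have "AE t in M. t \<in> C"
  proof -
    \<comment> \<open>This bounded continuous function vanishes exactly on \<open>C\<close>, hence
      at all sample points; its integral against the limit is 0, so the limit is concentrated on
      \<open>C\<close>.\<close>
    define F where "F t = min 1 (infdist t C)" for t
    have cF: "continuous_on UNIV F" unfolding F_def by (intro continuous_intros)
    have F0: "0 \<le> F t" "F t \<le> 1" for t by (auto simp: F_def infdist_nonneg)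
    have Fm: "F \<in> borel_measurable M" using borel_measurable_continuous_onI[OF cF] by simp
    have "(\<lambda>k. (\<Sum>j<n (s k). F (g (y (s k) j))) / n (s k)) \<longlonglongrightarrow> integral\<^sup>L M F"
      by (rule conv[of _ 1]) (use cF F0 in \<open>auto simp: abs_le_iff intro: order_trans[of _ 0]\<close>)
    moreover have "F (g x) = 0" for x using g(1)[of x] by (simp add: F_def)
    ultimately have "integral\<^sup>L M F = 0" by (simp add: LIMSEQ_const_iff)
    then have "AE t in M. F t = 0"
      by (subst (asm) integral_nonneg_eq_0_iff_AE)
         (auto intro!: M.integrable_const_bound[of _ 1] Fm simp: F0)
    moreover have "F t = 0 \<Longrightarrow> t \<in> C" for t
      using in_closed_iff_infdist_zero[OF compact_imp_closed[OF C(1)] Cne, of t]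
      by (auto simp: F_def min_def split: if_splits)
    ultimately show ?thesis by auto
  qed
  note AE_C = this
  \<comment> \<open>\<open>h\<close> is controlled on \<open>C\<close> only; any constant outside
    makes it Borel, and the outside is a null set.\<close>
  define h' where "h' t = (if t \<in> C then h t else h (g undefined))" for t
  have h'[measurable]: "h' \<in> borel_measurable borel"
    unfolding h'_def
    by (rule borel_measurable_continuous_on_if)
       (use C compact_imp_closed in \<open>auto intro!: borel_closed\<close>)
  have h'M: "h' \<in> borel_measurable M" using h' by simp
  define \<mu> where "\<mu> = distr M borel h'"
  show ?thesis
  proof
    show "strict_mono s" by fact
    show "prob_space \<mu>" unfolding \<mu>_def by (rule M.prob_space_distr[OF h'M])
    show "sets \<mu> = sets borel" by (simp add: \<mu>_def)
    fix f :: "'a \<Rightarrow> real" assume f: "continuous_on UNIV f"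
    then have "compact (range f)" using cpt by (rule compact_continuous_image)
    then obtain B where B: "\<And>x. \<bar>f x\<bar> \<le> B" "0 < B"
      using compact_imp_bounded[of "range f"] by (auto simp: bounded_pos)
    \<comment> \<open>Weak convergence on the line needs a bounded continuous function on all reals,
      so \<open>f (h t)\<close> is extended from \<open>C\<close> by Tietze with the same
      bound.\<close>
    have "continuous_on C (\<lambda>t. f (h t))"
      by (rule continuous_on_compose2[OF f C(2)]) auto
    then obtain G where G: "continuous_on UNIV G" "\<And>t. t \<in> C \<Longrightarrow> G t = f (h t)" "\<And>t. \<bar>G t\<bar> \<le> B"
      using Tietze[of C "\<lambda>t. f (h t)" UNIV B] B compact_imp_closed[OF C(1)]
      by (auto simp: less_imp_le)
    have "integral\<^sup>L \<mu> f = (\<integral>t. f (h' t) \<partial>M)"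
      unfolding \<mu>_def by (rule integral_distr[OF h'M]) (rule borel_measurable_continuous_onI[OF f])
    also have "\<dots> = integral\<^sup>L M G"
    proof (rule integral_cong_AE)
      show "(\<lambda>t. f (h' t)) \<in> borel_measurable M"
        using measurable_compose[OF h'M borel_measurable_continuous_onI[OF f]] .
      show "G \<in> borel_measurable M" using borel_measurable_continuous_onI[OF G(1)] by simp
      show "AE t in M. f (h' t) = G t" using AE_C by eventually_elim (simp add: h'_def G)
    qed
    finally have "integral\<^sup>L \<mu> f = integral\<^sup>L M G" .
    moreover have "G (g x) = f x" for x using G(2)[OF g(1)] g(2) by simp
    ultimately show "(\<lambda>k. (\<Sum>j<n (s k). f (y (s k) j)) / n (s k)) \<longlonglongrightarrow> integral\<^sup>L \<mu> f"
      using conv[OF G(1) G(3)] by simp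
  qed
qed

section \<open>Matrix norms and the joint spectral radius\<close>

lemma mat_onorm_nonneg: "0 \<le> mat_onorm A"
  by (rule onorm_pos_le) simp

lemma mat_vector_mult: "mat c *v v = c *s v"
  for v :: "complex ^ 'd"
  by (simp add: vec_eq_iff matrix_vector_mult_def mat_def if_distrib[of "\<lambda>x. x * _"] cong: if_cong)

lemma norm_matrix_vector_le: "norm (A *v v) \<le> mat_onorm A * norm v"
  for A :: "complex ^ 'd ^ 'd"
  by (rule onorm) simp

lemma mat_onorm_mult_le: "mat_onorm (A ** B) \<le> mat_onorm A * mat_onorm B"
  for A B :: "complex ^ 'd ^ 'd"
proof -
  have "(*v) (A ** B) = (*v) A \<circ> (*v) B" by (auto simp: matrix_vector_mul_assoc)
  then show ?thesis using onorm_compose[of "(*v) A" "(*v) B"] by simp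
qed

lemma mat_onorm_one: "mat_onorm (mat 1 :: complex ^ 'd ^ 'd) = 1"
proof -
  have "(*v) (mat 1 :: complex ^ 'd ^ 'd) = (\<lambda>v. v)" by (rule ext) simp
  then show ?thesis using onorm_id[where 'a = "complex ^ 'd"] by simp
qed

lemma mat_onorm_scaleR: "mat_onorm (c *\<^sub>R A) = \<bar>c\<bar> * mat_onorm A"
  for A :: "complex ^ 'd ^ 'd"
proof -
  have "(*v) (c *\<^sub>R A) = (\<lambda>v. c *\<^sub>R (A *v v))" by (rule ext) (simp add: vec_eq_iff matrix_vector_mult_def scaleR_sum_right)
  then show ?thesis using onorm_scaleR[of "(*v) A" c] by simp
qed

lemma mat_onorm_triangle: "mat_onorm (A + B) \<le> mat_onorm A + mat_onorm B"
  for A B :: "complex ^ 'd ^ 'd"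
proof -
  have "(*v) (A + B) = (\<lambda>v. A *v v + B *v v)" by (rule ext) (simp add: matrix_vector_mult_add_rdistrib)
  then show ?thesis using onorm_triangle[of "(*v) A" "(*v) B"] by simp
qed

lemma norm_component_le_mat_onorm: "norm (A $ i $ j) \<le> mat_onorm A"
  for A :: "complex ^ 'd ^ 'd"
proof -
  have "A $ i $ j = (A *v axis j 1) $ i"
    by (simp add: matrix_vector_mult_def axis_def if_distrib cong: if_cong)
  also have "norm \<dots> \<le> norm (A *v axis j 1)" by (rule Finite_Cartesian_Product.norm_nth_le)
  also have "\<dots> \<le> mat_onorm A * norm (axis j (1::complex))" by (rule norm_matrix_vector_le)
  finally show ?thesis by simp
qed

text \<open>The type-class norm of a matrix is the Frobenius norm, in which compactness and limits
  are expressed. This and the reverse estimate below pass between it and the operator norm; the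
  crude constant d^2 is enough.\<close>

lemma norm_le_mat_onorm:
  obtains K where "0 < K" "\<And>A :: complex ^ 'd ^ 'd. norm A \<le> K * mat_onorm A"
proof
  show "0 < real CARD('d) * real CARD('d)" by simp
  fix A :: "complex ^ 'd ^ 'd"
  have "norm A \<le> (\<Sum>i\<in>UNIV. norm (A $ i))" by (simp add: norm_vec_def L2_set_le_sum)
  also have "\<dots> \<le> (\<Sum>i\<in>(UNIV::'d set). \<Sum>j\<in>(UNIV::'d set). norm (A $ i $ j))"
    by (intro sum_mono) (simp add: norm_vec_def L2_set_le_sum)
  also have "\<dots> \<le> (\<Sum>i\<in>(UNIV::'d set). \<Sum>j\<in>(UNIV::'d set). mat_onorm A)"
    by (intro sum_mono norm_component_le_mat_onorm)
  finally show "norm A \<le> real CARD('d) * real CARD('d) * mat_onorm A" by simp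
qed

lemma mat_onorm_le_norm:
  obtains K where "0 < K" "\<And>A :: complex ^ 'd ^ 'd. mat_onorm A \<le> K * norm A"
proof
  show "0 < real CARD('d) * real CARD('d)" by simp
  fix A :: "complex ^ 'd ^ 'd"
  show "mat_onorm A \<le> real CARD('d) * real CARD('d) * norm A"
  proof (rule onorm_bound)
    fix v :: "complex ^ 'd"
    have *: "norm (A $ i $ j) \<le> norm A" for i j
      using Finite_Cartesian_Product.norm_nth_le[of "A $ i" j] Finite_Cartesian_Product.norm_nth_le[of A i] by linarith
    have "norm (A *v v) \<le> (\<Sum>i\<in>UNIV. norm ((A *v v) $ i))" by (simp add: norm_vec_def L2_set_le_sum)
    also have "\<dots> \<le> (\<Sum>i\<in>(UNIV::'d set). \<Sum>j\<in>(UNIV::'d set). norm (A $ i $ j * v $ j))"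
      by (intro sum_mono) (simp add: matrix_vector_mult_def norm_sum)
    also have "\<dots> \<le> (\<Sum>i\<in>(UNIV::'d set). \<Sum>j\<in>(UNIV::'d set). norm A * norm v)"
      by (intro sum_mono) (simp add: norm_mult mult_mono * Finite_Cartesian_Product.norm_nth_le)
    finally show "norm (A *v v) \<le> real CARD('d) * real CARD('d) * norm A * norm v" by simp
  qed simp
qed

lemma continuous_on_matrix_mult [continuous_intros]:
  fixes f g :: "'a::topological_space \<Rightarrow> complex ^ 'd ^ 'd"
  shows "continuous_on S f \<Longrightarrow> continuous_on S g \<Longrightarrow> continuous_on S (\<lambda>x. f x ** g x)"
  unfolding matrix_matrix_mult_def by (intro continuous_intros)

lemma continuous_on_matrix_vector [continuous_intros]:
  fixes f :: "'a::topological_space \<Rightarrow> complex ^ 'd ^ 'd"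
  shows "continuous_on S f \<Longrightarrow> continuous_on S g \<Longrightarrow> continuous_on S (\<lambda>x. f x *v g x)"
  unfolding matrix_vector_mult_def by (intro continuous_intros)

text \<open>Exchanging \<open>A\<close> and \<open>B\<close> turns the one-sided estimate into a
  Lipschitz bound.\<close>

lemma continuous_on_if_norm_lipschitz:
  fixes F :: "'b::real_normed_vector \<Rightarrow> real" and f :: "'a::topological_space \<Rightarrow> 'b"
  assumes F: "\<And>A B. F A \<le> F B + K * norm (A - B)" and f: "continuous_on S f"
  shows "continuous_on S (\<lambda>x. F (f x))"
proof -
  have "continuous_on UNIV F"
  proof (rule continuous_on_iff[THEN iffD2], intro ballI allI impI)
    fix B :: 'b and e :: real assume "0 < e"
    show "\<exists>d>0. \<forall>A\<in>UNIV. dist A B < d \<longrightarrow> dist (F A) (F B) < e"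
    proof (intro exI conjI ballI impI)
      show "0 < e / (\<bar>K\<bar> + 1)" using \<open>0 < e\<close> by simp
      fix A assume "dist A B < e / (\<bar>K\<bar> + 1)"
      then have "(\<bar>K\<bar> + 1) * norm (A - B) < e"
        by (simp add: dist_norm field_simps)
      moreover have "K * norm (A - B) \<le> (\<bar>K\<bar> + 1) * norm (A - B)"
        by (rule mult_right_mono) auto
      ultimately show "dist (F A) (F B) < e"
        using F[of A B] F[of B A] by (simp add: dist_real_def norm_minus_commute)
    qed
  qed
  then show ?thesis using f by (rule continuous_on_compose2) auto
qed

lemma continuous_on_mat_onorm [continuous_intros]:
  fixes f :: "'a::topological_space \<Rightarrow> complex ^ 'd ^ 'd"
  assumes "continuous_on S f"
  shows "continuous_on S (\<lambda>x. mat_onorm (f x))"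
proof -
  obtain K where K: "\<And>A :: complex ^ 'd ^ 'd. mat_onorm A \<le> K * norm A"
    using mat_onorm_le_norm by blast
  show ?thesis
  proof (rule continuous_on_if_norm_lipschitz[OF _ assms])
    fix A B :: "complex ^ 'd ^ 'd"
    have "mat_onorm (B + (A - B)) \<le> mat_onorm B + mat_onorm (A - B)" by (rule mat_onorm_triangle)
    then show "mat_onorm A \<le> mat_onorm B + K * norm (A - B)" using K[of "A - B"] by simp
  qed
qed

section \<open>The shift and the cocycle\<close>

lemma shift_funpow: "(shift ^^ n) x = (\<lambda>k. x (k + n))"
  by (induction n arbitrary: x) (auto simp: shift_def funpow_Suc_right simp del: funpow.simps)

lemma shift_funpow_add: "(shift ^^ m) ((shift ^^ n) x) = (shift ^^ (n + m)) x"
  by (simp add: shift_funpow ac_simps)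

lemma continuous_on_shift [continuous_intros]: "continuous_on UNIV ((shift :: (nat \<Rightarrow> 'i::topological_space) \<Rightarrow> _) ^^ n)"
proof -
  have "continuous_on UNIV (\<lambda>x k. x (k + n) :: 'i)"
    by (rule continuous_on_coordinatewise_then_product) (rule continuous_on_product_coordinates)
  then show ?thesis by (subst ext[of "shift ^^ n", OF shift_funpow])
qed

lemma cocycle_add: "cocycle A x (n + m) = cocycle A ((shift ^^ n) x) m ** cocycle A x n"
  by (induction m) (auto simp: matrix_mul_assoc shift_funpow add.commute)

lemma cocycle_cong: "(\<And>k. k < n \<Longrightarrow> x k = y k) \<Longrightarrow> cocycle A x n = cocycle A y n"
  by (induction n) auto

text \<open>The index space is a full shift, so the first n entries of \<open>x\<close> can be
  followed by \<open>y\<close>. Suprema over all sequences therefore control arbitrary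
  concatenations of orbit pieces.\<close>

lemma cocycle_mult_eq_cocycle:
  obtains z where "cocycle A z (n + m) = cocycle A y m ** cocycle A x n"
proof
  let ?z = "\<lambda>k. if k < n then x k else y (k - n)"
  have "cocycle A ?z n = cocycle A x n" by (rule cocycle_cong) simp
  moreover have "(shift ^^ n) ?z = y" by (simp add: shift_funpow)
  ultimately show "cocycle A ?z (n + m) = cocycle A y m ** cocycle A x n"
    by (simp add: cocycle_add)
qed

lemma continuous_on_cocycle:
  fixes A :: "'i::topological_space \<Rightarrow> complex ^ 'd ^ 'd"
  assumes "continuous_on UNIV A"
  shows "continuous_on UNIV (\<lambda>x. cocycle A x n)"
proof (induction n)
  case (Suc n)
  have "continuous_on UNIV (\<lambda>x :: nat \<Rightarrow> 'i. A (x n))"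
    by (rule continuous_on_compose2[OF assms continuous_on_product_coordinates]) auto
  then show ?case unfolding cocycle.simps by (rule continuous_on_matrix_mult) (rule Suc)
qed (simp add: continuous_on_const)

section \<open>The joint spectral radius through suprema of the cocycle\<close>

lemma mat_prods_eq_cocycles:
  "{mat_prod As |As. length As = n \<and> set As \<subseteq> range A} = range (\<lambda>x. cocycle A x n)"
proof -
  \<comment> \<open>The cocycle puts later factors on the left, whereas \<open>mat_prod\<close>
    follows the order of the list; hence the reversal.\<close>
  have c: "cocycle A x n = mat_prod (rev (map (\<lambda>k. A (x k)) [0..<n]))" for x n
    by (induction n) (auto simp: mat_prod_def)
  have 1: "\<exists>x. mat_prod As = cocycle A x n" if As: "length As = n" "set As \<subseteq> range A" for As
  proof -
    have "\<forall>k. \<exists>i. k < n \<longrightarrow> A i = rev As ! k"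
      using As by (metis image_iff length_rev nth_mem set_rev subsetD)
    then obtain x where x: "\<And>k. k < n \<Longrightarrow> A (x k) = rev As ! k" by metis
    have "map (\<lambda>k. A (x k)) [0..<n] = rev As"
      by (rule nth_equalityI) (use As x in auto)
    then show ?thesis using c[of x n] by (metis rev_rev_ident)
  qed
  have 2: "\<exists>As. cocycle A x n = mat_prod As \<and> length As = n \<and> set As \<subseteq> range A" for x
    by (intro exI[of _ "rev (map (\<lambda>k. A (x k)) [0..<n])"]) (auto simp: c)
  show ?thesis
  proof (intro equalityI subsetI)
    fix B assume "B \<in> {mat_prod As |As. length As = n \<and> set As \<subseteq> range A}"
    with 1 show "B \<in> range (\<lambda>x. cocycle A x n)" by blast
  next
    fix B assume "B \<in> range (\<lambda>x. cocycle A x n)"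
    then obtain x where "B = cocycle A x n" by blast
    with 2[of x] show "B \<in> {mat_prod As |As. length As = n \<and> set As \<subseteq> range A}" by auto
  qed
qed

lemma LIMSEQ_root_submultiplicative:
  fixes s :: "nat \<Rightarrow> real"
  assumes nonneg: "\<And>n. 0 \<le> s n" and sub: "\<And>n m. s (n + m) \<le> s n * s m"
  shows "(\<lambda>n. root n (s n)) \<longlonglongrightarrow> (INF n\<in>{1..}. root n (s n))"
    and "n \<ge> 1 \<Longrightarrow> (INF n\<in>{1..}. root n (s n)) ^ n \<le> s n"
proof -
  let ?L = "INF n\<in>{1..}. root n (s n)"
  have bdd: "bdd_below ((\<lambda>n. root n (s n)) ` {1..})"
    by (intro bdd_belowI2[of _ 0]) (auto simp: nonneg real_root_ge_zero)
  have L0: "0 \<le> ?L" by (rule cINF_greatest) (auto simp: nonneg real_root_ge_zero)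
  have Ln: "?L \<le> root n (s n)" if "n \<ge> 1" for n
    by (rule cINF_lower[OF bdd]) (use that in auto)
  show "?L ^ n \<le> s n" if "n \<ge> 1" for n
    using power_mono[OF Ln[OF that] L0, of n] that by (simp add: nonneg)
  show "(\<lambda>n. root n (s n)) \<longlonglongrightarrow> ?L"
  proof (rule order_tendstoI)
    fix a assume "a < ?L"
    then show "\<forall>\<^sub>F n in sequentially. a < root n (s n)"
      by (intro eventually_sequentiallyI[of 1]) (use Ln in \<open>auto intro: less_le_trans\<close>)
  next
    fix b assume "?L < b"
    then obtain a where a: "?L < a" "a < b" using dense by blast
    with L0 have a0: "0 < a" by linarith
    obtain m where m: "m \<ge> 1" "root m (s m) < a"
      using a(1) cINF_less_iff[OF _ bdd, of a] by auto
    have "root m (s m) ^ m \<le> a ^ m"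
      by (rule power_mono) (use m nonneg in \<open>auto simp: real_root_ge_zero\<close>)
    then have sm: "s m \<le> a ^ m" using m nonneg[of m] by simp
    \<comment> \<open>Fekete's argument with roots in place of logarithms, since \<open>s\<close>
      may vanish: \<open>Q * a ^ k\<close> dominates the finitely many \<open>s k\<close> with
      \<open>k < m\<close>, and splitting off pieces of length \<open>m\<close> preserves this
      bound.\<close>
    define Q where "Q = (\<Sum>k<m. s k / a ^ k) + 1"
    have Q: "0 < Q" unfolding Q_def using a0 nonneg
      by (intro add_nonneg_pos sum_nonneg) auto
    have sk: "s k \<le> Q * a ^ k" if "k < m" for k
    proof -
      have "s k / a ^ k \<le> (\<Sum>k<m. s k / a ^ k)"
        by (rule member_le_sum) (use that a0 nonneg in auto)
      then have "s k / a ^ k \<le> Q" by (simp add: Q_def)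
      then show ?thesis using a0 by (simp add: field_simps)
    qed
    have sn: "s n \<le> Q * a ^ n" for n
    proof (induction n rule: less_induct)
      case (less n)
      show ?case
      proof (cases "n < m")
        case False
        then have "s n \<le> s m * s (n - m)" using sub[of m "n - m"] by simp
        also have "\<dots> \<le> a ^ m * (Q * a ^ (n - m))"
          by (rule mult_mono) (use less[of "n - m"] sm False m nonneg a0 in auto)
        also have "\<dots> = Q * a ^ n" using False by (simp add: power_add[symmetric])
        finally show ?thesis .
      qed (rule sk)
    qed
    have "(\<lambda>n. root n Q * a) \<longlonglongrightarrow> 1 * a"
      by (intro tendsto_intros LIMSEQ_root_const Q)
    then have "\<forall>\<^sub>F n in sequentially. root n Q * a < b"
      using a(2) by (intro order_tendstoD(2)) auto
    then show "\<forall>\<^sub>F n in sequentially. root n (s n) < b"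
      using eventually_ge_at_top[of 1]
    proof eventually_elim
      case (elim n)
      have "root n (s n) \<le> root n (Q * a ^ n)" using sn elim by simp
      also have "\<dots> = root n Q * a" 
        using elim a0 by (simp only: real_root_mult real_root_power_cancel[of n a])
      finally show ?case using elim by simp
    qed
  qed
qed

lemma Sup_root_eq:
  fixes S :: "real set"
  assumes "S \<noteq> {}" "bdd_above S" "\<And>t. t \<in> S \<Longrightarrow> 0 \<le> t" "n \<ge> 1"
  shows "Sup (root n ` S) = root n (Sup S)"
proof (rule cSup_eq_non_empty)
  show "root n ` S \<noteq> {}" using assms by simp
  show "t \<le> root n (Sup S)" if "t \<in> root n ` S" for t
    using that assms by (auto intro!: cSup_upper)
  show "root n (Sup S) \<le> y" if y: "\<And>t. t \<in> root n ` S \<Longrightarrow> t \<le> y" for y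
  proof -
    obtain t where "t \<in> S" using assms by blast
    then have y0: "0 \<le> y" using y[of "root n t"] assms(3)[of t] real_root_ge_zero[of t n] by auto
    have "Sup S \<le> y ^ n"
    proof (rule cSup_least[OF assms(1)])
      fix t assume "t \<in> S"
      then have "root n t ^ n \<le> y ^ n" using y assms(3) by (intro power_mono) (auto simp: real_root_ge_zero)
      then show "t \<le> y ^ n" using assms(3,4) \<open>t \<in> S\<close> by simp
    qed
    then have "root n (Sup S) \<le> root n (y ^ n)" using assms(4) by simp
    then show ?thesis using y0 assms(4) by (simp add: real_root_power_cancel)
  qed
qed

locale matrix_cocycle =
  fixes A :: "'i::metric_space \<Rightarrow> complex ^ 'd ^ 'd"
  assumes compact_index: "compact (UNIV :: 'i set)"
    and continuous_A: "continuous_on UNIV A"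
    and jsr_pos: "0 < joint_spectral_radius (range A)"
begin

abbreviation (input) r where "r \<equiv> joint_spectral_radius (range A)"
abbreviation (input) L where "L \<equiv> cocycle A"

lemma compact_seq: "compact (UNIV :: (nat \<Rightarrow> 'i) set)"
  by (rule compact_UNIV_fun[OF compact_index])

lemma continuous_L: "continuous_on UNIV (\<lambda>x. L x n)"
  by (rule continuous_on_cocycle[OF continuous_A])

definition sup_norm :: "nat \<Rightarrow> real" where
  "sup_norm n = (SUP x. mat_onorm (L x n))"

lemma bdd_above_norm: "bdd_above (range (\<lambda>x. mat_onorm (L x n)))"
proof -
  have "compact (range (\<lambda>x. mat_onorm (L x n)))"
    by (intro compact_continuous_image continuous_on_mat_onorm continuous_L compact_seq)
  then show ?thesis by (simp add: compact_imp_bounded bounded_imp_bdd_above)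
qed

lemma norm_le_sup_norm: "mat_onorm (L x n) \<le> sup_norm n"
  unfolding sup_norm_def by (rule cSUP_upper[OF _ bdd_above_norm]) simp

lemma sup_norm_nonneg: "0 \<le> sup_norm n"
  using norm_le_sup_norm[of undefined n] mat_onorm_nonneg[of "L undefined n"] by linarith

lemma sup_norm_mult: "sup_norm (n + m) \<le> sup_norm n * sup_norm m"
proof -
  have "mat_onorm (L x (n + m)) \<le> sup_norm n * sup_norm m" for x
  proof -
    have "mat_onorm (L x (n + m)) \<le> mat_onorm (L ((shift ^^ n) x) m) * mat_onorm (L x n)"
      by (simp add: cocycle_add mat_onorm_mult_le)
    also have "\<dots> \<le> sup_norm m * sup_norm n"
      by (intro mult_mono norm_le_sup_norm sup_norm_nonneg mat_onorm_nonneg)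
    finally show ?thesis by (simp add: mult.commute)
  qed
  then show ?thesis unfolding sup_norm_def[of "n + m"] by (intro cSUP_least) auto
qed

lemma root_sup_norm_jsr: "(INF n\<in>{1..}. root n (sup_norm n)) = r"
  and root_sup_norm_LIMSEQ: "(\<lambda>n. root n (sup_norm n)) \<longlonglongrightarrow> r"
proof -
  let ?L = "INF n\<in>{1..}. root n (sup_norm n)"
  have lim: "(\<lambda>n. root n (sup_norm n)) \<longlonglongrightarrow> ?L"
    by (rule LIMSEQ_root_submultiplicative(1)[OF sup_norm_nonneg sup_norm_mult])
  have eq: "Sup {root n (mat_onorm (mat_prod As)) |As. length As = n \<and> set As \<subseteq> range A} = root n (sup_norm n)"
    if "n \<ge> 1" for n
  proof -
    have "{root n (mat_onorm (mat_prod As)) |As. length As = n \<and> set As \<subseteq> range A}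
        = (\<lambda>B. root n (mat_onorm B)) ` {mat_prod As |As. length As = n \<and> set As \<subseteq> range A}"
      by auto
    also have "\<dots> = root n ` range (\<lambda>x. mat_onorm (L x n))"
      by (simp only: mat_prods_eq_cocycles image_image)
    also have "Sup \<dots> = root n (sup_norm n)"
      unfolding sup_norm_def
      by (rule Sup_root_eq[OF _ bdd_above_norm _ that]) (auto simp: mat_onorm_nonneg)
    finally show ?thesis .
  qed
  have "(\<lambda>n. Sup {root n (mat_onorm (mat_prod As)) |As. length As = n \<and> set As \<subseteq> range A}) \<longlonglongrightarrow> ?L"
    by (rule Lim_transform_eventually[OF lim]) (auto intro!: eventually_sequentiallyI[of 1] simp: eq)
  then have "r = ?L" unfolding joint_spectral_radius_def by (rule limI)
  then show "?L = r" "(\<lambda>n. root n (sup_norm n)) \<longlonglongrightarrow> r" using lim by auto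
qed

lemma jsr_power_le_sup_norm: "r ^ n \<le> sup_norm n"
proof (cases "n \<ge> 1")
  case True
  from LIMSEQ_root_submultiplicative(2)[of sup_norm n, OF sup_norm_nonneg sup_norm_mult True]
  show ?thesis unfolding root_sup_norm_jsr .
next
  case False
  then show ?thesis using norm_le_sup_norm[of undefined 0] by (simp add: mat_onorm_one not_less_eq_eq)
qed

lemma sup_norm_pos: "0 < sup_norm n"
  by (rule less_le_trans[OF zero_less_power[OF jsr_pos] jsr_power_le_sup_norm])

lemma ln_sup_norm_LIMSEQ: "(\<lambda>n. ln (sup_norm n) / n) \<longlonglongrightarrow> ln r"
proof -
  have "(\<lambda>n. ln (root n (sup_norm n))) \<longlonglongrightarrow> ln r"
    using root_sup_norm_LIMSEQ jsr_pos by (intro tendsto_ln) auto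
  then show ?thesis
    by (rule Lim_transform_eventually)
       (auto intro!: eventually_sequentiallyI[of 1] simp: ln_root sup_norm_pos)
qed

end

section \<open>Blocks of the cocycle\<close>

lemma matrix_vector_scaleR: "B *v (c *\<^sub>R v) = c *\<^sub>R (B *v v)"
  for B :: "complex ^ 'd ^ 'd"
  by (rule linear_scale) simp

text \<open>When \<open>p\<close> depends on \<open>T *v v\<close> only, this is the operator norm
  of the compression \<open>T ** B ** T\<close> on the range of \<open>T\<close>. Vectors with
  \<open>p v = 0\<close> contribute 0, by division by zero.\<close>

definition op_seminorm :: "complex ^ 'd ^ 'd \<Rightarrow> (complex ^ 'd \<Rightarrow> real) \<Rightarrow> complex ^ 'd ^ 'd \<Rightarrow> real" where
  "op_seminorm T p B = (SUP v. p (B *v (T *v v)) / p v)"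

text \<open>The range of the projection \<open>T\<close> models a subquotient of the space.
  Comparability with \<open>norm (T *v v)\<close> makes \<open>p\<close> vanish exactly on the
  kernel of \<open>T\<close>, so \<open>p\<close> acts as a norm on that range.\<close>

locale projected_seminorm =
  fixes T :: "complex ^ 'd ^ 'd" and p :: "complex ^ 'd \<Rightarrow> real" and lo hi :: real
  assumes idem: "T *v (T *v v) = T *v v"
    and triangle: "p (v + w) \<le> p v + p w"
    and lo: "0 < lo" "lo * norm (T *v v) \<le> p v"
    and hi: "0 < hi" "p v \<le> hi * norm (T *v v)"
begin

lemma nonneg: "0 \<le> p v"
  using lo(1) lo(2)[of v] by (smt (verit) mult_nonneg_nonneg norm_ge_zero)

lemma eq_0_iff: "p v = 0 \<longleftrightarrow> T *v v = 0"
proof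
  assume "p v = 0"
  then have "lo * norm (T *v v) \<le> 0" using lo(2)[of v] by simp
  then show "T *v v = 0" using lo(1) by (simp add: mult_le_0_iff)
next
  assume "T *v v = 0"
  then show "p v = 0" using hi(2)[of v] nonneg[of v] by simp
qed

lemma cong: "T *v v = T *v w \<Longrightarrow> p v = p w"
proof -
  assume eq: "T *v v = T *v w"
  have "p (v - w) = 0" "p (w - v) = 0"
    by (simp_all add: eq_0_iff matrix_vector_mult_diff_distrib eq)
  then show ?thesis using triangle[of w "v - w"] triangle[of v "w - v"] by simp
qed

lemma proj: "p (T *v v) = p v"
  by (rule cong) (simp add: idem)

lemma ratio_le:
  "p (B *v (T *v v)) / p v \<le> hi / lo * mat_onorm (T ** B ** T)"
proof (cases "p v = 0")
  case True
  then show ?thesis using lo(1) hi(1) mat_onorm_nonneg[of "T ** B ** T"] by simp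
next
  case False
  then have pos: "0 < p v" using nonneg[of v] by linarith
  have "p (B *v (T *v v)) \<le> hi * norm ((T ** B ** T) *v (T *v v))"
    using hi(2)[of "B *v (T *v v)"] by (simp add: matrix_vector_mul_assoc[symmetric] idem)
  also have "\<dots> \<le> hi * (mat_onorm (T ** B ** T) * norm (T *v v))"
    using hi(1) by (intro mult_left_mono norm_matrix_vector_le) auto
  also have "\<dots> \<le> hi * (mat_onorm (T ** B ** T) * (p v / lo))"
    using lo hi(1) by (intro mult_left_mono mat_onorm_nonneg) (auto simp: field_simps)
  finally show ?thesis using pos by (simp add: field_simps)
qed

lemma op_seminorm_le_onorm: "op_seminorm T p B \<le> hi / lo * mat_onorm (T ** B ** T)"
  unfolding op_seminorm_def by (rule cSUP_least) (simp, rule ratio_le)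

lemma le_op_seminorm: "p (B *v (T *v v)) \<le> op_seminorm T p B * p v"
proof (cases "p v = 0")
  case True
  then show ?thesis using eq_0_iff[of v] eq_0_iff[of 0] by simp
next
  case False
  then have pos: "0 < p v" using nonneg[of v] by linarith
  have "p (B *v (T *v v)) / p v \<le> op_seminorm T p B"
    unfolding op_seminorm_def by (rule cSUP_upper) (auto intro!: bdd_aboveI2 ratio_le simp del: times_divide_eq_left)
  then show ?thesis using pos by (simp add: field_simps)
qed

lemma op_seminorm_least:
  assumes "0 \<le> K" "\<And>v. p (B *v (T *v v)) \<le> K * p v"
  shows "op_seminorm T p B \<le> K"
  unfolding op_seminorm_def
proof (rule cSUP_least)
  fix v show "p (B *v (T *v v)) / p v \<le> K"
  proof (cases "p v = 0")
    case False
    then have "0 < p v" using nonneg[of v] by linarith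
    then show ?thesis using assms(2)[of v] by (simp add: field_simps)
  qed (simp add: assms)
qed simp

lemma op_seminorm_nonneg: "0 \<le> op_seminorm T p B"
proof -
  have "p (B *v (T *v 0)) / p 0 \<le> op_seminorm T p B"
    unfolding op_seminorm_def by (rule cSUP_upper) (auto intro!: bdd_aboveI2 ratio_le simp del: times_divide_eq_left)
  then show ?thesis using eq_0_iff[of 0] by simp
qed

lemma onorm_le_op_seminorm: "mat_onorm (T ** B ** T) \<le> hi / lo * mat_onorm T * op_seminorm T p B"
proof (rule onorm_bound)
  show "0 \<le> hi / lo * mat_onorm T * op_seminorm T p B"
    using lo hi by (intro mult_nonneg_nonneg mat_onorm_nonneg op_seminorm_nonneg) auto
  fix v
  have "lo * norm ((T ** B ** T) *v v) \<le> p (B *v (T *v v))"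
    using lo(2)[of "B *v (T *v v)"] by (simp add: matrix_vector_mul_assoc[symmetric])
  also have "\<dots> \<le> op_seminorm T p B * p v" by (rule le_op_seminorm)
  also have "\<dots> \<le> op_seminorm T p B * (hi * (mat_onorm T * norm v))"
    using hi norm_matrix_vector_le[of T v]
    by (intro mult_left_mono op_seminorm_nonneg order_trans[OF hi(2)]) auto
  finally show "norm ((T ** B ** T) *v v) \<le> hi / lo * mat_onorm T * op_seminorm T p B * norm v"
    using lo(1) by (simp add: field_simps)
qed

lemma op_seminorm_lipschitz:
  obtains K where "\<And>B B'. op_seminorm T p B \<le> op_seminorm T p B' + K * norm (B - B')"
proof -
  obtain K where K: "\<And>A :: complex ^ 'd ^ 'd. mat_onorm A \<le> K * norm A"
    using mat_onorm_le_norm by blast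
  define K' where "K' = hi / lo * (mat_onorm T * K * mat_onorm T)"
  have *: "hi / lo * mat_onorm (T ** D ** T) \<le> K' * norm D" for D
  proof -
    have "mat_onorm (T ** D ** T) \<le> mat_onorm T * mat_onorm D * mat_onorm T"
      by (intro order_trans[OF mat_onorm_mult_le] mult_right_mono mat_onorm_mult_le mat_onorm_nonneg)
    also have "\<dots> \<le> mat_onorm T * (K * norm D) * mat_onorm T"
      by (intro mult_left_mono mult_right_mono K mat_onorm_nonneg)
    finally have "hi / lo * mat_onorm (T ** D ** T) \<le> hi / lo * (mat_onorm T * (K * norm D) * mat_onorm T)"
      using lo hi by (intro mult_left_mono) auto
    then show ?thesis by (simp add: K'_def ac_simps)
  qed
  show ?thesis
  proof
    fix B B'
    show "op_seminorm T p B \<le> op_seminorm T p B' + K' * norm (B - B')"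
    proof (rule op_seminorm_least)
      have "0 \<le> K' * norm (B - B')"
        using *[of "B - B'"] op_seminorm_le_onorm[of "B - B'"] op_seminorm_nonneg[of "B - B'"] by linarith
      then show "0 \<le> op_seminorm T p B' + K' * norm (B - B')" using op_seminorm_nonneg[of B'] by simp
      fix v
      have "B *v (T *v v) = B' *v (T *v v) + (B - B') *v (T *v v)"
        by (simp add: matrix_vector_mult_diff_rdistrib)
      then have "p (B *v (T *v v)) \<le> p (B' *v (T *v v)) + p ((B - B') *v (T *v v))"
        using triangle by metis
      also have "\<dots> \<le> op_seminorm T p B' * p v + op_seminorm T p (B - B') * p v"
        by (intro add_mono le_op_seminorm)
      also have "\<dots> \<le> op_seminorm T p B' * p v + K' * norm (B - B') * p v"
        using *[of "B - B'"] op_seminorm_le_onorm[of "B - B'"]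
        by (intro add_mono mult_right_mono nonneg) auto
      finally show "p (B *v (T *v v)) \<le> (op_seminorm T p B' + K' * norm (B - B')) * p v"
        by (simp add: algebra_simps)
    qed
  qed
qed

lemma continuous_on_op_seminorm:
  "continuous_on S f \<Longrightarrow> continuous_on S (\<lambda>x. op_seminorm T p (f x))"
  using op_seminorm_lipschitz by (metis continuous_on_if_norm_lipschitz)

end

lemma matrix_projection_exists:
  fixes V :: "(complex ^ 'd) set"
  assumes "vec.subspace V"
  obtains Q :: "complex ^ 'd ^ 'd" where "\<And>v. Q *v v \<in> V" "\<And>v. v \<in> V \<Longrightarrow> Q *v v = v"
proof -
  obtain g where g: "range g \<subseteq> V" "Vector_Spaces.linear (*s) (*s) g" "\<forall>v\<in>V. g (id v) = v"
    using vec.linear_exists_left_inverse_on[OF vec.linear_id assms inj_on_id] by blast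
  show ?thesis
  proof
    show "matrix g *v v \<in> V" for v using g by (auto simp: matrix_works)
    show "matrix g *v v = v" if "v \<in> V" for v using g that by (simp add: matrix_works)
  qed
qed

section \<open>Vectors of controlled growth modulo an invariant subspace\<close>

context matrix_cocycle
begin

definition invariant_subspace :: "(complex ^ 'd) set \<Rightarrow> bool" where
  "invariant_subspace V \<longleftrightarrow> vec.subspace V \<and> (\<forall>i. \<forall>v\<in>V. A i *v v \<in> V)"

lemma invariant_subspace_cocycle: "invariant_subspace V \<Longrightarrow> v \<in> V \<Longrightarrow> L x n *v v \<in> V"
  by (induction n) (auto simp: invariant_subspace_def matrix_vector_mul_assoc[symmetric])

text \<open>With \<open>Q\<close> a projection onto an invariant subspace, \<open>mat 1 - Q\<close>
  stands for the quotient map.\<close>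

definition bounded_orbits :: "complex ^ 'd ^ 'd \<Rightarrow> (complex ^ 'd) set" where
  "bounded_orbits Q = {v. \<exists>K. \<forall>x n. norm ((mat 1 - Q) *v (L x n *v v)) \<le> K * r ^ n}"

lemma bounded_orbits_subspace:
  assumes Q: "invariant_subspace V" "\<And>v. Q *v v \<in> V" "\<And>v. v \<in> V \<Longrightarrow> Q *v v = v"
  shows "invariant_subspace (bounded_orbits Q)" "V \<subseteq> bounded_orbits Q"
proof -
  let ?P = "mat 1 - Q"
  show sub: "V \<subseteq> bounded_orbits Q"
  proof
    fix v assume "v \<in> V"
    then have "?P *v (L x n *v v) = 0" for x n
      using Q(3)[OF invariant_subspace_cocycle[OF Q(1), of v x n]] by (simp add: matrix_vector_mult_diff_rdistrib)
    then show "v \<in> bounded_orbits Q" unfolding bounded_orbits_def by (auto intro!: exI[of _ 0])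
  qed
  have V: "vec.subspace V" using Q(1) by (simp add: invariant_subspace_def)
  have "vec.subspace (bounded_orbits Q)"
  proof (rule vec.subspaceI)
    show "0 \<in> bounded_orbits Q" using sub vec.subspace_0[OF V] by blast
  next
    fix v w assume "v \<in> bounded_orbits Q" "w \<in> bounded_orbits Q"
    then obtain K K' where K: "\<And>x n. norm (?P *v (L x n *v v)) \<le> K * r ^ n"
        "\<And>x n. norm (?P *v (L x n *v w)) \<le> K' * r ^ n"
      by (auto simp: bounded_orbits_def)
    have "norm (?P *v (L x n *v (v + w))) \<le> (K + K') * r ^ n" for x n
      using norm_triangle_ineq[of "?P *v (L x n *v v)" "?P *v (L x n *v w)"] K(1)[of x n] K(2)[of x n]
      by (simp add: matrix_vector_right_distrib distrib_right)
    then show "v + w \<in> bounded_orbits Q" unfolding bounded_orbits_def by blast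
  next
    fix c v assume "v \<in> bounded_orbits Q"
    then obtain K where K: "\<And>x n. norm (?P *v (L x n *v v)) \<le> K * r ^ n"
      by (auto simp: bounded_orbits_def)
    have "norm (?P *v (L x n *v (c *s v))) \<le> (cmod c * K) * r ^ n" for x n
    proof -
      have "norm (?P *v (L x n *v (c *s v))) = cmod c * norm (?P *v (L x n *v v))"
        by (simp add: vec.scale norm_vec_def norm_mult L2_set_right_distrib)
      then show ?thesis using mult_left_mono[OF K[of x n], of "cmod c"] by (simp add: mult.assoc)
    qed
    then show "c *s v \<in> bounded_orbits Q" unfolding bounded_orbits_def by blast
  qed
  moreover have "A i *v v \<in> bounded_orbits Q" if v: "v \<in> bounded_orbits Q" for i v
  proof -
    obtain K where K: "\<And>x n. norm (?P *v (L x n *v v)) \<le> K * r ^ n"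
      using v by (auto simp: bounded_orbits_def)
    have "norm (?P *v (L x n *v (A i *v v))) \<le> (K * r) * r ^ n" for x n
    proof -
      \<comment> \<open>Putting \<open>i\<close> in front of \<open>x\<close> makes the orbit of
        \<open>A i *v v\<close> a tail of an orbit of \<open>v\<close>; the shifted exponent costs
        the factor \<open>r\<close>.\<close>
      obtain z where z: "L z (1 + n) = L x n ** L (\<lambda>_. i) 1"
        using cocycle_mult_eq_cocycle[of A 1 n x "\<lambda>_. i"] by metis
      then have "L x n *v (A i *v v) = L z (Suc n) *v v" by (simp add: matrix_vector_mul_assoc)
      then show ?thesis using K[of z "Suc n"] by simp
    qed
    then show ?thesis unfolding bounded_orbits_def by blast
  qed
  ultimately show "invariant_subspace (bounded_orbits Q)" by (simp add: invariant_subspace_def)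
qed

text \<open>By invariance of \<open>V\<close>, changing \<open>v\<close> within its class modulo
  \<open>V\<close> does not change the class of its image.\<close>

lemma projection_cocycle:
  assumes Q: "invariant_subspace V" "\<And>v. Q *v v \<in> V" "\<And>v. v \<in> V \<Longrightarrow> Q *v v = v"
  shows "(mat 1 - Q) *v (L x n *v ((mat 1 - Q) *v v)) = (mat 1 - Q) *v (L x n *v v)"
proof -
  have "Q *v (L x n *v (Q *v v)) = L x n *v (Q *v v)"
    by (intro Q(3) invariant_subspace_cocycle[OF Q(1)] Q(2))
  then show ?thesis
    by (simp add: matrix_vector_mult_diff_rdistrib matrix_vector_mult_diff_distrib)
qed

text \<open>If no new vector had a bounded orbit modulo \<open>V\<close>, compactness of the unit sphere of a complement
  would give a uniform time in which the norm modulo \<open>V\<close> can be doubled relative to the rate \<open>r\<close>,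
  and iterating this would produce products growing faster than \<open>r\<close>.\<close>

lemma bounded_orbits_proper:
  assumes Q: "invariant_subspace V" "\<And>v. Q *v v \<in> V" "\<And>v. v \<in> V \<Longrightarrow> Q *v v = v"
    and ne: "V \<noteq> UNIV"
  shows "bounded_orbits Q \<noteq> V"
proof
  assume eq: "bounded_orbits Q = V"
  let ?P = "mat 1 - Q"
  have QP: "Q *v (?P *v v) = 0" for v
    using Q(3)[OF Q(2)[of v]] by (simp add: matrix_vector_mult_diff_rdistrib matrix_vector_mult_diff_distrib)
  define S where "S = {v. norm v = 1 \<and> Q *v v = 0}"
  have "closed S" unfolding S_def
    by (intro closed_Collect_conj closed_Collect_eq continuous_intros)
  moreover have "bounded S" unfolding S_def by (auto simp: bounded_iff)
  ultimately have "compact S" by (simp add: compact_eq_bounded_closed)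
  \<comment> \<open>The pair (x, n) more than doubles the norm modulo \<open>V\<close>, relative to
    \<open>r ^ n\<close>, on this open set. A finite subcover of the unit sphere \<open>S\<close> of
    the kernel of \<open>Q\<close> bounds the waiting time by \<open>N\<close>.\<close>
  define U where "U = (\<lambda>(x, n). {v. 2 * r ^ n < norm (?P *v (L x n *v v))})"
  have "\<exists>q. v \<in> U q" if v: "v \<in> S" for v
  proof -
    have "v \<notin> V" using v Q(3)[of v] by (auto simp: S_def)
    then have "\<not> (\<forall>x n. norm (?P *v (L x n *v v)) \<le> 2 * r ^ n)"
      using eq by (auto simp: bounded_orbits_def)
    then show ?thesis by (auto simp: U_def not_le)
  qed
  moreover have "open (U q)" for q
    unfolding U_def by (auto split: prod.split intro!: open_Collect_less continuous_intros)
  ultimately obtain F where F: "finite F" "S \<subseteq> (\<Union>q\<in>F. U q)"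
    using compactE_image[OF \<open>compact S\<close>, of UNIV U] by (metis UNIV_I UN_I subsetI)
  define N where "N = Max (insert 1 (snd ` F))"
  have N1: "1 \<le> N" unfolding N_def using F(1) by simp
  have step: "\<exists>x n. 1 \<le> n \<and> n \<le> N \<and> 2 * r ^ n * norm v \<le> norm (?P *v (L x n *v v))"
    if v: "Q *v v = 0" "v \<noteq> 0" for v
  proof -
    define u where "u = inverse (norm v) *\<^sub>R v"
    have "u \<in> S" using v by (simp add: S_def u_def matrix_vector_scaleR)
    then obtain x n where xn: "(x, n) \<in> F" "2 * r ^ n < norm (?P *v (L x n *v u))"
      using F(2) by (force simp: U_def)
    \<comment> \<open>At time 0 the norm of a unit vector is 1, which is not above 2; so each
      doubling takes positive time.\<close>
    have "n \<noteq> 0"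
    proof
      assume "n = 0"
      then show False using xn \<open>u \<in> S\<close> by (simp add: S_def matrix_vector_mult_diff_rdistrib)
    qed
    moreover have "n \<le> N" unfolding N_def using xn(1) F(1) by (intro Max_ge) force+
    moreover have "norm (?P *v (L x n *v u)) = norm (?P *v (L x n *v v)) / norm v"
      by (simp add: u_def matrix_vector_scaleR divide_inverse_commute)
    moreover have "norm v * (2 * r ^ n) \<le> norm v * norm (?P *v (L x n *v u))"
      using xn(2) by (intro mult_left_mono) auto
    ultimately show ?thesis using v(2) by (intro exI[of _ x] exI[of _ n]) (auto simp: mult.commute)
  qed
  obtain a where a: "a \<notin> V" using ne by blast
  define u where "u = ?P *v a"
  have u0: "u \<noteq> 0" using a Q(2)[of a] by (auto simp: u_def matrix_vector_mult_diff_rdistrib)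
  have Qu: "Q *v u = 0" using QP by (simp add: u_def)
  have Pu: "?P *v u = u" using Qu by (simp add: matrix_vector_mult_diff_rdistrib)
  \<comment> \<open>The bound \<open>k \<le> t\<close> makes the times tend to infinity;
    \<open>t \<le> k * N\<close> turns the k doublings into an exponential rate per unit of
    time.\<close>
  have grow: "\<exists>x t. k \<le> t \<and> t \<le> k * N \<and> 2 ^ k * r ^ t * norm u \<le> norm (?P *v (L x t *v u))" for k
  proof (induction k)
    case 0
    then show ?case by (intro exI[of _ undefined] exI[of _ 0]) (simp add: Pu)
  next
    case (Suc k)
    then obtain x t where xt: "k \<le> t" "t \<le> k * N" "2 ^ k * r ^ t * norm u \<le> norm (?P *v (L x t *v u))"
      by blast
    let ?w = "?P *v (L x t *v u)"
    have "0 < 2 ^ k * r ^ t * norm u" using u0 jsr_pos by simp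
    then have "?w \<noteq> 0" using xt(3) by auto
    then obtain y n where yn: "1 \<le> n" "n \<le> N" "2 * r ^ n * norm ?w \<le> norm (?P *v (L y n *v ?w))"
      using step[OF QP] by blast
    obtain z where z: "L z (t + n) = L y n ** L x t" by (rule cocycle_mult_eq_cocycle)
    have "?P *v (L y n *v ?w) = ?P *v (L z (t + n) *v u)"
      by (simp add: projection_cocycle[OF Q] z matrix_vector_mul_assoc[symmetric])
    moreover have "2 * r ^ n * (2 ^ k * r ^ t * norm u) \<le> 2 * r ^ n * norm ?w"
      using xt(3) jsr_pos by (intro mult_left_mono) auto
    ultimately have "2 ^ Suc k * r ^ (t + n) * norm u \<le> norm (?P *v (L z (t + n) *v u))"
      using yn(3) by (simp add: power_add mult_ac)
    then show ?case using xt yn by (intro exI[of _ z] exI[of _ "t + n"]) auto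
  qed
  \<comment> \<open>Doubling at least once every \<open>N\<close> steps means extra growth
    \<open>exp (t * b)\<close>. Half of \<open>b\<close> exceeds what \<open>sup_norm\<close> allows
    for large t, the other half absorbs the norm of \<open>mat 1 - Q\<close>.\<close>
  define b where "b = ln 2 / real N"
  have b: "0 < b" using N1 by (simp add: b_def)
  have Ppos: "0 < mat_onorm ?P"
  proof (rule ccontr)
    assume "\<not> 0 < mat_onorm ?P"
    then have "mat_onorm ?P = 0" using mat_onorm_nonneg[of ?P] by linarith
    then show False using norm_matrix_vector_le[of ?P u] Pu u0 by simp
  qed
  have "\<forall>\<^sub>F t in sequentially. ln (sup_norm t) / t < ln r + b / 2"
    using ln_sup_norm_LIMSEQ b by (intro order_tendstoD(2)) auto
  moreover have "(\<lambda>t. ln (mat_onorm ?P) / real t) \<longlonglongrightarrow> 0"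
    by (intro tendsto_divide_0[OF tendsto_const] filterlim_at_top_imp_at_infinity filterlim_real_sequentially)
  then have "\<forall>\<^sub>F t in sequentially. ln (mat_onorm ?P) / real t < b / 2"
    using b by (intro order_tendstoD(2)) auto
  ultimately have "\<forall>\<^sub>F t in sequentially. 1 \<le> t \<and> ln (sup_norm t) / t < ln r + b / 2 \<and> ln (mat_onorm ?P) / t < b / 2"
    using eventually_ge_at_top[of 1] by eventually_elim auto
  then obtain k where k: "\<And>t. k \<le> t \<Longrightarrow> 1 \<le> t \<and> ln (sup_norm t) / t < ln r + b / 2 \<and> ln (mat_onorm ?P) / t < b / 2"
    by (auto simp: eventually_sequentially)
  obtain x t where xt: "k \<le> t" "t \<le> k * N" "2 ^ k * r ^ t * norm u \<le> norm (?P *v (L x t *v u))"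
    using grow by blast
  have t: "1 \<le> t" using k xt(1) by blast
  have "2 ^ k * r ^ t * norm u \<le> mat_onorm ?P * (mat_onorm (L x t) * norm u)"
    using xt(3) norm_matrix_vector_le[of ?P "L x t *v u"] norm_matrix_vector_le[of "L x t" u] Ppos
    by (meson less_imp_le mult_left_mono order_trans)
  also have "\<dots> \<le> mat_onorm ?P * (sup_norm t * norm u)"
    using Ppos by (intro mult_left_mono mult_right_mono norm_le_sup_norm) auto
  finally have "2 ^ k * r ^ t \<le> mat_onorm ?P * sup_norm t" using u0 by simp
  then have "ln (2 ^ k * r ^ t) \<le> ln (mat_onorm ?P * sup_norm t)"
    using Ppos sup_norm_pos[of t] jsr_pos by simp
  then have "k * ln 2 + t * ln r \<le> ln (mat_onorm ?P) + ln (sup_norm t)"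
    using Ppos sup_norm_pos[of t] jsr_pos by (simp add: ln_mult ln_realpow)
  moreover have "t * b \<le> k * ln 2"
  proof -
    have "real t \<le> real k * real N" using xt(2) by (metis of_nat_le_iff of_nat_mult)
    then have "real t * ln 2 \<le> real k * real N * ln 2" by (intro mult_right_mono) auto
    then show ?thesis using N1 by (simp add: b_def field_simps)
  qed
  moreover have "ln (sup_norm t) < t * (ln r + b / 2)" "ln (mat_onorm ?P) < t * (b / 2)"
    using k[OF xt(1)] t by (auto simp: field_simps)
  ultimately show False by (simp add: algebra_simps)
qed

end

lemma seminorm_le_norm:
  fixes p :: "'a::euclidean_space \<Rightarrow> real"
  assumes tri: "\<And>v w. p (v + w) \<le> p v + p w" and hom: "\<And>c v. p (c *\<^sub>R v) \<le> \<bar>c\<bar> * p v"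
    and nonneg: "\<And>v. 0 \<le> p v"
  obtains C where "0 < C" "\<And>v. p v \<le> C * norm v"
proof
  show "0 < (\<Sum>b\<in>Basis. p b) + 1" by (simp add: add_nonneg_pos sum_nonneg nonneg)
  fix v :: 'a
  have p0: "p 0 = 0" using hom[of 0 0] nonneg[of 0] by simp
  have "p (\<Sum>b\<in>F. (v \<bullet> b) *\<^sub>R b) \<le> (\<Sum>b\<in>F. \<bar>v \<bullet> b\<bar> * p b)" if "finite F" for F
    using that
  proof induction
    case (insert b F)
    then show ?case using tri[of "(v \<bullet> b) *\<^sub>R b" "\<Sum>b\<in>F. (v \<bullet> b) *\<^sub>R b"] hom[of "v \<bullet> b" b] by simp
  qed (simp add: p0)
  from this[of Basis] have "p v \<le> (\<Sum>b\<in>Basis. \<bar>v \<bullet> b\<bar> * p b)" by (simp add: euclidean_representation)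
  also have "\<dots> \<le> (\<Sum>b\<in>Basis. norm v * p b)"
    by (intro sum_mono mult_right_mono nonneg Basis_le_norm)
  also have "\<dots> = (\<Sum>b\<in>Basis. p b) * norm v" by (simp add: sum_distrib_left[symmetric] mult.commute)
  also have "\<dots> \<le> ((\<Sum>b\<in>Basis. p b) + 1) * norm v" by (intro mult_right_mono) auto
  finally show "p v \<le> ((\<Sum>b\<in>Basis. p b) + 1) * norm v" .
qed

section \<open>Extremal seminorms on the quotients of the flag\<close>

context matrix_cocycle
begin

text \<open>The second clause makes compressions multiply along the cocycle, as maps on a
  subquotient do. The third is extremality of \<open>p\<close>. The last one lifts eigenvalues from
  the subquotient to the whole space; it is restricted to nonzero c since a compression also
  vanishes on the kernel of \<open>T\<close>.\<close>

definition block :: "complex ^ 'd ^ 'd \<Rightarrow> (complex ^ 'd \<Rightarrow> real) \<Rightarrow> bool" where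
  "block T p \<longleftrightarrow> (\<exists>lo hi. projected_seminorm T p lo hi) \<and>
     (\<forall>x n y m v. T *v (L y m *v (L x n *v (T *v v))) = T *v (L y m *v (T *v (L x n *v (T *v v))))) \<and>
     (\<forall>i v. p (A i *v (T *v v)) \<le> r * p v) \<and>
     (\<forall>x n c v. c \<noteq> 0 \<longrightarrow> v \<noteq> 0 \<longrightarrow> T *v (L x n *v (T *v v)) = c *s v \<longrightarrow>
        (\<exists>w. w \<noteq> 0 \<and> L x n *v w = c *s w))"

lemma block_op_mult:
  assumes "block T p"
  shows "op_seminorm T p (L x (n + m)) \<le> op_seminorm T p (L ((shift ^^ n) x) m) * op_seminorm T p (L x n)"
proof -
  obtain lo hi where "projected_seminorm T p lo hi" using assms by (auto simp: block_def)
  then interpret projected_seminorm T p lo hi .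
  show ?thesis
  proof (rule op_seminorm_least)
    let ?B = "L ((shift ^^ n) x) m" and ?C = "L x n"
    show "0 \<le> op_seminorm T p ?B * op_seminorm T p ?C" by (intro mult_nonneg_nonneg op_seminorm_nonneg)
    fix v
    have "p (L x (n + m) *v (T *v v)) = p (?B *v (T *v (?C *v (T *v v))))"
    proof (rule cong)
      show "T *v (L x (n + m) *v (T *v v)) = T *v (?B *v (T *v (?C *v (T *v v))))"
        using assms unfolding block_def cocycle_add matrix_vector_mul_assoc[symmetric] by blast
    qed
    also have "\<dots> \<le> op_seminorm T p ?B * p (?C *v (T *v v))" by (rule le_op_seminorm)
    also have "\<dots> \<le> op_seminorm T p ?B * (op_seminorm T p ?C * p v)"
      by (intro mult_left_mono le_op_seminorm op_seminorm_nonneg)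
    finally show "p (L x (n + m) *v (T *v v)) \<le> op_seminorm T p ?B * op_seminorm T p ?C * p v"
      by (simp add: mult.assoc)
  qed
qed

lemma block_op_le:
  assumes "block T p"
  shows "op_seminorm T p (L x n) \<le> r ^ n"
proof -
  obtain lo hi where "projected_seminorm T p lo hi" using assms by (auto simp: block_def)
  then interpret projected_seminorm T p lo hi .
  show ?thesis
  proof (induction n)
    case 0
    show ?case by (rule op_seminorm_least) (auto simp: proj)
  next
    case (Suc n)
    have "op_seminorm T p (L ((shift ^^ n) x) 1) \<le> r"
      by (rule op_seminorm_least) (use assms jsr_pos in \<open>auto simp: block_def\<close>)
    then have "op_seminorm T p (L ((shift ^^ n) x) 1) * op_seminorm T p (L x n) \<le> r * r ^ n"
      using Suc jsr_pos by (intro mult_mono op_seminorm_nonneg) auto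
    then show ?case using block_op_mult[OF assms, of x n 1] by simp
  qed
qed

text \<open>The seminorm is the supremum over all orbits of the norm modulo \<open>V\<close> divided
  by \<open>r ^ n\<close>, finite by the definition of \<open>bounded_orbits\<close>. One step along
  \<open>A i\<close> only passes to tails of orbits, so it multiplies this supremum by at most
  \<open>r\<close>, with no further constant.\<close>

lemma bounded_orbits_block:
  assumes V: "invariant_subspace V" and Q: "\<And>v. Q *v v \<in> V" "\<And>v. v \<in> V \<Longrightarrow> Q *v v = v"
  obtains T p where "block T p" "\<And>v. v \<in> V \<Longrightarrow> T *v v = 0"
    "\<And>v. v \<in> bounded_orbits Q \<Longrightarrow> T *v v = v - Q *v v"
proof -
  note VQ = V Q
  let ?P = "mat 1 - Q" and ?W = "bounded_orbits Q"
  have W: "invariant_subspace ?W" "V \<subseteq> ?W"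
    using bounded_orbits_subspace[OF VQ] by auto
  have subW: "vec.subspace ?W" using W(1) by (simp add: invariant_subspace_def)
  obtain R where R: "\<And>v. R *v v \<in> ?W" "\<And>v. v \<in> ?W \<Longrightarrow> R *v v = v"
    using matrix_projection_exists[OF subW] by blast
  \<comment> \<open>First project onto the larger subspace, then remove the component in
    \<open>V\<close>: the range of \<open>T\<close> is a complement of \<open>V\<close> in
    \<open>bounded_orbits Q\<close>.\<close>
  define T where "T = R - Q ** R"
  have T: "T *v v = R *v v - Q *v (R *v v)" for v
    by (simp add: T_def matrix_vector_mult_diff_rdistrib matrix_vector_mul_assoc)
  have TW: "T *v v \<in> ?W" for v
    unfolding T using R(1) Q(1) W(2) by (intro vec.subspace_diff[OF subW]) auto
  have QT: "Q *v (T *v v) = 0" for v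
    using Q(2)[OF Q(1)] by (simp add: T matrix_vector_mult_diff_distrib)
  have RT: "R *v (T *v v) = T *v v" for v by (rule R(2)[OF TW])
  have onW: "T *v v = v - Q *v v" if "v \<in> ?W" for v by (simp add: T R(2)[OF that])
  have onV: "T *v v = 0" if "v \<in> V" for v using onW that W(2) Q(2)[OF that] by auto
  have PL0: "?P *v (L x n *v (Q *v v)) = 0" for x n v
    using Q(2)[OF invariant_subspace_cocycle[OF V Q(1)[of v], of x n]]
    by (simp add: matrix_vector_mult_diff_rdistrib)
  define f where "f v = (\<lambda>(x, n). norm (?P *v (L x n *v (R *v v))) / r ^ n)" for v
  define p where "p v = (SUP q. f v q)" for v
  have bdd: "bdd_above (range (f v))" for v
  proof -
    obtain K where "\<And>x n. norm (?P *v (L x n *v (R *v v))) \<le> K * r ^ n"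
      using R(1)[of v] by (auto simp: bounded_orbits_def)
    then show ?thesis using jsr_pos
      by (intro bdd_aboveI2[of _ _ K]) (auto simp: f_def divide_le_eq)
  qed
  have le_p: "f v q \<le> p v" for v q unfolding p_def by (rule cSUP_upper[OF _ bdd]) simp
  have p_least: "p v \<le> K" if "\<And>x n. f v (x, n) \<le> K" for v K
    unfolding p_def by (rule cSUP_least) (use that in auto)
  have f0: "0 \<le> f v q" for v q using jsr_pos by (auto simp: f_def split: prod.split)
  have p0: "0 \<le> p v" for v using f0[of v undefined] le_p[of v undefined] by linarith
  have tri: "p (v + w) \<le> p v + p w" for v w
  proof (rule p_least)
    fix x n
    have "norm (?P *v (L x n *v (R *v (v + w)))) \<le> norm (?P *v (L x n *v (R *v v))) + norm (?P *v (L x n *v (R *v w)))"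
      unfolding matrix_vector_right_distrib by (rule norm_triangle_ineq)
    then have "f (v + w) (x, n) \<le> f v (x, n) + f w (x, n)"
      using jsr_pos by (simp add: f_def add_divide_distrib[symmetric] divide_right_mono)
    then show "f (v + w) (x, n) \<le> p v + p w" using le_p[of v "(x, n)"] le_p[of w "(x, n)"] by linarith
  qed
  have hom: "p (c *\<^sub>R v) \<le> \<bar>c\<bar> * p v" for c v
  proof (rule p_least)
    fix x n
    have "f (c *\<^sub>R v) (x, n) = \<bar>c\<bar> * f v (x, n)" by (simp add: f_def matrix_vector_scaleR)
    then show "f (c *\<^sub>R v) (x, n) \<le> \<bar>c\<bar> * p v" by (simp add: le_p mult_left_mono)
  qed
  have "f (T *v v) = f v" for v
  proof -
    have "?P *v (L x n *v (R *v (T *v v))) = ?P *v (L x n *v (R *v v))" for x n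
      unfolding RT unfolding T by (simp add: matrix_vector_mult_diff_distrib PL0)
    then show ?thesis by (simp add: f_def)
  qed
  then have pT: "p (T *v v) = p v" for v by (simp add: p_def)
  obtain C where C: "0 < C" "\<And>v. p v \<le> C * norm v" using seminorm_le_norm[of p, OF tri hom p0] by blast
  have ps: "projected_seminorm T p 1 C"
  proof
    show "T *v (T *v v) = T *v v" for v using onW[OF TW[of v]] QT by simp
    show "1 * norm (T *v v) \<le> p v" for v
      using le_p[of v "(undefined, 0)"] by (simp add: f_def T matrix_vector_mult_diff_rdistrib)
    show "p v \<le> C * norm (T *v v)" for v using C(2)[of "T *v v"] by (simp add: pT)
  qed (use tri C in auto)
  have invW: "L x n *v v \<in> ?W" if "v \<in> ?W" for x n v by (rule invariant_subspace_cocycle[OF W(1) that])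
  have "block T p"
    unfolding block_def
  proof (intro conjI allI impI)
    show "\<exists>lo hi. projected_seminorm T p lo hi" using ps by blast
  next
    fix x n y m v
    let ?w = "L x n *v (T *v v)"
    have "?w \<in> ?W" by (rule invW[OF TW])
    then have "?w = T *v ?w + Q *v ?w" by (simp add: onW)
    then have "T *v (L y m *v ?w) = T *v (L y m *v (T *v ?w + Q *v ?w))" by simp
    also have "\<dots> = T *v (L y m *v (T *v ?w))"
      using onV[OF invariant_subspace_cocycle[OF V Q(1)]] by (simp add: matrix_vector_right_distrib)
    finally show "T *v (L y m *v ?w) = T *v (L y m *v (T *v ?w))" .
  next
    fix i v
    have AT: "A i *v (T *v v) \<in> ?W" using W(1) TW by (auto simp: invariant_subspace_def)
    show "p (A i *v (T *v v)) \<le> r * p v"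
    proof (rule p_least)
      fix x n
      obtain z where z: "L z (1 + n) = L x n ** L (\<lambda>_. i) 1"
        using cocycle_mult_eq_cocycle[of A 1 n x "\<lambda>_. i"] by metis
      have "L z (Suc n) *v (T *v v) = L x n *v (A i *v (T *v v))"
        using arg_cong[OF z, of "\<lambda>B. B *v (T *v v)"] by (simp add: matrix_vector_mul_assoc[symmetric])
      then have "L x n *v (R *v (A i *v (T *v v))) = L z (Suc n) *v (R *v (T *v v))"
        by (simp only: R(2)[OF AT] RT)
      then have "f (A i *v (T *v v)) (x, n) = r * f (T *v v) (z, Suc n)"
        using jsr_pos by (simp add: f_def field_simps)
      also have "\<dots> \<le> r * p (T *v v)" using jsr_pos by (intro mult_left_mono le_p) auto
      finally show "f (A i *v (T *v v)) (x, n) \<le> r * p v" by (simp add: pT)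
    qed
  next
    fix x n c and v :: "complex ^ 'd"
    assume c: "c \<noteq> 0" and v: "v \<noteq> 0" "T *v (L x n *v (T *v v)) = c *s v"
    define B where "B = L x n"
    interpret projected_seminorm T p 1 C by (rule ps)
    have "c *s (T *v v) = c *s v" using idem[of "B *v (T *v v)"] v(2) by (simp add: B_def vec.scale)
    then have Tv: "T *v v = v" using c by (simp add: vec.scale_left_imp_eq vector_mul_lcancel)
    then have vW: "v \<in> ?W" using TW by metis
    \<comment> \<open>The failure of \<open>v\<close> to be an eigenvector of \<open>B\<close>. It
      vanishes modulo \<open>V\<close>, so it lies in \<open>V\<close>, and \<open>v\<close> has to
      be corrected by an element of \<open>V\<close>.\<close>
    define u where "u = B *v v - c *s v"
    have "u \<in> ?W" unfolding u_def B_def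
      by (intro vec.subspace_diff[OF subW] vec.subspace_scale[OF subW] invW vW)
    moreover have "T *v u = 0" using v(2) Tv by (simp add: u_def B_def matrix_vector_mult_diff_distrib vec.scale)
    ultimately have uV: "Q *v u = u" using onW by simp
    have VV: "B *v w - c *s w \<in> V" if "w \<in> V" for w
      using V that unfolding B_def invariant_subspace_def
      by (intro vec.subspace_diff vec.subspace_scale invariant_subspace_cocycle[OF V]) auto
    show "\<exists>w. w \<noteq> 0 \<and> L x n *v w = c *s w"
    proof (cases "\<exists>w\<in>V. w \<noteq> 0 \<and> B *v w = c *s w")
      case True
      then show ?thesis by (auto simp: B_def)
    next
      case False
      \<comment> \<open>If c is not an eigenvalue of \<open>B\<close> on \<open>V\<close>, then
        \<open>B - mat c\<close> is invertible on \<open>V\<close>. Extending it by the identity on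
        the kernel of \<open>Q\<close> gives an invertible matrix of full size, which solves for the
        correction w.\<close>
      define F where "F = (B - mat c) ** Q + (mat 1 - Q)"
      have F: "F *v y = (B *v (Q *v y) - c *s (Q *v y)) + (y - Q *v y)" for y
        by (simp add: F_def matrix_vector_mult_add_rdistrib matrix_vector_mul_assoc[symmetric]
              matrix_vector_mult_diff_rdistrib mat_vector_mult)
      have QF: "Q *v (F *v y) = B *v (Q *v y) - c *s (Q *v y)" for y
        using Q(2)[OF VV[OF Q(1)[of y]]] Q(2)[OF Q(1)[of y]]
        by (simp add: F matrix_vector_right_distrib matrix_vector_mult_diff_distrib)
      have "y = 0" if "F *v y = 0" for y
      proof -
        have "B *v (Q *v y) = c *s (Q *v y)" using QF[of y] that by simp
        then have "Q *v y = 0" using False Q(1) by blast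
        then show ?thesis using that by (simp add: F)
      qed
      then obtain F' where F': "F' ** F = mat 1" using matrix_left_invertible_ker by blast
      then have "F ** F' = mat 1" by (simp add: matrix_left_right_inverse)
      define y where "y = F' *v u"
      have Fy: "F *v y = u" using \<open>F ** F' = mat 1\<close> by (simp add: y_def matrix_vector_mul_assoc)
      define w where "w = Q *v y"
      have "B *v w - c *s w = u" using QF[of y] by (simp add: Fy uV w_def)
      then have "B *v (v - w) = c *s (v - w)"
        by (simp add: u_def matrix_vector_mult_diff_distrib algebra_simps vec.scale_right_diff_distrib)
      moreover have "v - w \<noteq> 0" using onV[of w] Q(1)[of y] Tv v(1) by (auto simp: w_def)
      ultimately show ?thesis unfolding B_def by blast
    qed
  qed
  then show ?thesis using that onV onW by blast
qed

section \<open>Norms controlled by the maximum over the blocks\<close>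

definition op_max :: "((complex ^ 'd ^ 'd) \<times> (complex ^ 'd \<Rightarrow> real)) set \<Rightarrow> complex ^ 'd ^ 'd \<Rightarrow> real" where
  "op_max \<Phi> B = Max (insert 0 ((\<lambda>(T, p). op_seminorm T p B) ` \<Phi>))"

lemma op_max_ge: "finite \<Phi> \<Longrightarrow> (T, p) \<in> \<Phi> \<Longrightarrow> op_seminorm T p B \<le> op_max \<Phi> B"
  unfolding op_max_def by (rule Max_ge) force+

lemma op_max_nonneg: "finite \<Phi> \<Longrightarrow> 0 \<le> op_max \<Phi> B"
  unfolding op_max_def by (rule Max_ge) auto

lemma op_max_insert_ge: "finite \<Phi> \<Longrightarrow> op_max \<Phi> B \<le> op_max (insert q \<Phi>) B"
  unfolding op_max_def by (rule Max_mono) auto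

text \<open>The upper bound holds everywhere but the lower one only on \<open>V\<close>. When
  \<open>V\<close> grows, the old function is reused after composition with \<open>Q\<close> and the
  new seminorm supplies the missing lower bound.\<close>

definition comparable_on :: "(complex ^ 'd) set \<Rightarrow> (complex ^ 'd \<Rightarrow> real) \<Rightarrow> real \<Rightarrow> real \<Rightarrow> bool" where
  "comparable_on V M c C \<longleftrightarrow> 0 < c \<and> 0 < C \<and> (\<forall>v w. M (v + w) \<le> M v + M w) \<and>
     (\<forall>v. 0 \<le> M v \<and> M v \<le> C * norm v) \<and> (\<forall>v\<in>V. c * norm v \<le> M v)"

text \<open>The order of quantifiers matters: the norm may change with the length \<open>m\<close>
  and the error \<open>\<eta>\<close>, which is what allows products that are not relatively
  bounded.\<close>

definition dominated :: "(complex ^ 'd) set \<Rightarrow> ((complex ^ 'd ^ 'd) \<times> (complex ^ 'd \<Rightarrow> real)) set \<Rightarrow> bool" where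
  "dominated V \<Phi> \<longleftrightarrow> (\<forall>m \<eta>. 0 < \<eta> \<longrightarrow> (\<exists>M c C. comparable_on V M c C \<and>
     (\<forall>x. \<forall>v\<in>V. M (L x m *v v) \<le> (op_max \<Phi> (L x m) + \<eta>) * M v)))"

text \<open>The off-diagonal parts of the cocycle are made negligible by giving the quotient
  a large weight \<open>K\<close> in the norm.\<close>

lemma dominated_step:
  assumes V: "invariant_subspace V" and Q: "\<And>v. Q *v v \<in> V" "\<And>v. v \<in> V \<Longrightarrow> Q *v v = v"
    and T: "block T p" "\<And>v. v \<in> V \<Longrightarrow> T *v v = 0" "\<And>v. v \<in> bounded_orbits Q \<Longrightarrow> T *v v = v - Q *v v"
    and fin: "finite \<Phi>" and dom: "dominated V \<Phi>"
  shows "dominated (bounded_orbits Q) (insert (T, p) \<Phi>)"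
  unfolding dominated_def
proof (intro allI impI)
  fix m and \<eta> :: real assume \<eta>: "0 < \<eta>"
  obtain lo hi where "projected_seminorm T p lo hi" using T(1) by (auto simp: block_def)
  then interpret projected_seminorm T p lo hi .
  obtain M c C where M': "comparable_on V M c C"
      "\<forall>x. \<forall>v\<in>V. M (L x m *v v) \<le> (op_max \<Phi> (L x m) + \<eta>) * M v"
    using dom \<eta> unfolding dominated_def by blast
  then have M: "0 < c" "0 < C" "\<And>v w. M (v + w) \<le> M v + M w" "\<And>v. 0 \<le> M v" "\<And>v. M v \<le> C * norm v"
     "\<And>v. v \<in> V \<Longrightarrow> c * norm v \<le> M v"
    by (auto simp: comparable_on_def)
  \<comment> \<open>\<open>D * p v\<close> bounds, uniformly in \<open>x\<close>, the part that
    \<open>L x m\<close> sends from the range of \<open>T\<close> into \<open>V\<close>. The weight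
    \<open>K\<close> below satisfies \<open>D \<le> K * \<eta>\<close>, so this part fits into the
    error \<open>\<eta>\<close> of the weighted term \<open>K * p v\<close>.\<close>
  define D where "D = C * (mat_onorm Q * (sup_norm m * (1 / lo)))"
  have D: "0 \<le> D" using M(2) lo(1) mat_onorm_nonneg[of Q] sup_norm_nonneg[of m] by (simp add: D_def)
  define K where "K = D / \<eta> + 1"
  have K: "1 \<le> K" "D \<le> K * \<eta>" using D \<eta> by (auto simp: K_def field_simps)
  define M' where "M' v = K * p v + M (Q *v v)" for v
  let ?c = "1 / (1 / c + 1 / lo)" and ?C = "K * (hi * mat_onorm T) + C * mat_onorm Q + 1"
  show "\<exists>M c C. comparable_on (bounded_orbits Q) M c C \<and>
     (\<forall>x. \<forall>v\<in>bounded_orbits Q. M (L x m *v v) \<le> (op_max (insert (T, p) \<Phi>) (L x m) + \<eta>) * M v)"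
    unfolding comparable_on_def
  proof (rule exI[of _ M'], rule exI[of _ ?c], rule exI[of _ ?C], intro conjI allI ballI)
    show "0 < ?c" using M(1) lo(1) by (simp add: add_pos_pos)
    show "0 < ?C" using K(1) hi(1) M(2) mat_onorm_nonneg[of T] mat_onorm_nonneg[of Q]
      by (intro add_nonneg_pos add_nonneg_nonneg mult_nonneg_nonneg) auto
    show "M' (v + w) \<le> M' v + M' w" for v w
    proof -
      have "K * p (v + w) \<le> K * (p v + p w)" using K(1) triangle[of v w] by (intro mult_left_mono) auto
      then show ?thesis using M(3)[of "Q *v v" "Q *v w"]
        by (simp add: M'_def matrix_vector_right_distrib distrib_left)
    qed
    show "0 \<le> M' v" for v using K(1) nonneg[of v] M(4) by (simp add: M'_def)
    show "M' v \<le> ?C * norm v" for v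
    proof -
      have "K * p v \<le> K * (hi * (mat_onorm T * norm v))"
        using K(1) hi(1) by (intro mult_left_mono order_trans[OF hi(2)] norm_matrix_vector_le) auto
      moreover have "M (Q *v v) \<le> C * (mat_onorm Q * norm v)"
        using M(2) by (intro order_trans[OF M(5)] mult_left_mono norm_matrix_vector_le) auto
      ultimately have "M' v \<le> K * (hi * (mat_onorm T * norm v)) + C * (mat_onorm Q * norm v)"
        by (simp add: M'_def)
      also have "\<dots> \<le> ?C * norm v" by (simp add: algebra_simps)
      finally show ?thesis .
    qed
    fix v assume v: "v \<in> bounded_orbits Q"
    have vs: "v = T *v v + Q *v v" using T(3)[OF v] by simp
    have pv: "0 \<le> p v" and Mv: "0 \<le> M (Q *v v)" using nonneg M(4) by auto
    show "?c * norm v \<le> M' v"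
    proof -
      have "norm v \<le> norm (T *v v) + norm (Q *v v)" using norm_triangle_ineq[of "T *v v" "Q *v v"] vs by simp
      also have "\<dots> \<le> p v / lo + M (Q *v v) / c"
        using lo M(1) M(6)[OF Q(1)[of v]] by (intro add_mono) (auto simp: field_simps)
      also have "\<dots> \<le> M' v / lo + M' v / c"
      proof (intro add_mono divide_right_mono)
        show "p v \<le> M' v" using mult_right_mono[OF K(1) pv] Mv by (simp add: M'_def)
        show "M (Q *v v) \<le> M' v" using K(1) pv by (simp add: M'_def)
      qed (use lo(1) M(1) in auto)
      also have "\<dots> = (1 / c + 1 / lo) * M' v" by (simp add: distrib_right)
      finally have "norm v \<le> (1 / c + 1 / lo) * M' v" .
      moreover have "0 < 1 / c + 1 / lo" using M(1) lo(1) by (simp add: add_pos_pos)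
      ultimately show ?thesis by (simp add: pos_divide_le_eq mult.commute)
    qed
    fix x
    let ?B = "L x m" and ?\<mu> = "op_max (insert (T, p) \<Phi>) (L x m)"
    have BV: "?B *v (Q *v v) \<in> V" by (rule invariant_subspace_cocycle[OF V Q(1)])
    have Bv: "?B *v v = ?B *v (T *v v) + ?B *v (Q *v v)"
      using arg_cong[OF vs, of "(*v) ?B"] by (simp add: matrix_vector_right_distrib)
    have "p (?B *v v) = p (?B *v (T *v v))"
      by (rule cong) (simp add: Bv matrix_vector_right_distrib T(2)[OF BV])
    also have "\<dots> \<le> op_seminorm T p ?B * p v" by (rule le_op_seminorm)
    also have "\<dots> \<le> ?\<mu> * p v" using fin pv by (intro mult_right_mono op_max_ge) auto
    finally have 1: "p (?B *v v) \<le> ?\<mu> * p v" .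
    have "M (Q *v (?B *v v)) \<le> M (Q *v (?B *v (T *v v))) + M (Q *v (?B *v (Q *v v)))"
      unfolding Bv matrix_vector_right_distrib[of Q] by (rule M(3))
    moreover have "M (Q *v (?B *v (Q *v v))) \<le> (?\<mu> + \<eta>) * M (Q *v v)"
    proof -
      have "M (Q *v (?B *v (Q *v v))) \<le> (op_max \<Phi> ?B + \<eta>) * M (Q *v v)"
        using M'(2) Q(1)[of v] Q(2)[OF BV] by simp
      also have "\<dots> \<le> (?\<mu> + \<eta>) * M (Q *v v)"
        using fin by (intro mult_right_mono M(4)) (simp add: op_max_insert_ge)
      finally show ?thesis .
    qed
    moreover have "M (Q *v (?B *v (T *v v))) \<le> D * p v"
    proof -
      have Tv: "norm (T *v v) \<le> 1 / lo * p v" using lo(1) lo(2)[of v] by (simp add: field_simps)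
      have "norm (?B *v (T *v v)) \<le> mat_onorm ?B * norm (T *v v)" by (rule norm_matrix_vector_le)
      also have "\<dots> \<le> sup_norm m * (1 / lo * p v)"
        by (intro mult_mono norm_le_sup_norm Tv sup_norm_nonneg) auto
      finally have "norm (Q *v (?B *v (T *v v))) \<le> mat_onorm Q * (sup_norm m * (1 / lo * p v))"
        by (rule order_trans[OF norm_matrix_vector_le mult_left_mono[OF _ mat_onorm_nonneg]])
      then have "C * norm (Q *v (?B *v (T *v v))) \<le> C * (mat_onorm Q * (sup_norm m * (1 / lo * p v)))"
        using M(2) by (intro mult_left_mono) auto
      then show ?thesis using M(5)[of "Q *v (?B *v (T *v v))"] by (simp add: D_def mult.assoc)
    qed
    moreover have "D * p v \<le> K * \<eta> * p v" using K(2) pv by (intro mult_right_mono)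
    moreover have "K * p (?B *v v) \<le> K * (?\<mu> * p v)" using 1 K(1) by (intro mult_left_mono) auto
    ultimately show "M' (?B *v v) \<le> (?\<mu> + \<eta>) * M' v"
      by (simp add: M'_def algebra_simps)
  qed
qed

lemma dominating_blocks_exist:
  obtains \<Phi> where "finite \<Phi>" "\<And>T p. (T, p) \<in> \<Phi> \<Longrightarrow> block T p" "dominated UNIV \<Phi>"
proof -
  have "\<exists>\<Phi>. finite \<Phi> \<and> (\<forall>(T, p)\<in>\<Phi>. block T p) \<and> dominated UNIV \<Phi>"
    if "invariant_subspace V" "finite \<Phi>" "\<forall>(T, p)\<in>\<Phi>. block T p" "dominated V \<Phi>" for V \<Phi>
    using that
  proof (induction "CARD('d) - vec.dim V" arbitrary: V \<Phi> rule: less_induct)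
    case less
    show ?case
    proof (cases "V = UNIV")
      case True
      then show ?thesis using less.prems by blast
    next
      case False
      have V: "invariant_subspace V" by fact
      then have sub: "vec.subspace V" by (simp add: invariant_subspace_def)
      obtain Q where Q: "\<And>v. Q *v v \<in> V" "\<And>v. v \<in> V \<Longrightarrow> Q *v v = v"
        using matrix_projection_exists[OF sub] by blast
      obtain T p where T: "block T p" "\<And>v. v \<in> V \<Longrightarrow> T *v v = 0"
          "\<And>v. v \<in> bounded_orbits Q \<Longrightarrow> T *v v = v - Q *v v"
        using bounded_orbits_block[OF V Q] by blast
      have W: "invariant_subspace (bounded_orbits Q)" "V \<subseteq> bounded_orbits Q" "V \<noteq> bounded_orbits Q"
        using bounded_orbits_subspace[OF V Q] bounded_orbits_proper[OF V Q False] by auto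
      then have subW: "vec.subspace (bounded_orbits Q)" by (simp add: invariant_subspace_def)
      have "vec.dim V < vec.dim (bounded_orbits Q)"
        using W(2,3) by (intro vec.dim_psubset) (simp add: vec.span_eq_iff[THEN iffD2, OF sub] vec.span_eq_iff[THEN iffD2, OF subW] psubset_eq)
      moreover have "vec.dim (bounded_orbits Q) \<le> CARD('d)" using vec.dim_subset_UNIV[of "bounded_orbits Q"] by (simp add: vec.dimension_def card_cart_basis)
      ultimately show ?thesis
        using less.hyps[of "bounded_orbits Q" "insert (T, p) \<Phi>"] less.prems W(1) T(1)
          dominated_step[OF V Q T less.prems(2,4)] by auto
    qed
  qed
  moreover have "invariant_subspace {0}" by (simp add: invariant_subspace_def vec.subspace_0 vec.subspace_single_0)
  \<comment> \<open>Start of the flag: for the empty family \<open>op_max\<close> is 0 because of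
    the inserted 0, and on the zero space every estimate is trivial.\<close>
  moreover have "dominated {0} {}"
    unfolding dominated_def
    by (intro allI impI exI[of _ norm] exI[of _ 1])
       (auto simp: comparable_on_def norm_triangle_ineq)
  ultimately obtain \<Phi> where "finite \<Phi> \<and> (\<forall>(T, p)\<in>\<Phi>. block T p) \<and> dominated UNIV \<Phi>" by blast
  then show ?thesis using that by auto
qed

end

section \<open>Eigenvalues\<close>

lemma mat_eq_of_bool: "mat z = (\<chi> i j. of_bool (i = j) * z)"
  for z :: "'a::semiring_1"
  by (simp add: vec_eq_iff mat_def)

lemma eigenvalue_iff_det:
  fixes B :: "complex ^ 'd ^ 'd"
  shows "(\<exists>v. v \<noteq> 0 \<and> B *v v = c *s v) \<longleftrightarrow> det (mat c - B) = 0"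
proof -
  have "(mat c - B) *v v = 0 \<longleftrightarrow> B *v v = c *s v" for v
    by (auto simp: matrix_vector_mult_diff_rdistrib mat_vector_mult)
  moreover have "det (mat c - B) \<noteq> 0 \<longleftrightarrow> (\<forall>v. (mat c - B) *v v = 0 \<longrightarrow> v = 0)"
    by (simp add: invertible_det_nz[symmetric] invertible_left_inverse matrix_left_invertible_ker)
  ultimately show ?thesis by auto
qed

lemma holomorphic_char_poly: "(\<lambda>z. det (mat z - B)) holomorphic_on S"
  for B :: "complex ^ 'd ^ 'd"
proof -
  have "(mat z - B) $ i $ j = of_bool (i = j) * z - B $ i $ j" for z i j
    by (simp add: mat_def)
  then show ?thesis unfolding det_def by (simp only:) (intro holomorphic_intros)
qed

lemma continuous_on_det [continuous_intros]:
  fixes f :: "'a::topological_space \<Rightarrow> complex ^ 'd ^ 'd"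
  shows "continuous_on S f \<Longrightarrow> continuous_on S (\<lambda>x. det (f x))"
  unfolding det_def by (intro continuous_intros)

lemma eigenvalue_le_onorm:
  fixes B :: "complex ^ 'd ^ 'd"
  assumes "det (mat c - B) = 0"
  shows "cmod c \<le> mat_onorm B"
proof -
  obtain v where v: "v \<noteq> 0" "B *v v = c *s v" using assms eigenvalue_iff_det by blast
  have "cmod c * norm v = norm (B *v v)" by (simp add: v norm_vec_def norm_mult L2_set_right_distrib)
  also have "\<dots> \<le> mat_onorm B * norm v" by (rule norm_matrix_vector_le)
  finally show ?thesis using v(1) by simp
qed

text \<open>The characteristic polynomial is treated as an entire function whose zeros lie in the
  disc of radius \<open>mat_onorm B\<close>. If it is constant, the constant is nonzero, because
  numbers beyond that disc are not eigenvalues. Finiteness gives meaning to the \<open>Max\<close>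
  in the spectral radius.\<close>

lemma finite_eigenvalues: "finite {c. det (mat c - B) = 0}"
  for B :: "complex ^ 'd ^ 'd"
proof (cases "(\<lambda>z. det (mat z - B)) constant_on UNIV")
  case True
  then obtain a where a: "\<And>z. det (mat z - B) = a" by (auto simp: constant_on_def)
  have "\<not> cmod (of_real (mat_onorm B + 1)) \<le> mat_onorm B"
    using mat_onorm_nonneg[of B] unfolding norm_of_real by simp
  then have "a \<noteq> 0" using eigenvalue_le_onorm a by blast
  then show ?thesis by (simp add: a)
next
  case False
  have "finite {z \<in> cball 0 (mat_onorm B). det (mat z - B) = 0}"
    by (rule holomorphic_compact_finite_zeros[OF holomorphic_char_poly _ _ _ _ False]) auto
  moreover have "{c. det (mat c - B) = 0} \<subseteq> {z \<in> cball 0 (mat_onorm B). det (mat z - B) = 0}"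
    using eigenvalue_le_onorm by auto
  ultimately show ?thesis by (rule finite_subset[rotated])
qed

text \<open>Without zeros, the reciprocal of the characteristic polynomial would be entire. It tends
  to 0 at infinity, since \<open>det (mat z - B)\<close> is \<open>z ^ CARD('d)\<close> times a
  factor tending to 1, and Liouville's theorem makes it vanish identically.\<close>

lemma eigenvalue_exists:
  fixes B :: "complex ^ 'd ^ 'd"
  obtains c where "det (mat c - B) = 0"
proof (rule ccontr)
  assume "\<not> thesis"
  then have nz: "det (mat z - B) \<noteq> 0" for z using that by blast
  define h where "h z = inverse (det (mat z - B))" for z
  define g where "g w = det (\<chi> i j. of_bool (i = j) - w * B $ i $ j)" for w
  have "h holomorphic_on UNIV"
    unfolding h_def by (intro holomorphic_on_inverse holomorphic_char_poly) (use nz in auto)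
  moreover have "(h \<longlongrightarrow> 0) at_infinity"
  proof -
    have eq: "h z = inverse z ^ CARD('d) * inverse (g (inverse z))" if "z \<noteq> 0" for z
    proof -
      have "mat z - B = (\<chi> i. z *s (\<chi> j. of_bool (i = j) - inverse z * B $ i $ j))"
        using that by (simp add: vec_eq_iff mat_def right_diff_distrib)
      then have "det (mat z - B) = z ^ CARD('d) * g (inverse z)"
        unfolding g_def by (simp only: det_rows_mul) simp
      then show ?thesis by (simp add: h_def power_inverse)
    qed
    have "continuous_on UNIV g"
      unfolding g_def by (intro continuous_intros)
    then have "isCont g 0" by (simp add: continuous_on_eq_continuous_at)
    moreover have "g 0 = 1"
      using det_I[where 'a = complex and 'n = 'd] by (simp add: g_def mat_def of_bool_def)
    ultimately have "((\<lambda>z. g (inverse z)) \<longlongrightarrow> 1) at_infinity"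
      using isCont_tendsto_compose[OF _ tendsto_inverse_0] by metis
    then have "((\<lambda>z. inverse z ^ CARD('d) * inverse (g (inverse z))) \<longlongrightarrow> 0 ^ CARD('d) * inverse 1) at_infinity"
      by (intro tendsto_intros tendsto_inverse_0) auto
    then have "((\<lambda>z. inverse z ^ CARD('d) * inverse (g (inverse z))) \<longlongrightarrow> 0) at_infinity" by (simp add: power_0_left)
    moreover have "\<forall>\<^sub>F z in at_infinity. inverse z ^ CARD('d) * inverse (g (inverse z)) = h z"
      using eventually_not_equal_at_infinity[of 0] by eventually_elim (simp add: eq)
    ultimately show ?thesis by (rule Lim_transform_eventually)
  qed
  ultimately have "h 0 = 0" by (rule Liouville_weak_0)
  then show False using nz[of 0] by (simp add: h_def)
qed

lemma mat_spectral_radius_altdef: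
  "mat_spectral_radius B = Max (cmod ` {c. det (mat c - B) = 0})"
  for B :: "complex ^ 'd ^ 'd"
  unfolding mat_spectral_radius_def eigenvalue_iff_det by (simp add: setcompr_eq_image)

lemma mat_spectral_radius_ge: "det (mat c - B) = 0 \<Longrightarrow> cmod c \<le> mat_spectral_radius B"
  for B :: "complex ^ 'd ^ 'd"
  unfolding mat_spectral_radius_altdef by (rule Max_ge) (auto simp: finite_eigenvalues)

lemma mat_spectral_radius_attained:
  fixes B :: "complex ^ 'd ^ 'd"
  obtains c where "det (mat c - B) = 0" "cmod c = mat_spectral_radius B"
proof -
  obtain c0 where "det (mat c0 - B) = 0" by (rule eigenvalue_exists)
  then have "mat_spectral_radius B \<in> cmod ` {c. det (mat c - B) = 0}"
    unfolding mat_spectral_radius_altdef by (intro Max_in) (auto simp: finite_eigenvalues)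
  then show ?thesis using that by auto
qed

text \<open>By Hurwitz' theorem: if infinitely many characteristic functions had no zero near c,
  their limit would have none or be constant there. A constant limit would be 0 on a ball, giving
  \<open>E\<close> infinitely many eigenvalues.\<close>

lemma eigenvalues_lower_semicontinuous:
  fixes B :: "nat \<Rightarrow> complex ^ 'd ^ 'd"
  assumes lim: "B \<longlonglongrightarrow> E" and c: "det (mat c - E) = 0" and "0 < \<delta>"
  shows "\<forall>\<^sub>F k in sequentially. \<exists>z. cmod (z - c) < \<delta> \<and> det (mat z - B k) = 0"
proof (rule ccontr)
  assume "\<not> ?thesis"
  then have "\<exists>\<^sub>F k in sequentially. \<forall>z. cmod (z - c) < \<delta> \<longrightarrow> det (mat z - B k) \<noteq> 0"
    by (simp add: frequently_def)
  then have inf: "infinite {k. \<forall>z. cmod (z - c) < \<delta> \<longrightarrow> det (mat z - B k) \<noteq> 0}"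
    by (simp add: frequently_cofinite cofinite_eq_sequentially[symmetric])
  obtain s :: "nat \<Rightarrow> nat" where s: "strict_mono s"
    "\<And>k. s k \<in> {k. \<forall>z. cmod (z - c) < \<delta> \<longrightarrow> det (mat z - B k) \<noteq> 0}"
    using infinite_enumerate[OF inf] by blast
  have lims: "(\<lambda>k. B (s k)) \<longlonglongrightarrow> E" using LIMSEQ_subseq_LIMSEQ[OF lim s(1)] by (simp add: comp_def)
  have "det (mat c - E) \<noteq> 0"
  proof (rule Hurwitz_no_zeros[of "ball c \<delta>" "\<lambda>k z. det (mat z - B (s k))" "\<lambda>z. det (mat z - E)"])
    fix K :: "complex set" assume K: "compact K" "K \<subseteq> ball c \<delta>"
    \<comment> \<open>A convergent sequence together with its limit is compact; uniform continuity
      of the determinant on \<open>K \<times> ?M\<close> gives the convergence uniform in z that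
      Hurwitz' theorem requires.\<close>
    let ?M = "insert E (range (\<lambda>k. B (s k)))"
    have "compact (K \<times> ?M)" by (intro compact_Times K compact_sequence_with_limit lims)
    moreover have "continuous_on (K \<times> ?M) (\<lambda>q. det (mat (fst q) - snd q))"
      unfolding mat_eq_of_bool by (intro continuous_intros)
    ultimately have uc: "uniformly_continuous_on (K \<times> ?M) (\<lambda>q. det (mat (fst q) - snd q))"
      by (intro compact_uniformly_continuous)
    show "uniform_limit K (\<lambda>k z. det (mat z - B (s k))) (\<lambda>z. det (mat z - E)) sequentially"
    proof (rule uniform_limitI)
      fix e :: real assume "0 < e"
      with uc obtain d where d: "0 < d" "\<And>q q'. q \<in> K \<times> ?M \<Longrightarrow> q' \<in> K \<times> ?M \<Longrightarrow> dist q' q < d \<Longrightarrow>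
         dist (det (mat (fst q') - snd q')) (det (mat (fst q) - snd q)) < e"
        unfolding uniformly_continuous_on_def by metis
      have "\<forall>\<^sub>F k in sequentially. dist (B (s k)) E < d" using lims d(1) by (rule tendstoD)
      then show "\<forall>\<^sub>F k in sequentially. \<forall>z\<in>K. dist (det (mat z - B (s k))) (det (mat z - E)) < e"
      proof eventually_elim
        case (elim k)
        then show ?case using d(2)[of "(z, E)" "(z, B (s k))" for z] by (auto simp: dist_Pair_Pair)
      qed
    qed
  next
    show "\<not> (\<lambda>z. det (mat z - E)) constant_on ball c \<delta>"
    proof
      assume "(\<lambda>z. det (mat z - E)) constant_on ball c \<delta>"
      then have "ball c \<delta> \<subseteq> {z. det (mat z - E) = 0}"
        using c \<open>0 < \<delta>\<close> by (auto simp: constant_on_def)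
      then have "finite (ball c \<delta>)" using finite_eigenvalues finite_subset by blast
      then show False using \<open>0 < \<delta>\<close> uncountable_ball countable_finite by blast
    qed
  next
    show "det (mat z - B (s k)) \<noteq> 0" if "z \<in> ball c \<delta>" for k z
      using s(2)[of k] that by (simp add: dist_norm norm_minus_commute)
  qed (use \<open>0 < \<delta>\<close> in \<open>auto intro: holomorphic_char_poly\<close>)
  then show False using c by simp
qed

section \<open>Growth along invariant measures\<close>

lemma ereal_integral_ereal:
  fixes h :: "'a \<Rightarrow> real"
  assumes "integrable M h"
  shows "ereal_integral M (\<lambda>x. ereal (h x)) = ereal (integral\<^sup>L M h)"
proof -
  have "(\<integral>\<^sup>+ x. ennreal (h x) \<partial>M) \<noteq> \<infinity>" "(\<integral>\<^sup>+ x. ennreal (- h x) \<partial>M) \<noteq> \<infinity>"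
    using assms by (auto simp: real_integrable_def)
  then show ?thesis
    unfolding real_lebesgue_integral_def[OF assms] ereal_integral_def uminus_ereal.simps e2ennreal_ereal
    by (cases "\<integral>\<^sup>+ x. ennreal (h x) \<partial>M"; cases "\<integral>\<^sup>+ x. ennreal (- h x) \<partial>M")
       (auto simp: enn2ereal_ennreal)
qed

lemma ereal_integral_mono_AE:
  assumes "AE x in M. f x \<le> g x"
  shows "ereal_integral M f \<le> ereal_integral M g"
proof -
  have "(\<integral>\<^sup>+ x. e2ennreal (f x) \<partial>M) \<le> (\<integral>\<^sup>+ x. e2ennreal (g x) \<partial>M)"
    "(\<integral>\<^sup>+ x. e2ennreal (- g x) \<partial>M) \<le> (\<integral>\<^sup>+ x. e2ennreal (- f x) \<partial>M)"
    using assms by (auto intro!: nn_integral_mono_AE e2ennreal_mono elim!: eventually_mono)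
  then show ?thesis
    unfolding ereal_integral_def by (intro ereal_minus_mono) (simp_all add: less_eq_ennreal.rep_eq)
qed

text \<open>With its counterpart below, this confines the extended integral to comparisons with
  integrable real functions, so that -\<infinity> never needs separate arithmetic.\<close>

lemma ereal_integral_le:
  fixes h :: "'a \<Rightarrow> real"
  assumes "integrable M h" "AE x in M. f x \<le> ereal (h x)"
  shows "ereal_integral M f \<le> ereal (integral\<^sup>L M h)"
  using ereal_integral_mono_AE[OF assms(2)] ereal_integral_ereal[OF assms(1)] by simp

lemma ereal_integral_ge:
  fixes h :: "'a \<Rightarrow> real"
  assumes "integrable M h" "AE x in M. ereal (h x) \<le> f x"
  shows "ereal (integral\<^sup>L M h) \<le> ereal_integral M f"
  using ereal_integral_mono_AE[OF assms(2)] ereal_integral_ereal[OF assms(1)] by simp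

lemma elog_ereal: "0 < t \<Longrightarrow> elog t = ereal (ln t)"
  by (simp add: elog_def)

lemma elog_le: "0 \<le> t \<Longrightarrow> t \<le> exp b \<Longrightarrow> elog t \<le> ereal b"
  by (cases "t = 0") (auto simp: elog_def ln_le_cancel_iff[of t "exp b", simplified])

lemma msupport_closed: "closed (msupport \<mu>)"
proof -
  have "open (- msupport \<mu>)"
  proof (subst open_subopen, intro ballI)
    fix x assume "x \<in> - msupport \<mu>"
    then obtain U where U: "open U" "x \<in> U" "emeasure \<mu> U = 0"
      by (auto simp: msupport_def)
    then have "U \<subseteq> - msupport \<mu>" by (auto simp: msupport_def)
    then show "\<exists>T. open T \<and> x \<in> T \<and> T \<subseteq> - msupport \<mu>" using U by blast
  qed
  then show ?thesis by (simp add: closed_def)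
qed

text \<open>A point outside the support lies in a null set of the countable base, and there are only
  countably many of these.\<close>

lemma AE_msupport:
  fixes \<mu> :: "'a::metric_space measure"
  assumes cpt: "compact (UNIV :: 'a set)" and sets: "sets \<mu> = sets borel"
  shows "AE x in \<mu>. x \<in> msupport \<mu>"
proof -
  obtain U :: "nat \<Rightarrow> 'a set" where U: "\<And>n. open (U n)"
    "\<And>V x. open V \<Longrightarrow> x \<in> V \<Longrightarrow> \<exists>n. x \<in> U n \<and> U n \<subseteq> V"
    using compact_countable_base[OF cpt] by blast
  have Um: "U n \<in> sets \<mu>" for n using U(1) sets by simp
  have "AE x in \<mu>. \<forall>n. emeasure \<mu> (U n) = 0 \<longrightarrow> x \<notin> U n"
    unfolding AE_all_countable
  proof
    fix n
    show "AE x in \<mu>. emeasure \<mu> (U n) = 0 \<longrightarrow> x \<notin> U n"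
    proof (cases "emeasure \<mu> (U n) = 0")
      case True
      then have "U n \<in> null_sets \<mu>" using Um by (simp add: null_sets_def)
      then show ?thesis by (auto dest: AE_not_in)
    qed simp
  qed
  then show ?thesis
  proof eventually_elim
    case (elim x)
    show ?case
      unfolding msupport_def
    proof (intro CollectI allI impI)
      fix V assume V: "open V \<and> x \<in> V"
      then obtain n where n: "x \<in> U n" "U n \<subseteq> V" using U(2) by blast
      then have "0 < emeasure \<mu> (U n)" using elim by (auto simp: zero_less_iff_neq_zero)
      also have "\<dots> \<le> emeasure \<mu> V" using n(2) V sets by (intro emeasure_mono) auto
      finally show "0 < emeasure \<mu> V" .
    qed
  qed
qed

lemma continuous_bounded_on_compact:
  fixes f :: "'a::topological_space \<Rightarrow> real"
  assumes "compact (UNIV :: 'a set)" "continuous_on UNIV f"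
  obtains B where "0 < B" "\<And>x. \<bar>f x\<bar> \<le> B"
proof -
  have "bounded (range f)" by (intro compact_imp_bounded compact_continuous_image assms)
  then show ?thesis using that by (auto simp: bounded_pos)
qed

lemma integrable_continuous_compact:
  fixes f :: "'a::topological_space \<Rightarrow> real"
  assumes "prob_space \<mu>" "sets \<mu> = sets borel" "compact (UNIV :: 'a set)" "continuous_on UNIV f"
  shows "integrable \<mu> f"
proof -
  interpret prob_space \<mu> by fact
  obtain B where "\<And>x. \<bar>f x\<bar> \<le> B" using continuous_bounded_on_compact[OF assms(3,4)] by blast
  moreover have "f \<in> borel_measurable \<mu>"
    using borel_measurable_continuous_onI[OF assms(4)] assms(2) by (simp cong: measurable_cong_sets)
  ultimately show ?thesis by (intro integrable_const_bound[of _ B]) auto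
qed

lemma invariant_measures_iff:
  "\<mu> \<in> invariant_measures \<longleftrightarrow> prob_space \<mu> \<and> sets \<mu> = sets borel \<and> distr \<mu> borel shift = \<mu>"
  by (simp add: invariant_measures_def)

lemma shift_measurable: "shift \<in> borel_measurable (borel :: (nat \<Rightarrow> 'i::topological_space) measure)"
  using borel_measurable_continuous_onI[OF continuous_on_shift[of 1]] by simp

lemma integral_shift_funpow:
  fixes f :: "(nat \<Rightarrow> 'i::topological_space) \<Rightarrow> real"
  assumes \<mu>: "\<mu> \<in> invariant_measures" and f: "continuous_on UNIV f"
  shows "(\<integral>x. f ((shift ^^ n) x) \<partial>\<mu>) = integral\<^sup>L \<mu> f"
proof (induction n)
  case (Suc n)
  have sets: "sets \<mu> = sets borel" and inv: "distr \<mu> borel shift = \<mu>" using \<mu> by (auto simp: invariant_measures_iff)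
  have m: "shift \<in> \<mu> \<rightarrow>\<^sub>M borel"
    using shift_measurable sets by (simp cong: measurable_cong_sets)
  have c: "continuous_on UNIV (\<lambda>x. f ((shift ^^ n) x))"
    by (rule continuous_on_compose2[OF f continuous_on_shift]) auto
  have "integral\<^sup>L (distr \<mu> borel shift) (\<lambda>x. f ((shift ^^ n) x)) = (\<integral>x. f ((shift ^^ n) (shift x)) \<partial>\<mu>)"
    by (rule integral_distr[OF m borel_measurable_continuous_onI[OF c]])
  then show ?case using Suc by (simp add: inv funpow_swap1)
qed simp

lemma sum_lessThan_add: "(\<Sum>i<m + n. f i) = (\<Sum>i<m. f i) + (\<Sum>i<n. f (m + i))"
  for f :: "nat \<Rightarrow> 'a::comm_monoid_add"
  by (induction n) (auto simp: add.assoc)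

section \<open>Growth bounds, Birkhoff sums and supercritical measures\<close>

context matrix_cocycle
begin

text \<open>\<open>g\<close> is a substitute for the logarithm of the norm over \<open>m\<close>
  steps. It can be chosen continuous, and \<open>M\<close> can be adapted to it.\<close>

definition growth_bound :: "nat \<Rightarrow> ((nat \<Rightarrow> 'i) \<Rightarrow> real) \<Rightarrow> bool" where
  "growth_bound m g \<longleftrightarrow> (\<exists>M c C. 0 < c \<and> (\<forall>v. c * norm v \<le> M v \<and> M v \<le> C * norm v) \<and>
     (\<forall>x v. M (L x m *v v) \<le> exp (g x) * M v))"

text \<open>With \<open>a i = M (L x i *v v)\<close>, the bounds \<open>a (i + m) \<le> exp (g (shift\<^sup>i x)) * a i\<close> are multiplied over
  all \<open>i < n\<close>; the product telescopes up to \<open>m\<close> factors at either end. Using every \<open>i\<close> instead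
  of the multiples of \<open>m\<close> leaves Birkhoff sums of the shift itself.\<close>

lemma growth_bound_telescope:
  assumes gb: "growth_bound m g" and m: "1 \<le> m"
  obtains D where "\<And>n x. mat_onorm (L x (n + m)) \<le> exp ((D + (\<Sum>i<n. g ((shift ^^ i) x))) / m)"
proof -
  obtain M c C where c: "0 < c" and M: "\<And>v. c * norm v \<le> M v" "\<And>v. M v \<le> C * norm v"
      "\<And>x v. M (L x m *v v) \<le> exp (g x) * M v"
    using gb unfolding growth_bound_def by blast
  define S where "S = (\<Sum>j\<le>m. sup_norm j) + 1"
  have S: "mat_onorm (L x j) \<le> S" if "j \<le> m" for x j
  proof -
    have "sup_norm j \<le> (\<Sum>j\<le>m. sup_norm j)"
      by (rule member_le_sum) (use that in \<open>auto simp: sup_norm_nonneg\<close>)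
    then show ?thesis using norm_le_sup_norm[of x j] by (simp add: S_def)
  qed
  have S1: "1 \<le> S" unfolding S_def by (simp add: sum_nonneg sup_norm_nonneg)
  have SL: "norm (L x j *v v) \<le> S * norm v" if "j \<le> m" for x j v
    using norm_matrix_vector_le[of "L x j" v] mult_right_mono[OF S[OF that] norm_ge_zero] by (rule order_trans)
  have C: "0 < C"
  proof -
    have "c * norm (axis undefined 1 :: complex ^ 'd) \<le> C * norm (axis undefined 1 :: complex ^ 'd)"
      using M(1,2) order_trans by blast
    then show ?thesis using c by simp
  qed
  \<comment> \<open>Each of the m initial terms costs at most \<open>ln C + ln S\<close> beyond
    \<open>ln (norm v)\<close>, each of the m final ones at most \<open>ln S - ln c\<close> beyond
    the logarithm of the final norm; \<open>D\<close> collects these.\<close>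
  define D where "D = m * (ln C + 2 * ln S - ln c)"
  show ?thesis
  proof
    fix n x
    let ?G = "\<Sum>i<n. g ((shift ^^ i) x)"
    show "mat_onorm (L x (n + m)) \<le> exp ((D + ?G) / m)"
    proof (rule onorm_bound)
      fix v
      show "norm (L x (n + m) *v v) \<le> exp ((D + ?G) / m) * norm v"
      proof (cases "L x (n + m) *v v = 0")
        case False
        then have v0: "v \<noteq> 0" by auto
        define w where "w i = L x i *v v" for i
        have w_add: "w (i + j) = L ((shift ^^ i) x) j *v w i" for i j
          by (simp add: w_def cocycle_add matrix_vector_mul_assoc)
        \<comment> \<open>The final vector is an image of each earlier one, so a nonzero end keeps
          the whole orbit nonzero and all the logarithms below are genuine.\<close>
        have w0: "w i \<noteq> 0" if "i \<le> n + m" for i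
          using w_add[of i "n + m - i"] that False by (auto simp: w_def)
        define b where "b i = ln (M (w i))" for i
        have pos: "0 < M (w i)" if "i \<le> n + m" for i
          using M(1)[of "w i"] w0[OF that] c by (smt (verit) mult_pos_pos zero_less_norm_iff)
        have step: "b (i + m) \<le> g ((shift ^^ i) x) + b i" if "i < n" for i
        proof -
          have "M (w (i + m)) \<le> exp (g ((shift ^^ i) x)) * M (w i)" by (simp add: w_add M(3))
          then have "b (i + m) \<le> ln (exp (g ((shift ^^ i) x)) * M (w i))"
            unfolding b_def using pos[of "i + m"] pos[of i] that by (subst ln_le_cancel_iff) auto
          then show ?thesis using pos[of i] that by (simp add: ln_mult b_def)
        qed
        have "(\<Sum>i<n. b (i + m)) \<le> ?G + (\<Sum>i<n. b i)"
          unfolding sum.distrib[symmetric] by (rule sum_mono) (use step in auto)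
        moreover have "(\<Sum>i<n. b (i + m)) + (\<Sum>i<m. b i) = (\<Sum>i<n. b i) + (\<Sum>i<m. b (n + i))"
        proof -
          have "(\<Sum>i<m. b i) + (\<Sum>i<n. b (m + i)) = (\<Sum>i<n. b i) + (\<Sum>i<m. b (n + i))"
            using sum_lessThan_add[of b m n] sum_lessThan_add[of b n m] by (simp add: add.commute[of n m])
          then show ?thesis by (simp only: add.commute)
        qed
        ultimately have 1: "(\<Sum>i<m. b (n + i)) \<le> ?G + (\<Sum>i<m. b i)" by linarith
        have "(\<Sum>i<m. ln (norm (w (n + m))) + ln c - ln S) \<le> (\<Sum>i<m. b (n + i))"
        proof (rule sum_mono)
          fix i assume "i \<in> {..<m}"
          then have i: "i < m" by simp
          have "norm (w (n + m)) \<le> S * norm (w (n + i))"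
            using w_add[of "n + i" "m - i"] SL[of "m - i"] i by simp
          moreover have "c * norm (w (n + i)) \<le> M (w (n + i))" by (rule M(1))
          ultimately have "c * norm (w (n + m)) \<le> c * (S * norm (w (n + i)))"
              "S * (c * norm (w (n + i))) \<le> S * M (w (n + i))"
            using c S1 by (auto intro!: mult_left_mono)
          then have "c * norm (w (n + m)) \<le> S * M (w (n + i))" by (simp add: mult.left_commute)
          then have "ln (c * norm (w (n + m))) \<le> ln (S * M (w (n + i)))"
            using c S1 pos[of "n + i"] w0[of "n + m"] i by (subst ln_le_cancel_iff) auto
          then show "ln (norm (w (n + m))) + ln c - ln S \<le> b (n + i)"
            using c S1 pos[of "n + i"] w0[of "n + m"] i by (simp add: ln_mult b_def)
        qed
        moreover have "(\<Sum>i<m. b i) \<le> (\<Sum>i<m. ln C + ln S + ln (norm v))"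
        proof (rule sum_mono)
          fix i assume "i \<in> {..<m}"
          then have i: "i < m" by simp
          have "M (w i) \<le> C * (S * norm v)"
          proof (rule order_trans[OF M(2)])
            show "C * norm (w i) \<le> C * (S * norm v)"
              using SL[of i x v] i C by (intro mult_left_mono) (auto simp: w_def)
          qed
          then have "b i \<le> ln (C * (S * norm v))"
            unfolding b_def using pos[of i] i C S1 v0 by (subst ln_le_cancel_iff) auto
          then show "b i \<le> ln C + ln S + ln (norm v)" using C S1 v0 by (simp add: ln_mult)
        qed
        ultimately have "m * (ln (norm (w (n + m))) + ln c - ln S) \<le> ?G + m * (ln C + ln S + ln (norm v))"
          using 1 by simp
        then have "m * ln (norm (w (n + m))) \<le> D + ?G + m * ln (norm v)"
          by (simp add: D_def algebra_simps)
        then have "ln (norm (w (n + m))) \<le> (D + ?G) / m + ln (norm v)"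
          using m by (simp add: field_simps)
        then have "exp (ln (norm (w (n + m)))) \<le> exp ((D + ?G) / m + ln (norm v))" by simp
        then show ?thesis using w0[of "n + m"] v0 by (simp add: exp_add w_def)
      qed simp
    qed simp
  qed
qed

text \<open>No continuous growth bound has an average below the rate \<open>r\<close>. Only
  integrals of continuous functions occur, so the condition can be verified for weak limits.\<close>

definition supercritical :: "(nat \<Rightarrow> 'i) measure \<Rightarrow> bool" where
  "supercritical \<mu> \<longleftrightarrow> (\<forall>m g. 1 \<le> m \<longrightarrow> continuous_on UNIV g \<longrightarrow> growth_bound m g \<longrightarrow> m * ln r \<le> integral\<^sup>L \<mu> g)"

abbreviation log_growth :: "(nat \<Rightarrow> 'i) measure \<Rightarrow> nat \<Rightarrow> ereal" where
  "log_growth \<mu> n \<equiv> ereal_integral \<mu> (\<lambda>x. elog (mat_onorm (L x n)))"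

text \<open>Integrating the telescoped bound turns the Birkhoff sum into n times the integral of
  \<open>g\<close>; dividing by n removes both \<open>D\<close> and the bounded loss
  \<open>c\<close>.\<close>

lemma supercritical_if_log_growth:
  assumes \<mu>: "\<mu> \<in> invariant_measures" and lg: "\<And>n. 1 \<le> n \<Longrightarrow> ereal (n * ln r - c) \<le> log_growth \<mu> n"
  shows "supercritical \<mu>"
  unfolding supercritical_def
proof (intro allI impI)
  fix m g assume m: "1 \<le> m" and g: "continuous_on UNIV g" and gb: "growth_bound m g"
  have \<mu>': "prob_space \<mu>" "sets \<mu> = sets borel" using \<mu> by (auto simp: invariant_measures_iff)
  interpret prob_space \<mu> by fact
  obtain D where D: "\<And>n x. mat_onorm (L x (n + m)) \<le> exp ((D + (\<Sum>i<n. g ((shift ^^ i) x))) / m)"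
    using growth_bound_telescope[OF gb m] by blast
  have cg: "continuous_on UNIV (\<lambda>x. g ((shift ^^ i) x))" for i
    by (rule continuous_on_compose2[OF g continuous_on_shift]) auto
  have ig: "integrable \<mu> (\<lambda>x. g ((shift ^^ i) x))" for i
    by (rule integrable_continuous_compact[OF \<mu>' compact_seq cg])
  have bound: "(n + m) * ln r - c \<le> (D + n * integral\<^sup>L \<mu> g) / m" for n
  proof -
    have "ereal ((n + m) * ln r - c) \<le> log_growth \<mu> (n + m)" using lg[of "n + m"] m by simp
    also have "\<dots> \<le> ereal (\<integral>x. (D + (\<Sum>i<n. g ((shift ^^ i) x))) / m \<partial>\<mu>)"
    proof (rule ereal_integral_le)
      show "integrable \<mu> (\<lambda>x. (D + (\<Sum>i<n. g ((shift ^^ i) x))) / m)"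
        by (intro integrable_divide Bochner_Integration.integrable_add Bochner_Integration.integrable_sum ig) simp
    qed (use D in \<open>auto intro!: AE_I2 elog_le simp: mat_onorm_nonneg\<close>)
    also have "(\<integral>x. (D + (\<Sum>i<n. g ((shift ^^ i) x))) / m \<partial>\<mu>) = (D + n * integral\<^sup>L \<mu> g) / m"
      by (simp add: ig integral_shift_funpow[OF \<mu> g] prob_space)
    finally show ?thesis by simp
  qed
  show "m * ln r \<le> integral\<^sup>L \<mu> g"
  proof (rule ccontr)
    assume "\<not> ?thesis"
    then have pos: "0 < m * ln r - integral\<^sup>L \<mu> g" by simp
    obtain n :: nat where "D + m * c - m * (m * ln r) < n * (m * ln r - integral\<^sup>L \<mu> g)"
      using reals_Archimedean3[OF pos] by blast
    moreover have "m * ((n + m) * ln r - c) \<le> D + n * integral\<^sup>L \<mu> g"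
      using bound[of n] m by (simp add: field_simps)
    ultimately show False by (simp add: algebra_simps)
  qed
qed

text \<open>The telescoped bound is applied to single orbit segments whose growth rate tends to at
  least \<open>ln r\<close>; their Birkhoff averages converge to the integral.\<close>

lemma supercritical_if_empirical:
  fixes y :: "nat \<Rightarrow> nat \<Rightarrow> 'i" and N :: "nat \<Rightarrow> nat"
  assumes N: "filterlim N at_top sequentially"
    and lim: "\<And>f. continuous_on UNIV f \<Longrightarrow>
       (\<lambda>k. (\<Sum>j<N k. f ((shift ^^ j) (y k))) / N k) \<longlonglongrightarrow> integral\<^sup>L \<mu> f"
    and growth: "\<And>\<delta>. 0 < \<delta> \<Longrightarrow> \<forall>\<^sub>F k in sequentially. exp (N k * (ln r - \<delta>)) \<le> mat_onorm (L (y k) (N k))"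
  shows "supercritical \<mu>"
  unfolding supercritical_def
proof (intro allI impI)
  fix m g assume m: "1 \<le> m" and g: "continuous_on UNIV g" and gb: "growth_bound m g"
  obtain D where D: "\<And>n x. mat_onorm (L x (n + m)) \<le> exp ((D + (\<Sum>i<n. g ((shift ^^ i) x))) / m)"
    using growth_bound_telescope[OF gb m] by blast
  obtain B where B: "0 < B" "\<And>x. \<bar>g x\<bar> \<le> B"
    using continuous_bounded_on_compact[OF compact_seq g] by blast
  have "m * (ln r - \<delta>) \<le> integral\<^sup>L \<mu> g" if \<delta>: "0 < \<delta>" for \<delta>
  proof (rule tendsto_lowerbound)
    have "(\<lambda>k. (D + m * B) / real (N k)) \<longlonglongrightarrow> 0"
      by (intro tendsto_divide_0[OF tendsto_const] filterlim_at_top_imp_at_infinity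
            filterlim_compose[OF filterlim_real_sequentially N])
    from tendsto_add[OF this lim[OF g]]
    show "(\<lambda>k. (D + m * B) / N k + (\<Sum>j<N k. g ((shift ^^ j) (y k))) / N k) \<longlonglongrightarrow> integral\<^sup>L \<mu> g"
      by simp
    have "\<forall>\<^sub>F k in sequentially. m \<le> N k" using N by (simp add: filterlim_at_top)
    then show "\<forall>\<^sub>F k in sequentially. m * (ln r - \<delta>) \<le> (D + m * B) / N k + (\<Sum>j<N k. g ((shift ^^ j) (y k))) / N k"
      using growth[OF \<delta>]
    proof eventually_elim
      case (elim k)
      let ?f = "\<lambda>j. g ((shift ^^ j) (y k))"
      \<comment> \<open>A product of length \<open>N k\<close> is bounded by a Birkhoff sum of
        length \<open>N k - m\<close>; the m missing terms cost at most
        \<open>m * B\<close>.\<close>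
      define n where "n = N k - m"
      have Nk: "N k = n + m" using elim(1) by (simp add: n_def)
      have "exp (N k * (ln r - \<delta>)) \<le> exp ((D + sum ?f {..<n}) / m)"
        using elim(2) D[of "y k" n] unfolding Nk by (rule order_trans)
      then have 1: "m * (N k * (ln r - \<delta>)) \<le> D + sum ?f {..<n}" using m by (simp add: field_simps)
      have "sum ?f {..<n} - m * B \<le> sum ?f {..<N k}"
      proof -
        have "sum ?f {..<N k} = sum ?f {..<n} + (\<Sum>i<m. ?f (n + i))"
          unfolding Nk by (rule sum_lessThan_add)
        moreover have "(\<Sum>i<m. - B) \<le> (\<Sum>i<m. ?f (n + i))"
          by (rule sum_mono) (use B(2) in \<open>simp add: abs_le_iff minus_le_iff\<close>)
        ultimately show ?thesis by simp
      qed
      with 1 have "m * (N k * (ln r - \<delta>)) \<le> D + m * B + sum ?f {..<N k}" by linarith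
      then have "m * (ln r - \<delta>) \<le> (D + m * B + sum ?f {..<N k}) / N k"
        using Nk m by (subst pos_le_divide_eq) (auto simp: mult.assoc mult.commute[of "real n + real m"])
      then show ?case by (simp add: add_divide_distrib)
    qed
  qed simp
  note * = this
  show "m * ln r \<le> integral\<^sup>L \<mu> g"
  proof (rule field_le_epsilon)
    fix e :: real assume "0 < e"
    then have "m * (ln r - e / m) \<le> integral\<^sup>L \<mu> g" using m by (intro *) simp
    then show "m * ln r \<le> integral\<^sup>L \<mu> g + e" using m by (simp add: right_diff_distrib)
  qed
qed

text \<open>If \<open>\<psi> x\<close> were below \<open>r ^ m\<close> at a point of the support,
  \<open>\<psi>\<close> would stay below some \<open>a < r ^ m\<close> on a set of positive measure,
  and the integral of \<open>ln (\<psi> + \<eta>)\<close> would fall below \<open>m * ln r\<close>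
  as \<open>\<eta>\<close> tends to 0. The \<open>\<eta>\<close> keeps the logarithm continuous
  where \<open>\<psi>\<close> vanishes and absorbs the error in the growth bounds.\<close>

lemma supercritical_extremal_on_support:
  assumes \<mu>: "prob_space \<mu>" "sets \<mu> = sets borel" and sc: "supercritical \<mu>" and m: "1 \<le> m"
    and \<psi>: "continuous_on UNIV \<psi>" "\<And>x. 0 \<le> \<psi> x" "\<And>x. \<psi> x \<le> r ^ m"
    and gb: "\<And>\<eta>. 0 < \<eta> \<Longrightarrow> growth_bound m (\<lambda>x. ln (\<psi> x + \<eta>))"
    and x: "x \<in> msupport \<mu>"
  shows "\<psi> x = r ^ m"
proof (rule ccontr)
  assume "\<psi> x \<noteq> r ^ m"
  then have "\<psi> x < r ^ m" using \<psi>(3)[of x] by simp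
  then obtain a where a: "\<psi> x < a" "a < r ^ m" using dense by blast
  have a0: "0 < a" using a(1) \<psi>(2)[of x] by linarith
  interpret prob_space \<mu> by fact
  have sp: "space \<mu> = UNIV" using sets_eq_imp_space_eq[OF \<mu>(2)] by simp
  have p1: "measure \<mu> UNIV = 1" using prob_space unfolding sp .
  define U where "U = {y. \<psi> y < a}"
  have U: "open U" "x \<in> U" unfolding U_def using a(1) \<psi>(1) by (auto intro!: open_Collect_less continuous_intros)
  have Um: "U \<in> sets \<mu>" using U(1) \<mu>(2) by simp
  define q where "q = measure \<mu> U"
  have q: "0 < q" unfolding q_def using x U emeasure_eq_measure[of U]
    by (auto simp: msupport_def)
  have int: "m * ln r \<le> ln (r ^ m + \<eta>) - q * (ln (r ^ m + \<eta>) - ln (a + \<eta>))" if \<eta>: "0 < \<eta>" for \<eta>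
  proof -
    have pos: "0 < \<psi> y + \<eta>" for y using \<psi>(2)[of y] \<eta> by linarith
    have cl: "continuous_on UNIV (\<lambda>y. ln (\<psi> y + \<eta>))"
      using pos by (intro continuous_intros \<psi>(1)) (auto simp: less_le)
    have "m * ln r \<le> (\<integral>y. ln (\<psi> y + \<eta>) \<partial>\<mu>)"
      using sc m cl gb[OF \<eta>] by (simp add: supercritical_def)
    also have "\<dots> \<le> (\<integral>y. ln (r ^ m + \<eta>) - indicator U y * (ln (r ^ m + \<eta>) - ln (a + \<eta>)) \<partial>\<mu>)"
    proof (rule integral_mono)
      show "integrable \<mu> (\<lambda>y. ln (\<psi> y + \<eta>))" by (rule integrable_continuous_compact[OF \<mu> compact_seq cl])
      show "integrable \<mu> (\<lambda>y. ln (r ^ m + \<eta>) - indicator U y * (ln (r ^ m + \<eta>) - ln (a + \<eta>)))"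
        using Um by (intro Bochner_Integration.integrable_diff integrable_mult_left) (auto simp: emeasure_eq_measure)
      show "ln (\<psi> y + \<eta>) \<le> ln (r ^ m + \<eta>) - indicator U y * (ln (r ^ m + \<eta>) - ln (a + \<eta>))" for y
        using pos[of y] \<psi>(3)[of y] jsr_pos \<eta> a0
        by (cases "y \<in> U") (auto simp: U_def intro!: ln_mono)
    qed
    also have "\<dots> = ln (r ^ m + \<eta>) - q * (ln (r ^ m + \<eta>) - ln (a + \<eta>))"
      using Um p1 sp
      by (subst Bochner_Integration.integral_diff) (auto simp: emeasure_eq_measure q_def)
    finally show ?thesis .
  qed
  have "((\<lambda>\<eta>. ln (r ^ m + \<eta>) - q * (ln (r ^ m + \<eta>) - ln (a + \<eta>))) \<longlongrightarrow>
        ln (r ^ m + 0) - q * (ln (r ^ m + 0) - ln (a + 0))) (at_right 0)"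
    using jsr_pos a0 by (intro tendsto_intros) auto
  then have "m * ln r \<le> ln (r ^ m + 0) - q * (ln (r ^ m + 0) - ln (a + 0))"
    by (rule tendsto_lowerbound) (auto intro: int eventually_at_right_less[THEN eventually_mono])
  then have "q * (m * ln r - ln a) \<le> 0" using jsr_pos by (simp add: ln_realpow)
  moreover have "ln a < m * ln r" using a(2) a0 jsr_pos by (simp add: ln_realpow[symmetric])
  ultimately show False using q by (simp add: mult_le_0_iff)
qed

end

lemma (in projected_seminorm) op_seminorm_le_mat_onorm:
  "\<exists>K>0. \<forall>B. op_seminorm T p B \<le> K * mat_onorm B"
proof (intro exI[of _ "hi / lo * (mat_onorm T * mat_onorm T) + 1"] conjI allI)
  let ?K = "hi / lo * (mat_onorm T * mat_onorm T) + 1"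
  show "0 < ?K" using lo(1) hi(1) mat_onorm_nonneg[of T] by (intro add_nonneg_pos mult_nonneg_nonneg) auto
  fix B
  have "mat_onorm (T ** B ** T) \<le> mat_onorm T * mat_onorm B * mat_onorm T"
    by (rule order_trans[OF mat_onorm_mult_le mult_right_mono[OF mat_onorm_mult_le mat_onorm_nonneg]])
  then have "hi / lo * mat_onorm (T ** B ** T) \<le> hi / lo * (mat_onorm T * mat_onorm B * mat_onorm T)"
    using lo(1) hi(1) by (intro mult_left_mono) auto
  also have "\<dots> = hi / lo * (mat_onorm T * mat_onorm T) * mat_onorm B" by (simp only: mult_ac)
  also have "\<dots> \<le> ?K * mat_onorm B" by (intro mult_right_mono mat_onorm_nonneg) simp
  finally show "op_seminorm T p B \<le> ?K * mat_onorm B" using op_seminorm_le_onorm[of B] by linarith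
qed

section \<open>Extremal points and maximising measures\<close>

locale cocycle_blocks = matrix_cocycle A for A :: "'i::metric_space \<Rightarrow> complex ^ 'd ^ 'd" +
  fixes \<Phi> :: "((complex ^ 'd ^ 'd) \<times> (complex ^ 'd \<Rightarrow> real)) set"
  assumes finite_blocks: "finite \<Phi>"
    and blocks: "\<And>T p. (T, p) \<in> \<Phi> \<Longrightarrow> block T p"
    and dominated_UNIV: "dominated UNIV \<Phi>"
begin

definition extremal_points :: "(nat \<Rightarrow> 'i) set" where
  "extremal_points = {x. \<exists>(T, p)\<in>\<Phi>. \<forall>n. op_seminorm T p (L x n) = r ^ n}"

lemma block_projected_seminorm: "block T p \<Longrightarrow> \<exists>lo hi. projected_seminorm T p lo hi"
  unfolding block_def by (rule conjunct1)

lemma continuous_op_seminorm: "block T p \<Longrightarrow> continuous_on UNIV (\<lambda>x. op_seminorm T p (L x n))"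
  unfolding block_def by (auto intro: projected_seminorm.continuous_on_op_seminorm continuous_L)

lemma continuous_op_max: "continuous_on UNIV (\<lambda>x. op_max \<Phi> (L x n))"
proof -
  have "continuous_on UNIV (\<lambda>x. op_max F (L x n))" if "finite F" "F \<subseteq> \<Phi>" for F
    using that
  proof induction
    case empty
    show ?case by (simp add: op_max_def)
  next
    case (insert q F)
    obtain T p where q: "q = (T, p)" by (cases q)
    have "op_max (insert q F) B = max (op_seminorm T p B) (op_max F B)" for B
      using insert.hyps(1) by (simp add: op_max_def q insert_commute[of 0])
    moreover have "continuous_on UNIV (\<lambda>x. op_seminorm T p (L x n))"
      using insert.prems q by (intro continuous_op_seminorm blocks) auto
    ultimately show ?case using insert by (simp add: continuous_on_max)
  qed
  then show ?thesis using finite_blocks by blast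
qed

lemma op_max_le: "op_max \<Phi> (L x n) \<le> r ^ n"
  unfolding op_max_def using finite_blocks jsr_pos block_op_le[OF blocks]
  by (subst Max_le_iff) auto

lemma op_seminorm_block_nonneg: "block T p \<Longrightarrow> 0 \<le> op_seminorm T p B"
  unfolding block_def by (auto intro: projected_seminorm.op_seminorm_nonneg)

lemma growth_bound_op_max:
  assumes "0 < \<eta>"
  shows "growth_bound m (\<lambda>x. ln (op_max \<Phi> (L x m) + \<eta>))"
proof -
  obtain M c C where M: "comparable_on UNIV M c C"
    "\<forall>x. \<forall>v\<in>UNIV. M (L x m *v v) \<le> (op_max \<Phi> (L x m) + \<eta>) * M v"
    using dominated_UNIV assms unfolding dominated_def by blast
  have "0 < op_max \<Phi> (L x m) + \<eta>" for x
    using op_max_nonneg[OF finite_blocks, of "L x m"] assms by linarith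
  with M show ?thesis unfolding growth_bound_def comparable_on_def
    by (intro exI[of _ M] exI[of _ c] exI[of _ C]) auto
qed

text \<open>The maximum might be attained by different blocks at different times. But a block that
  falls below \<open>r ^ n\<close> once stays below at all later times, by submultiplicativity; if
  every block did so, the maximum would be too small at a time beyond all these failures.\<close>

lemma extremal_if_op_max:
  assumes x: "\<And>m. 1 \<le> m \<Longrightarrow> op_max \<Phi> (L x m) = r ^ m"
  shows "x \<in> extremal_points"
proof (rule ccontr)
  assume "x \<notin> extremal_points"
  then have "\<forall>q\<in>\<Phi>. \<exists>n. op_seminorm (fst q) (snd q) (L x n) \<noteq> r ^ n"
    by (auto simp: extremal_points_def)
  then obtain N where N: "\<And>q. q \<in> \<Phi> \<Longrightarrow> op_seminorm (fst q) (snd q) (L x (N q)) \<noteq> r ^ N q"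
    by metis
  define m where "m = Suc (Max (insert 0 (N ` \<Phi>)))"
  have less: "op_seminorm T p (L x m) < r ^ m" if q: "(T, p) \<in> \<Phi>" for T p
  proof -
    let ?n = "N (T, p)"
    have b: "block T p" by (rule blocks[OF q])
    have "?n \<le> Max (insert 0 (N ` \<Phi>))" using finite_blocks q by (intro Max_ge) auto
    then have m: "m = ?n + (m - ?n)" by (simp add: m_def)
    have "op_seminorm T p (L x ?n) < r ^ ?n"
      using N[OF q] block_op_le[OF b, of x ?n] by simp
    then have "r ^ (m - ?n) * op_seminorm T p (L x ?n) < r ^ (m - ?n) * r ^ ?n"
      using jsr_pos by simp
    moreover have "op_seminorm T p (L x m) \<le> op_seminorm T p (L ((shift ^^ ?n) x) (m - ?n)) * op_seminorm T p (L x ?n)"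
      using block_op_mult[OF b, of x ?n "m - ?n"] m by simp
    moreover have "\<dots> \<le> r ^ (m - ?n) * op_seminorm T p (L x ?n)"
      by (intro mult_right_mono block_op_le b op_seminorm_block_nonneg)
    ultimately have "op_seminorm T p (L x m) < r ^ (m - ?n) * r ^ ?n" by linarith
    also have "\<dots> = r ^ m" using m by (metis power_add add.commute)
    finally show ?thesis .
  qed
  have "op_max \<Phi> (L x m) < r ^ m"
    unfolding op_max_def using finite_blocks less jsr_pos by (subst Max_less_iff) auto
  then show False using x[of m] by (simp add: m_def)
qed

lemma msupport_subset_extremal:
  assumes "prob_space \<mu>" "sets \<mu> = sets borel" "supercritical \<mu>"
  shows "msupport \<mu> \<subseteq> extremal_points"
proof
  fix x assume x: "x \<in> msupport \<mu>"
  show "x \<in> extremal_points"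
  proof (rule extremal_if_op_max)
    fix m :: nat assume "1 \<le> m"
    then show "op_max \<Phi> (L x m) = r ^ m"
      by (rule supercritical_extremal_on_support[OF assms])
         (auto intro: continuous_op_max op_max_nonneg finite_blocks op_max_le growth_bound_op_max x)
  qed
qed

lemma closed_extremal_points: "closed extremal_points"
proof -
  have "extremal_points = (\<Union>(T, p)\<in>\<Phi>. {x. \<forall>n. op_seminorm T p (L x n) = r ^ n})"
    by (auto simp: extremal_points_def)
  moreover have "closed {x. \<forall>n. op_seminorm T p (L x n) = r ^ n}" if "(T, p) \<in> \<Phi>" for T p
    by (intro closed_Collect_all closed_Collect_eq continuous_op_seminorm blocks[OF that] continuous_on_const)
  ultimately show ?thesis using finite_blocks by (auto intro!: closed_UN)
qed

text \<open>One \<open>\<epsilon>\<close> serves all extremal points since there are finitely many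
  blocks. Besides strong extremality this bounds the logarithms of the norms from below on the
  extremal set.\<close>

lemma extremal_points_lower_bound:
  obtains \<epsilon> where "0 < \<epsilon>" "\<And>x n. x \<in> extremal_points \<Longrightarrow> \<epsilon> * r ^ n \<le> mat_onorm (L x n)"
proof -
  have "\<forall>q\<in>\<Phi>. \<exists>K>0. \<forall>B. op_seminorm (fst q) (snd q) B \<le> K * mat_onorm B"
  proof
    fix q assume "q \<in> \<Phi>"
    then have "block (fst q) (snd q)" by (intro blocks) simp
    then obtain lo hi where "projected_seminorm (fst q) (snd q) lo hi"
      using block_projected_seminorm by blast
    then show "\<exists>K>0. \<forall>B. op_seminorm (fst q) (snd q) B \<le> K * mat_onorm B"
      by (rule projected_seminorm.op_seminorm_le_mat_onorm)
  qed
  from bchoice[OF this] obtain K where K: "\<And>q. q \<in> \<Phi> \<Longrightarrow> 0 < K q"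
      "\<And>q B. q \<in> \<Phi> \<Longrightarrow> op_seminorm (fst q) (snd q) B \<le> K q * mat_onorm B"
    by blast
  define K0 where "K0 = sum K \<Phi> + 1"
  have K0: "0 < K0" unfolding K0_def using K(1) by (intro add_nonneg_pos sum_nonneg) (auto intro: less_imp_le)
  show ?thesis
  proof
    show "0 < 1 / K0" using K0 by simp
    fix x n assume "x \<in> extremal_points"
    then obtain T p where q: "(T, p) \<in> \<Phi>" "op_seminorm T p (L x n) = r ^ n" by (auto simp: extremal_points_def)
    have "K (T, p) \<le> sum K \<Phi>" by (rule member_le_sum[OF q(1)]) (use K(1) finite_blocks in \<open>auto intro: less_imp_le\<close>)
    then have "K (T, p) * mat_onorm (L x n) \<le> K0 * mat_onorm (L x n)"
      by (intro mult_right_mono mat_onorm_nonneg) (simp add: K0_def)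
    then have "r ^ n \<le> K0 * mat_onorm (L x n)" using K(2)[OF q(1), of "L x n"] q(2) by simp
    then show "1 / K0 * r ^ n \<le> mat_onorm (L x n)" using K0 by (simp add: field_simps)
  qed
qed

lemma log_growth_ge_if_maximising:
  assumes "\<mu> \<in> maximising_measures A" "1 \<le> n"
  shows "ereal (n * ln r) \<le> log_growth \<mu> n"
proof -
  have "(INF n\<in>{1..}. ereal (1 / real n) * log_growth \<mu> n) = ereal (ln r)"
    using assms(1) jsr_pos by (simp add: maximising_measures_def elog_ereal)
  moreover have "(INF n\<in>{1..}. ereal (1 / real n) * log_growth \<mu> n) \<le> ereal (1 / real n) * log_growth \<mu> n"
    by (rule INF_lower) (use assms(2) in simp)
  ultimately have "ereal (ln r) \<le> ereal (1 / real n) * log_growth \<mu> n" by simp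
  then show ?thesis using assms(2) by (cases "log_growth \<mu> n") (auto simp: field_simps)
qed

lemma supercritical_if_maximising:
  assumes "\<mu> \<in> maximising_measures A"
  shows "supercritical \<mu>"
  using assms log_growth_ge_if_maximising[OF assms]
  by (intro supercritical_if_log_growth[of _ 0]) (auto simp: maximising_measures_def)

text \<open>The pointwise bound by \<open>\<epsilon> * r ^ n\<close> loses the constant
  \<open>ln \<epsilon>\<close>, which is harmless for \<open>supercritical\<close>. That condition
  then gives back the sharp bound \<open>n * ln r\<close> for every single n, as the infimum in the
  definition of maximising measures demands.\<close>

lemma maximising_if_AE_extremal:
  assumes \<mu>: "\<mu> \<in> invariant_measures" and ae: "AE x in \<mu>. x \<in> extremal_points"
  shows "\<mu> \<in> maximising_measures A"
proof -
  have \<mu>': "prob_space \<mu>" "sets \<mu> = sets borel" using \<mu> by (auto simp: invariant_measures_iff)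
  interpret prob_space \<mu> by fact
  obtain \<epsilon> where \<epsilon>: "0 < \<epsilon>" "\<And>x n. x \<in> extremal_points \<Longrightarrow> \<epsilon> * r ^ n \<le> mat_onorm (L x n)"
    using extremal_points_lower_bound by blast
  have pos: "0 < \<epsilon> * r ^ n" for n using \<epsilon>(1) jsr_pos by simp
  have "ereal (n * ln r - (- ln \<epsilon>)) \<le> log_growth \<mu> n" for n
  proof -
    have "ereal (\<integral>x. ln (\<epsilon> * r ^ n) \<partial>\<mu>) \<le> log_growth \<mu> n"
    proof (rule ereal_integral_ge)
      show "AE x in \<mu>. ereal (ln (\<epsilon> * r ^ n)) \<le> elog (mat_onorm (L x n))"
        using ae
      proof eventually_elim
        case (elim x)
        then show ?case using \<epsilon>(2)[OF elim, of n] pos[of n] by (simp add: elog_ereal)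
      qed
    qed simp
    then show ?thesis using \<epsilon>(1) jsr_pos by (simp add: prob_space ln_mult ln_realpow add.commute)
  qed
  then have sc: "supercritical \<mu>" by (rule supercritical_if_log_growth[OF \<mu>])
  have ge: "ereal (n * ln r) \<le> log_growth \<mu> n" if n: "1 \<le> n" for n
  proof -
    \<comment> \<open>Truncation from below at \<open>\<epsilon> * r ^ n\<close> makes the logarithm
      of the norm continuous without changing it almost everywhere; with the Euclidean norm as
      comparison function it is a growth bound.\<close>
    define g where "g x = ln (max (mat_onorm (L x n)) (\<epsilon> * r ^ n))" for x
    have gpos: "0 < max (mat_onorm (L x n)) (\<epsilon> * r ^ n)" for x using pos[of n] by simp
    have cg: "continuous_on UNIV g" unfolding g_def
      using gpos by (intro continuous_intros continuous_L) (auto simp: less_le)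
    have "growth_bound n g"
      unfolding growth_bound_def
    proof (intro exI[of _ norm] exI[of _ 1] conjI allI)
      fix x v
      have "norm (L x n *v v) \<le> mat_onorm (L x n) * norm v" by (rule norm_matrix_vector_le)
      also have "\<dots> \<le> exp (g x) * norm v" using gpos[of x] by (intro mult_right_mono) (auto simp: g_def)
      finally show "norm (L x n *v v) \<le> exp (g x) * norm v" .
    qed auto
    then have "n * ln r \<le> integral\<^sup>L \<mu> g" using sc n cg by (simp add: supercritical_def)
    then have "ereal (n * ln r) \<le> ereal (integral\<^sup>L \<mu> g)" by simp
    also have "\<dots> \<le> log_growth \<mu> n"
    proof (rule ereal_integral_ge)
      show "integrable \<mu> g" by (rule integrable_continuous_compact[OF \<mu>' compact_seq cg])
      show "AE x in \<mu>. ereal (g x) \<le> elog (mat_onorm (L x n))"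
        using ae
      proof eventually_elim
        case (elim x)
        then show ?case using \<epsilon>(2)[OF elim, of n] pos[of n] by (simp add: elog_ereal g_def max_def)
      qed
    qed
    finally show ?thesis .
  qed
  let ?I = "INF n\<in>{1..}. ereal (1 / real n) * log_growth \<mu> n"
  have "ereal (ln r) \<le> ?I"
  proof (rule INF_greatest)
    fix n :: nat assume "n \<in> {1..}"
    then have n: "1 \<le> n" by simp
    then show "ereal (ln r) \<le> ereal (1 / real n) * log_growth \<mu> n"
      using ge[OF n] by (cases "log_growth \<mu> n") (auto simp: field_simps)
  qed
  moreover have "?I \<le> ereal (ln r)"
  proof (rule LIMSEQ_le_const)
    show "(\<lambda>n. ereal (ln (sup_norm n) / n)) \<longlonglongrightarrow> ereal (ln r)" using ln_sup_norm_LIMSEQ by simp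
    have "?I \<le> ereal (ln (sup_norm n) / n)" if n: "1 \<le> n" for n
    proof -
      have "log_growth \<mu> n \<le> ereal (\<integral>x. ln (sup_norm n) \<partial>\<mu>)"
        by (rule ereal_integral_le)
           (auto intro!: elog_le simp: mat_onorm_nonneg norm_le_sup_norm sup_norm_pos)
      then have "log_growth \<mu> n \<le> ereal (ln (sup_norm n))" by (simp add: prob_space)
      then have "ereal (1 / real n) * log_growth \<mu> n \<le> ereal (1 / real n) * ereal (ln (sup_norm n))"
        by (intro ereal_mult_left_mono) auto
      moreover have "?I \<le> ereal (1 / real n) * log_growth \<mu> n" by (rule INF_lower) (use n in simp)
      ultimately show ?thesis by simp
    qed
    then show "\<exists>N. \<forall>n\<ge>N. ?I \<le> ereal (ln (sup_norm n) / n)" by blast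
  qed
  ultimately have "?I = elog r" using jsr_pos by (simp add: elog_ereal)
  then show ?thesis using \<mu> by (simp add: maximising_measures_def)
qed

lemma maximising_iff_AE_extremal:
  assumes \<mu>: "\<mu> \<in> invariant_measures"
  shows "\<mu> \<in> maximising_measures A \<longleftrightarrow> (AE x in \<mu>. x \<in> extremal_points)"
proof
  assume "\<mu> \<in> maximising_measures A"
  then have "msupport \<mu> \<subseteq> extremal_points"
    using \<mu> by (intro msupport_subset_extremal supercritical_if_maximising) (auto simp: invariant_measures_iff)
  moreover have "AE x in \<mu>. x \<in> msupport \<mu>"
    using \<mu> by (intro AE_msupport compact_seq) (auto simp: invariant_measures_iff)
  ultimately show "AE x in \<mu>. x \<in> extremal_points" by (auto elim!: eventually_mono)
qed (rule maximising_if_AE_extremal[OF \<mu>])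

text \<open>A weak limit is invariant because the averages of \<open>f\<close> and of
  \<open>f\<close> after the shift differ by two boundary terms over \<open>N (s k)\<close>. The
  growth hypothesis makes it supercritical, so its support consists of extremal points.\<close>

lemma empirical_measures_maximising:
  fixes y :: "nat \<Rightarrow> nat \<Rightarrow> 'i" and N :: "nat \<Rightarrow> nat"
  assumes N: "filterlim N at_top sequentially" "\<And>k. 0 < N k"
    and growth: "\<And>\<delta>. 0 < \<delta> \<Longrightarrow> \<forall>\<^sub>F k in sequentially. exp (N k * (ln r - \<delta>)) \<le> mat_onorm (L (y k) (N k))"
  obtains s \<mu> where "strict_mono (s :: nat \<Rightarrow> nat)" "\<mu> \<in> maximising_measures A"
    "\<And>f. continuous_on UNIV f \<Longrightarrow>
       (\<lambda>k. (\<Sum>j<N (s k). f ((shift ^^ j) (y (s k)))) / N (s k)) \<longlonglongrightarrow> integral\<^sup>L \<mu> f"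
proof -
  obtain s \<mu> where s: "strict_mono s" and \<mu>: "prob_space \<mu>" "sets \<mu> = sets borel"
    and lim: "\<And>f :: (nat \<Rightarrow> 'i) \<Rightarrow> real. continuous_on UNIV f \<Longrightarrow>
       (\<lambda>k. (\<Sum>j<N (s k). f ((shift ^^ j) (y (s k)))) / N (s k)) \<longlonglongrightarrow> integral\<^sup>L \<mu> f"
    by (rule empirical_measures_cluster[where y = "\<lambda>k j. (shift ^^ j) (y k)" and n = N, OF compact_seq N(2)])
       (rule that)
  have Ns: "filterlim (\<lambda>k. N (s k)) at_top sequentially"
    by (rule filterlim_compose[OF N(1) filterlim_subseq[OF s]])
  have m: "shift \<in> \<mu> \<rightarrow>\<^sub>M borel" using shift_measurable \<mu>(2) by (simp cong: measurable_cong_sets)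
  have "distr \<mu> borel shift = \<mu>"
  proof (rule finite_measure_eqI_continuous)
    show "finite_measure \<mu>" using \<mu>(1) by (rule prob_space.finite_measure)
    show "finite_measure (distr \<mu> borel shift)"
      using prob_space.prob_space_distr[OF \<mu>(1) m] by (rule prob_space.finite_measure)
    fix f :: "(nat \<Rightarrow> 'i) \<Rightarrow> real" assume f: "continuous_on UNIV f" and f1: "\<And>x. \<bar>f x\<bar> \<le> 1"
    have fs: "continuous_on UNIV (\<lambda>x. f (shift x))"
      using continuous_on_compose2[OF f continuous_on_shift[of 1]] by simp
    have "(\<lambda>k. (\<Sum>j<N (s k). f (shift ((shift ^^ j) (y (s k))))) / N (s k)
        - (\<Sum>j<N (s k). f ((shift ^^ j) (y (s k)))) / N (s k)) \<longlonglongrightarrow> (\<integral>x. f (shift x) \<partial>\<mu>) - integral\<^sup>L \<mu> f"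
      by (intro tendsto_diff lim f fs)
    moreover have "(\<lambda>k. (\<Sum>j<N (s k). f (shift ((shift ^^ j) (y (s k))))) / N (s k)
        - (\<Sum>j<N (s k). f ((shift ^^ j) (y (s k)))) / N (s k)) \<longlonglongrightarrow> 0"
    proof (rule Lim_null_comparison)
      show "(\<lambda>k. 2 / real (N (s k))) \<longlonglongrightarrow> 0"
        by (intro tendsto_divide_0[OF tendsto_const] filterlim_at_top_imp_at_infinity
              filterlim_compose[OF filterlim_real_sequentially Ns])
      show "\<forall>\<^sub>F k in sequentially. norm ((\<Sum>j<N (s k). f (shift ((shift ^^ j) (y (s k))))) / N (s k)
        - (\<Sum>j<N (s k). f ((shift ^^ j) (y (s k)))) / N (s k)) \<le> 2 / real (N (s k))"
      proof (rule always_eventually, rule allI)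
        fix k
        let ?a = "\<lambda>j. f ((shift ^^ j) (y (s k)))"
        have "(\<Sum>j<N (s k). ?a (Suc j)) - (\<Sum>j<N (s k). ?a j) = ?a (N (s k)) - ?a 0"
          by (subst sum_subtractf[symmetric]) (rule sum_lessThan_telescope)
        then have "\<bar>(\<Sum>j<N (s k). ?a (Suc j)) - (\<Sum>j<N (s k). ?a j)\<bar> \<le> 2"
          using f1[of "(shift ^^ N (s k)) (y (s k))"] f1[of "y (s k)"] by simp
        then show "norm ((\<Sum>j<N (s k). f (shift ((shift ^^ j) (y (s k))))) / N (s k)
          - (\<Sum>j<N (s k). ?a j) / N (s k)) \<le> 2 / real (N (s k))"
          using N(2)[of "s k"] by (simp add: diff_divide_distrib[symmetric] divide_right_mono)
      qed
    qed
    ultimately have "(\<integral>x. f (shift x) \<partial>\<mu>) - integral\<^sup>L \<mu> f = 0" by (rule LIMSEQ_unique)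
    then show "integral\<^sup>L (distr \<mu> borel shift) f = integral\<^sup>L \<mu> f"
      using integral_distr[OF m borel_measurable_continuous_onI[OF f]] by simp
  qed (use \<mu> in auto)
  then have inv: "\<mu> \<in> invariant_measures" using \<mu> by (simp add: invariant_measures_iff)
  have "supercritical \<mu>"
    using Ns lim
  proof (rule supercritical_if_empirical)
    fix \<delta> :: real assume "0 < \<delta>"
    from eventually_compose_filterlim[OF growth[OF this] filterlim_subseq[OF s]]
    show "\<forall>\<^sub>F k in sequentially. exp (N (s k) * (ln r - \<delta>)) \<le> mat_onorm (L (y (s k)) (N (s k)))" .
  qed
  then have "msupport \<mu> \<subseteq> extremal_points" by (rule msupport_subset_extremal[OF \<mu>])
  then have "\<mu> \<in> maximising_measures A"
    using AE_msupport[OF compact_seq \<mu>(2)] by (intro maximising_if_AE_extremal[OF inv]) (auto elim!: eventually_mono)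
  with s lim show ?thesis using that by blast
qed

text \<open>Since \<open>sup_norm n\<close> is at least \<open>r ^ n\<close>, some orbit reaches
  \<open>r ^ n / 2\<close> at time n. The factor 1/2 is subexponential, so empirical measures along
  these orbits have a maximising limit.\<close>

lemma maximising_measures_nonempty: "maximising_measures A \<noteq> {}"
proof -
  have "\<exists>x. r ^ n / 2 \<le> mat_onorm (L x n)" for n
  proof (rule ccontr)
    assume "\<not> ?thesis"
    then have "sup_norm n \<le> r ^ n / 2" unfolding sup_norm_def by (intro cSUP_least) (auto simp: not_le less_imp_le)
    moreover have "0 < r ^ n" using jsr_pos by simp
    ultimately show False using jsr_power_le_sup_norm[of n] by simp
  qed
  then obtain y where y: "\<And>n. r ^ n / 2 \<le> mat_onorm (L (y n) n)" by metis
  have g: "\<forall>\<^sub>F k in sequentially. exp (Suc k * (ln r - \<delta>)) \<le> mat_onorm (L (y (Suc k)) (Suc k))" if \<delta>: "0 < \<delta>" for \<delta>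
  proof -
    have "filterlim (\<lambda>k. Suc k * \<delta>) at_top sequentially"
      by (rule filterlim_at_top_mult_tendsto_pos[OF tendsto_const \<delta>])
         (rule filterlim_compose[OF filterlim_real_sequentially filterlim_Suc])
    then have "\<forall>\<^sub>F k in sequentially. ln 2 \<le> Suc k * \<delta>" by (simp add: filterlim_at_top)
    then show ?thesis
    proof eventually_elim
      case (elim k)
      have "exp (Suc k * (ln r - \<delta>)) = exp (Suc k * ln r) * exp (- (Suc k * \<delta>))"
        by (simp only: exp_add[symmetric] right_diff_distrib) simp
      also have "\<dots> \<le> exp (Suc k * ln r) * exp (- ln 2)" using elim by (intro mult_left_mono) auto
      also have "\<dots> = r ^ Suc k / 2"
      proof -
        have "exp (Suc k * ln r) = r ^ Suc k" unfolding exp_of_nat_mult using jsr_pos by simp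
        moreover have "exp (- ln 2) = (1 / 2 :: real)" by (simp add: exp_minus)
        ultimately show ?thesis by simp
      qed
      finally show ?case using y[of "Suc k"] by simp
    qed
  qed
  show ?thesis
  proof (rule empirical_measures_maximising[where N = Suc and y = "\<lambda>k. y (Suc k)"])
    show "filterlim Suc at_top sequentially" by (rule filterlim_Suc)
    show "0 < Suc k" for k by simp
    show "\<forall>\<^sub>F k in sequentially. exp (Suc k * (ln r - \<delta>)) \<le> mat_onorm (L (y (Suc k)) (Suc k))"
      if "0 < \<delta>" for \<delta>
      by (rule g[OF that])
    show ?thesis if "\<mu> \<in> maximising_measures A" for \<mu> using that by blast
  qed
qed

end

section \<open>The Mather set\<close>

text \<open>One inclusion pulls open sets back along the shift. For the other, the image of the
  support is compact and, by invariance, has full measure, so its complement is an open null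
  set.\<close>

lemma msupport_shift_image:
  fixes \<mu> :: "(nat \<Rightarrow> 'i::metric_space) measure"
  assumes cpt: "compact (UNIV :: 'i set)" and \<mu>: "\<mu> \<in> invariant_measures"
  shows "shift ` msupport \<mu> = msupport \<mu>"
proof
  have sets: "sets \<mu> = sets borel" and inv: "distr \<mu> borel shift = \<mu>" and prob: "prob_space \<mu>"
    using \<mu> by (auto simp: invariant_measures_iff)
  interpret prob_space \<mu> by (rule prob)
  have sp: "space \<mu> = UNIV" using sets_eq_imp_space_eq[OF sets] by simp
  have m: "shift \<in> \<mu> \<rightarrow>\<^sub>M borel" using shift_measurable sets by (simp cong: measurable_cong_sets)
  have em: "emeasure \<mu> B = emeasure \<mu> (shift -` B)" if "B \<in> sets borel" for B
    using emeasure_distr[OF m that] by (simp add: inv sp)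
  have cs: "continuous_on UNIV (shift :: (nat \<Rightarrow> 'i) \<Rightarrow> _)" using continuous_on_shift[of 1] by simp
  show "shift ` msupport \<mu> \<subseteq> msupport \<mu>"
  proof (intro image_subsetI)
    fix x assume x: "x \<in> msupport \<mu>"
    have "0 < emeasure \<mu> U" if U: "open U" "shift x \<in> U" for U
    proof -
      have "open (shift -` U)" using cs U(1) by (simp add: continuous_on_open_vimage)
      then have "0 < emeasure \<mu> (shift -` U)" using x U(2) by (simp add: msupport_def)
      then show ?thesis using em[of U] U(1) by simp
    qed
    then show "shift x \<in> msupport \<mu>" by (simp add: msupport_def)
  qed
  have cl: "closed (shift ` msupport \<mu>)"
  proof -
    have "compact (msupport \<mu>)"
      using compact_Int_closed[OF compact_UNIV_fun[OF cpt] msupport_closed[of \<mu>]] by simp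
    then show ?thesis
      by (intro compact_imp_closed compact_continuous_image continuous_on_subset[OF cs]) auto
  qed
  have "AE x in \<mu>. x \<in> msupport \<mu>" by (rule AE_msupport[OF compact_UNIV_fun[OF cpt] sets])
  then have "AE x in \<mu>. shift x \<in> shift ` msupport \<mu>" by (auto elim!: eventually_mono)
  then have "AE x in distr \<mu> borel shift. x \<in> shift ` msupport \<mu>"
    by (subst AE_distr_iff[OF m]) (use cl in simp_all)
  then have ae: "AE x in \<mu>. x \<in> shift ` msupport \<mu>" unfolding inv .
  show "msupport \<mu> \<subseteq> shift ` msupport \<mu>"
  proof (rule ccontr)
    assume "\<not> ?thesis"
    then obtain x where x: "x \<in> msupport \<mu>" "x \<in> - shift ` msupport \<mu>" by blast
    moreover have "open (- shift ` msupport \<mu>)" using cl by (simp add: closed_def)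
    ultimately have "0 < emeasure \<mu> (- shift ` msupport \<mu>)"
      unfolding msupport_def[of \<mu>] by blast
    moreover have "- shift ` msupport \<mu> \<in> sets \<mu>" using cl sets by simp
    then have "emeasure \<mu> (- shift ` msupport \<mu>) = 0"
      using ae AE_iff_measurable[of "- shift ` msupport \<mu>" \<mu> "\<lambda>x. x \<in> shift ` msupport \<mu>"]
      by (simp add: sp Compl_eq)
    ultimately show False by simp
  qed
qed

context cocycle_blocks
begin

lemma mather_set_subset: "mather_set A \<subseteq> extremal_points"
  unfolding mather_set_def
  using msupport_subset_extremal supercritical_if_maximising
  by (auto simp: maximising_measures_def invariant_measures_iff)

text \<open>All geometric weights are positive, so the null sets of the mixture are the common null
  sets of the components. Being maximising is an almost-everywhere condition on invariant measures,
  hence inherited by the mixture.\<close>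

lemma countable_mixture_maximising:
  assumes \<nu>: "\<And>n::nat. \<nu> n \<in> maximising_measures A"
  obtains \<mu> where "\<mu> \<in> maximising_measures A"
    "\<And>U n. U \<in> sets borel \<Longrightarrow> 0 < emeasure (\<nu> n) U \<Longrightarrow> 0 < emeasure \<mu> U"
proof -
  let ?p = "geometric_pmf (1 / 2)"
  define \<mu> where "\<mu> = measure_pmf ?p \<bind> \<nu>"
  have \<nu>_inv: "\<nu> n \<in> invariant_measures" for n using \<nu> by (auto simp: maximising_measures_def)
  have sets\<nu>: "sets (\<nu> n) = sets borel" and prob\<nu>: "prob_space (\<nu> n)" and inv\<nu>: "distr (\<nu> n) borel shift = \<nu> n" for n
    using \<nu>_inv[of n] by (auto simp: invariant_measures_iff)
  have sp\<nu>: "space (\<nu> n) = UNIV" for n using sets_eq_imp_space_eq[OF sets\<nu>] by simp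
  have meas: "\<nu> \<in> measure_pmf ?p \<rightarrow>\<^sub>M subprob_algebra borel"
    by (auto simp: space_subprob_algebra sets\<nu> prob_space_imp_subprob_space prob\<nu> measurable_pmf_measure1)
  have sets\<mu>: "sets \<mu> = sets borel" unfolding \<mu>_def by (rule sets_bind) (auto simp: sets\<nu>)
  have sp\<mu>: "space \<mu> = UNIV" using sets_eq_imp_space_eq[OF sets\<mu>] by simp
  have em: "emeasure \<mu> X = (\<integral>\<^sup>+ n. emeasure (\<nu> n) X \<partial>measure_pmf ?p)" if "X \<in> sets borel" for X
    unfolding \<mu>_def by (rule emeasure_bind[OF _ meas that]) simp
  have null: "emeasure \<mu> X = 0 \<longleftrightarrow> (\<forall>n. emeasure (\<nu> n) X = 0)" if "X \<in> sets borel" for X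
    unfolding em[OF that] by (subst nn_integral_0_iff_AE) (auto simp: AE_measure_pmf_iff set_pmf_geometric)
  have prob: "prob_space \<mu>"
  proof (rule prob_spaceI)
    have "emeasure (\<nu> n) UNIV = 1" for n
      using prob_space.emeasure_space_1[OF prob\<nu>] by (simp add: sp\<nu>)
    then show "emeasure \<mu> (space \<mu>) = 1"
      by (simp add: sp\<mu> em measure_pmf.emeasure_space_1[simplified])
  qed
  have msh: "shift \<in> M \<rightarrow>\<^sub>M borel" if "sets M = sets borel" for M :: "(nat \<Rightarrow> 'i) measure"
    using shift_measurable that by (simp cong: measurable_cong_sets)
  have vim: "shift -` X \<in> sets borel" if "X \<in> sets borel" for X :: "(nat \<Rightarrow> 'i) set"
    using measurable_sets[OF shift_measurable that] by simp
  have "distr \<mu> borel shift = \<mu>"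
  proof (rule measure_eqI)
    fix X assume "X \<in> sets (distr \<mu> borel shift)"
    then have X: "X \<in> sets borel" by simp
    have "emeasure (\<nu> n) (shift -` X) = emeasure (\<nu> n) X" for n
      using emeasure_distr[OF msh[OF sets\<nu>] X, of n] by (simp add: inv\<nu> sp\<nu>)
    then show "emeasure (distr \<mu> borel shift) X = emeasure \<mu> X"
      using X by (simp add: emeasure_distr[OF msh[OF sets\<mu>] X] sp\<mu> em vim)
  qed (simp add: sets\<mu>)
  then have inv: "\<mu> \<in> invariant_measures" using prob sets\<mu> by (simp add: invariant_measures_iff)
  have Em: "- extremal_points \<in> sets borel" using closed_extremal_points by auto
  have "emeasure (\<nu> n) (- extremal_points) = 0" for n
    using maximising_iff_AE_extremal[OF \<nu>_inv[of n]] \<nu>[of n] Em sets\<nu>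
    by (subst (asm) AE_iff_measurable[of "- extremal_points"]) (auto simp: sp\<nu>)
  then have "emeasure \<mu> (- extremal_points) = 0" using null[OF Em] by blast
  then have "AE x in \<mu>. x \<in> extremal_points"
    using Em sets\<mu> by (subst AE_iff_measurable[of "- extremal_points"]) (auto simp: sp\<mu>)
  then have "\<mu> \<in> maximising_measures A" by (rule maximising_if_AE_extremal[OF inv])
  moreover have "0 < emeasure \<mu> U" if "U \<in> sets borel" "0 < emeasure (\<nu> n) U" for U n
    using null[OF that(1)] that(2) by (metis less_irrefl zero_less_iff_neq_zero)
  ultimately show ?thesis using that by blast
qed

text \<open>For each set of a countable base, choose a maximising measure that charges it, if there
  is one. A mixture of these charges every open set charged by some maximising measure.\<close>

lemma mather_set_eq_msupport:
  obtains \<mu> where "\<mu> \<in> maximising_measures A" "mather_set A = msupport \<mu>"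
proof -
  obtain U :: "nat \<Rightarrow> (nat \<Rightarrow> 'i) set" where U: "\<And>n. open (U n)"
    "\<And>V x. open V \<Longrightarrow> x \<in> V \<Longrightarrow> \<exists>n. x \<in> U n \<and> U n \<subseteq> V"
    by (rule compact_countable_base[OF compact_seq]) (rule that)
  have "\<exists>\<nu>\<in>maximising_measures A. (\<exists>\<mu>\<in>maximising_measures A. 0 < emeasure \<mu> (U n)) \<longrightarrow> 0 < emeasure \<nu> (U n)" for n
    using maximising_measures_nonempty by blast
  then obtain \<nu> where \<nu>: "\<And>n. \<nu> n \<in> maximising_measures A"
      "\<And>n \<mu>. \<mu> \<in> maximising_measures A \<Longrightarrow> 0 < emeasure \<mu> (U n) \<Longrightarrow> 0 < emeasure (\<nu> n) (U n)"
    by metis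
  obtain \<mu> where \<mu>: "\<mu> \<in> maximising_measures A"
     "\<And>U n. U \<in> sets borel \<Longrightarrow> 0 < emeasure (\<nu> n) U \<Longrightarrow> 0 < emeasure \<mu> U"
    by (rule countable_mixture_maximising[OF \<nu>(1)]) (rule that)
  have sets: "sets \<mu> = sets borel" using \<mu>(1) by (auto simp: maximising_measures_def invariant_measures_iff)
  have "x \<in> msupport \<mu>" if x: "x \<in> msupport \<mu>'" "\<mu>' \<in> maximising_measures A" for x \<mu>'
    unfolding msupport_def
  proof (intro CollectI allI impI)
    fix V assume V: "open V \<and> x \<in> V"
    then obtain n where n: "x \<in> U n" "U n \<subseteq> V" using U(2) by blast
    have "0 < emeasure \<mu>' (U n)" using x(1) U(1) n(1) by (auto simp: msupport_def)
    then have "0 < emeasure \<mu> (U n)" using \<mu>(2)[of "U n" n] \<nu>(2) x(2) U(1) by auto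
    also have "\<dots> \<le> emeasure \<mu> V" using n(2) V sets by (intro emeasure_mono) auto
    finally show "0 < emeasure \<mu> V" .
  qed
  then have "mather_set A = msupport \<mu>" unfolding mather_set_def using \<mu>(1) by blast
  with \<mu>(1) show ?thesis by (rule that)
qed

lemma closed_mather_set: "closed (mather_set A)"
  using mather_set_eq_msupport msupport_closed by metis

lemma mather_set_nonempty: "mather_set A \<noteq> {}"
proof
  assume empty: "mather_set A = {}"
  obtain \<mu> where \<mu>: "\<mu> \<in> maximising_measures A" "mather_set A = msupport \<mu>"
    by (rule mather_set_eq_msupport) (rule that)
  then have "prob_space \<mu>" "AE x in \<mu>. x \<in> msupport \<mu>"
    using AE_msupport[OF compact_seq] by (auto simp: maximising_measures_def invariant_measures_iff)
  then show False using empty \<mu>(2) prob_space.AE_False by fastforce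
qed

lemma AE_mather_set: "\<mu> \<in> maximising_measures A \<Longrightarrow> AE x in \<mu>. x \<in> mather_set A"
  using AE_msupport[OF compact_seq, of \<mu>]
  by (auto simp: maximising_measures_def invariant_measures_iff mather_set_def elim!: eventually_mono)

lemma maximising_iff_mather_set:
  assumes \<mu>: "\<mu> \<in> invariant_measures"
  shows "\<mu> \<in> maximising_measures A \<longleftrightarrow> emeasure \<mu> (mather_set A) = 1"
proof -
  have "prob_space \<mu>" and sets: "sets \<mu> = sets borel" using \<mu> by (auto simp: invariant_measures_iff)
  interpret prob_space \<mu> by fact
  have Zm: "mather_set A \<in> sets \<mu>" using closed_mather_set sets by simp
  have "emeasure \<mu> (mather_set A) = 1 \<longleftrightarrow> (AE x in \<mu>. x \<in> mather_set A)"
    using AE_in_set_eq_1[OF Zm] by (simp add: emeasure_eq_measure)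
  moreover have "(AE x in \<mu>. x \<in> mather_set A) \<Longrightarrow> \<mu> \<in> maximising_measures A"
    using mather_set_subset by (intro maximising_if_AE_extremal[OF \<mu>]) (auto elim!: eventually_mono)
  ultimately show ?thesis using AE_mather_set by blast
qed

lemma strongly_extremal_mather_set:
  assumes "x \<in> mather_set A"
  shows "strongly_extremal A x"
proof -
  obtain \<epsilon> where "0 < \<epsilon>" "\<And>x n. x \<in> extremal_points \<Longrightarrow> \<epsilon> * r ^ n \<le> mat_onorm (L x n)"
    using extremal_points_lower_bound by blast
  then show ?thesis using assms mather_set_subset unfolding strongly_extremal_def by blast
qed

text \<open>An extremal norm is the case \<open>T = mat 1\<close> of a projected seminorm, and its
  own operator norm provides the growth bounds. The argument for the blocks then applies directly to
  the whole space.\<close>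

lemma extremal_norm_mather_set:
  assumes N: "extremal_norm (range A) N" and x: "x \<in> mather_set A" and n: "1 \<le> n"
  shows "induced_norm N (L x n) = r ^ n"
proof -
  have isn: "is_norm N" and ext: "\<And>i. induced_norm N (A i) \<le> r" using N by (auto simp: extremal_norm_def)
  have N0: "0 \<le> N v" and N_eq_0: "N v = 0 \<longleftrightarrow> v = 0" and hom: "N (c *s v) = cmod c * N v"
    and tri: "N (v + w) \<le> N v + N w" for v w c
    using isn by (auto simp: is_norm_def)
  have homR: "N (c *\<^sub>R v) = \<bar>c\<bar> * N v" for c v
  proof -
    have "c *\<^sub>R v = of_real c *s v" by (simp add: vec_eq_iff scaleR_conv_of_real[where 'a = complex])
    then show ?thesis by (simp add: hom)
  qed
  obtain C where C: "0 < C" "\<And>v. N v \<le> C * norm v"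
    by (rule seminorm_le_norm[of N, OF tri _ N0]) (simp_all add: homR)
  have cN: "continuous_on UNIV N"
  proof (rule continuous_on_if_norm_lipschitz[OF _ continuous_on_id])
    fix v w
    show "N v \<le> N w + C * norm (v - w)" using tri[of w "v - w"] C(2)[of "v - w"] by simp
  qed
  have "compact (sphere (0 :: complex ^ 'd) 1)" by simp
  moreover have "axis undefined 1 \<in> sphere (0 :: complex ^ 'd) 1" by simp
  ultimately obtain u where u: "u \<in> sphere 0 1" "\<And>v. v \<in> sphere 0 1 \<Longrightarrow> N u \<le> N v"
    using continuous_attains_inf[of "sphere (0 :: complex ^ 'd) 1" N] continuous_on_subset[OF cN] by blast
  have Nu: "0 < N u" using u(1) N0[of u] N_eq_0[of u] by (auto simp: less_le)
  have low: "N u * norm v \<le> N v" for v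
  proof (cases "v = 0")
    case False
    have "N u \<le> N (inverse (norm v) *\<^sub>R v)" using False by (intro u(2)) simp
    then show ?thesis using False by (simp add: homR field_simps)
  qed (simp add: N0)
  interpret N: projected_seminorm "mat 1" N "N u" C
    by unfold_locales (auto simp: tri Nu low C)
  have op: "induced_norm N B = op_seminorm (mat 1) N B" for B
    by (simp add: induced_norm_def op_seminorm_def)
  have NL: "N (L x n *v v) \<le> r ^ n * N v" for x n v
  proof (induction n)
    case (Suc n)
    have "N (A (x n) *v (L x n *v v)) \<le> induced_norm N (A (x n)) * N (L x n *v v)"
      using N.le_op_seminorm[of "A (x n)" "L x n *v v"] by (simp add: op)
    also have "\<dots> \<le> r * (r ^ n * N v)"
      using Suc ext[of "x n"] jsr_pos N0 by (intro mult_mono) auto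
    finally show ?case by (simp add: matrix_vector_mul_assoc)
  qed simp
  obtain \<mu> where \<mu>: "\<mu> \<in> maximising_measures A" "x \<in> msupport \<mu>" using x by (auto simp: mather_set_def)
  have "op_seminorm (mat 1) N (L x n) = r ^ n"
  proof (rule supercritical_extremal_on_support[OF _ _ supercritical_if_maximising[OF \<mu>(1)] n _ _ _ _ \<mu>(2)])
    show "prob_space \<mu>" "sets \<mu> = sets borel"
      using \<mu>(1) by (auto simp: maximising_measures_def invariant_measures_iff)
    show "continuous_on UNIV (\<lambda>x. op_seminorm (mat 1) N (L x n))"
      by (rule N.continuous_on_op_seminorm[OF continuous_L])
    show "0 \<le> op_seminorm (mat 1) N (L x n)" for x by (rule N.op_seminorm_nonneg)
    show "op_seminorm (mat 1) N (L x n) \<le> r ^ n" for x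
      using jsr_pos by (intro N.op_seminorm_least) (auto simp: NL)
    fix \<eta> :: real assume \<eta>: "0 < \<eta>"
    have pos: "0 < op_seminorm (mat 1) N (L x n) + \<eta>" for x using N.op_seminorm_nonneg[of "L x n"] \<eta> by linarith
    show "growth_bound n (\<lambda>x. ln (op_seminorm (mat 1) N (L x n) + \<eta>))"
      unfolding growth_bound_def
    proof (rule exI[of _ N], rule exI[of _ "N u"], rule exI[of _ C], intro conjI allI)
      fix x v
      have "N (L x n *v v) \<le> op_seminorm (mat 1) N (L x n) * N v"
        using N.le_op_seminorm[of "L x n" v] by simp
      also have "\<dots> \<le> (op_seminorm (mat 1) N (L x n) + \<eta>) * N v" using \<eta> N0 by (intro mult_right_mono) auto
      finally show "N (L x n *v v) \<le> exp (ln (op_seminorm (mat 1) N (L x n) + \<eta>)) * N v" using pos by simp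
    qed (use Nu low C in auto)
  qed
  then show ?thesis by (simp add: op)
qed

text \<open>Otherwise the averages stay above some e along a subsequence. Weak extremality makes a
  weak limit along it maximising; that limit would integrate \<open>D\<close> to at least e,
  although it lives on the Mather set, where \<open>D\<close> is 0.\<close>

lemma weakly_extremal_average_zero:
  assumes z: "weakly_extremal A z" and D: "continuous_on UNIV D" "\<And>x. 0 \<le> D x" "\<And>x. x \<in> mather_set A \<Longrightarrow> D x = 0"
  shows "(\<lambda>n. (\<Sum>k<n. D ((shift ^^ k) z)) / n) \<longlonglongrightarrow> 0"
proof (rule ccontr)
  let ?a = "\<lambda>n. (\<Sum>k<n. D ((shift ^^ k) z)) / real n"
  assume "\<not> ?a \<longlonglongrightarrow> 0"
  then obtain e where e: "0 < e" "\<not> (\<forall>\<^sub>F n in sequentially. dist (?a n) 0 < e)"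
    unfolding tendsto_iff by blast
  have a0: "0 \<le> ?a n" for n by (intro divide_nonneg_nonneg sum_nonneg D(2)) auto
  have "infinite {n. e \<le> ?a n}"
  proof -
    have "dist (?a n) 0 = ?a n" for n unfolding dist_real_def diff_0_right by (rule abs_of_nonneg[OF a0])
    then show ?thesis
      using e(2) unfolding infinite_nat_iff_unbounded_le eventually_sequentially by (simp only: mem_Collect_eq not_ex not_all not_imp not_less) blast
  qed
  then obtain N :: "nat \<Rightarrow> nat" where N: "strict_mono N" "\<And>k. e \<le> ?a (N k)"
    using infinite_enumerate[of "{n. e \<le> ?a n}"] by auto
  \<comment> \<open>The average over no terms is 0 by division by zero, hence below e.\<close>
  have Npos: "0 < N k" for k using N(2)[of k] e(1) by (cases "N k") auto
  have Ntop: "filterlim N at_top sequentially" by (rule filterlim_subseq[OF N(1)])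
  have growth: "\<forall>\<^sub>F k in sequentially. exp (N k * (ln r - \<delta>)) \<le> mat_onorm (L z (N k))" if \<delta>: "0 < \<delta>" for \<delta>
  proof -
    have "exp (ln r - \<delta>) < exp (ln r)" using \<delta> by simp
    then have "exp (ln r - \<delta>) < r" using jsr_pos by simp
    then have "\<forall>\<^sub>F n in sequentially. exp (ln r - \<delta>) < root n (mat_onorm (L z n))"
      using z unfolding weakly_extremal_def by (intro order_tendstoD(1))
    from eventually_compose_filterlim[OF this Ntop] show ?thesis
    proof eventually_elim
      case (elim k)
      have "exp (ln r - \<delta>) ^ N k \<le> root (N k) (mat_onorm (L z (N k))) ^ N k"
        using elim by (intro power_mono) auto
      then show ?case using Npos[of k] by (simp add: exp_of_nat_mult mat_onorm_nonneg)
    qed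
  qed
  obtain s \<mu> where s: "strict_mono (s :: nat \<Rightarrow> nat)" and \<mu>: "\<mu> \<in> maximising_measures A"
    and lim: "\<And>f. continuous_on UNIV f \<Longrightarrow>
       (\<lambda>k. (\<Sum>j<N (s k). f ((shift ^^ j) z)) / N (s k)) \<longlonglongrightarrow> integral\<^sup>L \<mu> f"
    by (rule empirical_measures_maximising[where N = N and y = "\<lambda>_. z", OF Ntop Npos growth]) (assumption, rule that)
  have "e \<le> integral\<^sup>L \<mu> D" by (rule LIMSEQ_le_const[OF lim[OF D(1)]]) (use N(2) in auto)
  moreover have "integral\<^sup>L \<mu> D = 0"
    by (rule integral_eq_zero_AE) (use AE_mather_set[OF \<mu>] D(3) in \<open>auto elim!: eventually_mono\<close>)
  ultimately show False using e(1) by simp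
qed

end

text \<open>The metric \<open>d\<close> is an arbitrary one for the topology, not the
  \<open>dist\<close> of the type. The distance function is 1-Lipschitz for \<open>d\<close>, and
  balls of \<open>d\<close> are open.\<close>

lemma continuous_on_distance_to_set:
  fixes d :: "'a::topological_space \<Rightarrow> 'a \<Rightarrow> real"
  assumes d: "Metric_space UNIV d" "Metric_space.mtopology UNIV d = (euclidean :: 'a topology)" and "Z \<noteq> {}"
  shows "continuous_on UNIV (\<lambda>x. Inf {d x y |y. y \<in> Z})" "0 \<le> Inf {d x y |y. y \<in> Z}"
    "x \<in> Z \<Longrightarrow> Inf {d x y |y. y \<in> Z} = 0"
proof -
  interpret Metric_space UNIV d by fact
  define D where "D x = Inf {d x y |y. y \<in> Z}" for x
  have bdd: "bdd_below {d x y |y. y \<in> Z}" for x by (rule bdd_belowI[of _ 0]) auto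
  have ne: "{d x y |y. y \<in> Z} \<noteq> {}" for x using \<open>Z \<noteq> {}\<close> by blast
  have D0: "0 \<le> D x" for x unfolding D_def by (rule cInf_greatest[OF ne]) auto
  have Dle: "D x \<le> d x y" if "y \<in> Z" for x y unfolding D_def by (rule cInf_lower[OF _ bdd]) (use that in auto)
  have lip: "D x \<le> D y + d x y" for x y
  proof -
    have "D x - d x y \<le> D y"
      unfolding D_def[of y]
    proof (rule cInf_greatest[OF ne])
      fix t assume "t \<in> {d y w |w. w \<in> Z}"
      then obtain w where w: "w \<in> Z" "t = d y w" by blast
      have "D x \<le> d x w" by (rule Dle[OF w(1)])
      also have "\<dots> \<le> d x y + d y w" by (rule triangle) auto
      finally show "D x - d x y \<le> t" using w(2) by simp
    qed
    then show ?thesis by simp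
  qed
  have "continuous_on UNIV D"
    unfolding continuous_on_def
  proof (intro ballI tendstoI)
    fix x and e :: real assume "0 < e"
    have "open (mball x e)" using openin_mball[of x e] d(2) by simp
    moreover have "x \<in> mball x e" using \<open>0 < e\<close> by simp
    moreover have "dist (D y) (D x) < e" if "y \<in> mball x e" for y
      using lip[of x y] lip[of y x] that commute[of x y] by (auto simp: dist_real_def in_mball)
    ultimately show "\<forall>\<^sub>F y in at x. dist (D y) (D x) < e"
      unfolding eventually_at_topological by blast
  qed
  then show "continuous_on UNIV (\<lambda>x. Inf {d x y |y. y \<in> Z})" unfolding D_def .
  show "0 \<le> Inf {d x y |y. y \<in> Z}" using D0 unfolding D_def .
  show "Inf {d x y |y. y \<in> Z} = 0" if "x \<in> Z" using D0[of x] Dle[OF that, of x] unfolding D_def by simp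
qed

section \<open>Recurrent points\<close>

lemma matrix_mult_scaleR: "(c *\<^sub>R X) ** (e *\<^sub>R Y) = (c * e) *\<^sub>R (X ** Y)"
  for X Y :: "complex ^ 'd ^ 'd"
  by (simp add: vec_eq_iff matrix_matrix_mult_def scaleR_sum_right mult.commute)

lemma seq_compact_subseq:
  assumes "seq_compact S" "\<And>n. f n \<in> S"
  obtains l s where "l \<in> S" "strict_mono (s :: nat \<Rightarrow> nat)" "(\<lambda>n. f (s n)) \<longlonglongrightarrow> l"
  using assms unfolding seq_compact_def comp_def by blast

lemma continuous_on_UNIV_nhds:
  assumes "continuous_on UNIV f"
  shows "(f \<longlongrightarrow> f x) (nhds x)"
  using continuous_on_tendsto_compose[OF assms filterlim_ident, of x] by simp

primrec mat_power :: "complex ^ 'd ^ 'd \<Rightarrow> nat \<Rightarrow> complex ^ 'd ^ 'd" where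
  "mat_power P 0 = mat 1"
| "mat_power P (Suc n) = P ** mat_power P n"

lemma mat_power_add: "mat_power P (m + n) = mat_power P m ** mat_power P n"
  by (induction m) (auto simp: matrix_mul_assoc)

lemma tendsto_matrix_mult:
  fixes X Y :: "'a \<Rightarrow> complex ^ 'd ^ 'd"
  assumes "(X \<longlongrightarrow> P) F" "(Y \<longlongrightarrow> Q) F"
  shows "((\<lambda>k. X k ** Y k) \<longlongrightarrow> P ** Q) F"
proof -
  have "continuous_on UNIV (\<lambda>q :: (complex ^ 'd ^ 'd) \<times> (complex ^ 'd ^ 'd). fst q ** snd q)"
    by (intro continuous_intros)
  then have "((\<lambda>q. fst q ** snd q) \<longlongrightarrow> fst (P, Q) ** snd (P, Q)) (nhds (P, Q))"
    by (rule continuous_on_UNIV_nhds)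
  from filterlim_compose[OF this tendsto_Pair[OF assms]] show ?thesis by simp
qed

text \<open>If \<open>R\<close> is the limit of \<open>P\<^bsup>n(j)\<^esup>\<close> and \<open>Y\<close> that of \<open>P\<^bsup>n(k(j)) - 2 n(j)\<^esup>\<close>, then \<open>R = Y ** R ** R\<close>, so that
  \<open>Y ** R\<close> is idempotent.\<close>

lemma compact_matrix_semigroup_idempotent:
  fixes S :: "(complex ^ 'd ^ 'd) set"
  assumes S: "compact S" "S \<noteq> {}" and mult: "\<And>P Q. P \<in> S \<Longrightarrow> Q \<in> S \<Longrightarrow> P ** Q \<in> S"
  obtains E where "E \<in> S" "E ** E = E"
proof -
  obtain P where P: "P \<in> S" using S(2) by blast
  have pow: "mat_power P (Suc n) \<in> S" for n
    by (induction n) (use P mult in auto)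
  have seq: "seq_compact S" using S(1) by (simp add: compact_imp_seq_compact)
  obtain R a where a: "strict_mono a" and R: "R \<in> S" "(\<lambda>j. mat_power P (Suc (a j))) \<longlonglongrightarrow> R"
    by (rule seq_compact_subseq[OF seq, of "\<lambda>n. mat_power P (Suc n)", OF pow]) (rule that)
  \<comment> \<open>Exponents enter as successors. The 3 makes \<open>a (k j)\<close> exceed twice
    \<open>a j\<close> plus 2, so the natural subtraction in \<open>c\<close> is not truncated and
    \<open>Suc (a (k j)) = Suc (c j) + 2 * Suc (a j)\<close>.\<close>
  define k where "k j = 2 * a j + 3" for j
  define c where "c j = a (k j) - 2 * a j - 2" for j
  have ak: "2 * a j + 3 \<le> a (k j)" for j using seq_suble[OF a, of "k j"] by (simp add: k_def)
  obtain Y s where s: "strict_mono s" and Y: "Y \<in> S" "(\<lambda>j. mat_power P (Suc (c (s j)))) \<longlonglongrightarrow> Y"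
    by (rule seq_compact_subseq[OF seq, of "\<lambda>j. mat_power P (Suc (c j))", OF pow]) (rule that)
  have Rs: "(\<lambda>j. mat_power P (Suc (a (s j)))) \<longlonglongrightarrow> R"
    using LIMSEQ_subseq_LIMSEQ[OF R(2) s] by (simp add: comp_def)
  have "filterlim (\<lambda>j. k (s j)) at_top sequentially"
  proof (rule filterlim_at_top_mono[OF filterlim_subseq[OF s]])
    have "j \<le> k j" for j using seq_suble[OF a, of j] by (simp add: k_def)
    then show "\<forall>\<^sub>F j in sequentially. s j \<le> k (s j)" by simp
  qed
  from filterlim_compose[OF R(2) this] have "(\<lambda>j. mat_power P (Suc (a (k (s j))))) \<longlonglongrightarrow> R" .
  moreover have "mat_power P (Suc (a (k j))) = mat_power P (Suc (c j)) ** (mat_power P (Suc (a j)) ** mat_power P (Suc (a j)))" for j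
  proof -
    have "Suc (a (k j)) = Suc (c j) + (Suc (a j) + Suc (a j))" using ak[of j] by (simp add: c_def)
    then show ?thesis by (simp only: mat_power_add)
  qed
  ultimately have "(\<lambda>j. mat_power P (Suc (c (s j))) ** (mat_power P (Suc (a (s j))) ** mat_power P (Suc (a (s j))))) \<longlonglongrightarrow> R"
    by simp
  then have R_eq: "R = Y ** (R ** R)"
    by (rule LIMSEQ_unique[OF _ tendsto_matrix_mult[OF Y(2) tendsto_matrix_mult[OF Rs Rs]]])
  \<comment> \<open>Both factors are limits of powers of the same \<open>P\<close>.\<close>
  have comm: "Y ** R = R ** Y"
  proof (rule LIMSEQ_unique[OF tendsto_matrix_mult[OF Y(2) Rs]])
    have "mat_power P m ** mat_power P n = mat_power P n ** mat_power P m" for m n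
      by (simp only: mat_power_add[symmetric] add.commute)
    then show "(\<lambda>j. mat_power P (Suc (c (s j))) ** mat_power P (Suc (a (s j)))) \<longlonglongrightarrow> R ** Y"
      using tendsto_matrix_mult[OF Rs Y(2)] by (simp only:)
  qed
  have "(Y ** R) ** (Y ** R) = (Y ** R) ** (R ** Y)" by (simp add: comm)
  also have "\<dots> = (Y ** (R ** R)) ** Y" by (simp add: matrix_mul_assoc)
  also have "\<dots> = Y ** R" using R_eq comm by simp
  finally show ?thesis using that mult[OF Y(1) R(1)] by blast
qed

context matrix_cocycle
begin

text \<open>Repeating the first n entries of \<open>x\<close> k times produces the eigenvalue
  \<open>c ^ k\<close> for a product of length \<open>n * k\<close>, and the growth of
  \<open>sup_norm\<close> along such lengths bounds \<open>cmod c\<close>.\<close>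

lemma mat_spectral_radius_cocycle_le:
  assumes n: "1 \<le> n"
  shows "mat_spectral_radius (L x n) \<le> r ^ n"
proof -
  obtain c where c: "det (mat c - L x n) = 0" "cmod c = mat_spectral_radius (L x n)"
    by (rule mat_spectral_radius_attained)
  then obtain v where v: "v \<noteq> 0" "L x n *v v = c *s v" using eigenvalue_iff_det by blast
  have "cmod c \<le> r ^ n"
  proof (cases "c = 0")
    case True
    then show ?thesis using jsr_pos by simp
  next
    case False
    have pow: "\<exists>z. L z (n * k) *v v = c ^ k *s v" for k
    proof (induction k)
      case (Suc k)
      then obtain z where z: "L z (n * k) *v v = c ^ k *s v" by blast
      obtain w where "L w (n * k + n) = L x n ** L z (n * k)" by (rule cocycle_mult_eq_cocycle)
      then have "L w (n * Suc k) *v v = c ^ Suc k *s v"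
        using z v(2) by (simp add: add.commute matrix_vector_mul_assoc[symmetric] vec.scale mult.commute)
      then show ?case by blast
    qed simp
    have "cmod c ^ k \<le> sup_norm (n * k)" for k
    proof -
      obtain z where z: "L z (n * k) *v v = c ^ k *s v" using pow by blast
      have "cmod c ^ k * norm v = norm (c ^ k *s v)"
        by (simp add: norm_vec_def norm_mult norm_power L2_set_right_distrib)
      also have "\<dots> \<le> sup_norm (n * k) * norm v"
        unfolding z[symmetric]
        by (rule order_trans[OF norm_matrix_vector_le mult_right_mono[OF norm_le_sup_norm norm_ge_zero]])
      finally show ?thesis using v(1) by simp
    qed
    note le = this
    have "ln (cmod c) / n \<le> ln r"
    proof (rule LIMSEQ_le_const)
      have "filterlim (\<lambda>k. n * k) at_top sequentially"
        by (rule filterlim_subseq) (use n in \<open>auto simp: strict_mono_def\<close>)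
      from filterlim_compose[OF ln_sup_norm_LIMSEQ this]
      show "(\<lambda>k. ln (sup_norm (n * k)) / real (n * k)) \<longlonglongrightarrow> ln r" .
      have "ln (cmod c) / n \<le> ln (sup_norm (n * k)) / real (n * k)" if k: "1 \<le> k" for k
      proof -
        have "ln (cmod c ^ k) \<le> ln (sup_norm (n * k))" using le[of k] False by (intro ln_mono) auto
        then have "k * ln (cmod c) \<le> ln (sup_norm (n * k))" using False by (simp add: ln_realpow)
        then show ?thesis using n k by (simp add: field_simps)
      qed
      then show "\<exists>N. \<forall>k\<ge>N. ln (cmod c) / n \<le> ln (sup_norm (n * k)) / real (n * k)" by blast
    qed
    then have "ln (cmod c) \<le> ln (r ^ n)" using n jsr_pos by (simp add: field_simps ln_realpow)
    then show ?thesis using False jsr_pos by (subst (asm) ln_le_cancel_iff) auto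
  qed
  then show ?thesis using c(2) by simp
qed

text \<open>The limits of the normalised blocks along return times of \<open>x\<close> form a compact semigroup that
  does not contain 0. An idempotent in it has the eigenvalue 1, and so the blocks near it have
  eigenvalues near 1.\<close>

lemma spectral_radius_at_recurrent_point:
  assumes rec: "recurrent x" and T: "block T p" and ext: "\<And>n. op_seminorm T p (L x n) = r ^ n" and \<delta>: "0 < \<delta>" "\<delta> < 1"
  shows "\<exists>t\<ge>N. (1 - \<delta>) * r ^ t \<le> mat_spectral_radius (L x t)"
proof -
  obtain lo hi where "projected_seminorm T p lo hi" using T unfolding block_def by blast
  then interpret projected_seminorm T p lo hi .
  obtain K1 where K1: "0 < K1" "\<And>A :: complex ^ 'd ^ 'd. norm A \<le> K1 * mat_onorm A"
    by (rule norm_le_mat_onorm) (rule that)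
  obtain K2 where K2: "0 < K2" "\<And>A :: complex ^ 'd ^ 'd. mat_onorm A \<le> K2 * norm A"
    by (rule mat_onorm_le_norm) (rule that)
  define C where "C n y = inverse (r ^ n) *\<^sub>R (T ** L y n ** T)" for n y
  have rn: "0 < r ^ n" for n using jsr_pos by simp
  have C_add: "C (t + s) x = C s ((shift ^^ t) x) ** C t x" for s t
  proof -
    have "T *v (L ((shift ^^ t) x) s *v (L x t *v (T *v v))) = T *v (L ((shift ^^ t) x) s *v (T *v (L x t *v (T *v v))))" for v
      using T unfolding block_def by blast
    then have "T ** L x (t + s) ** T = (T ** L ((shift ^^ t) x) s ** T) ** (T ** L x t ** T)"
      by (simp add: matrix_eq cocycle_add matrix_vector_mul_assoc[symmetric] idem)
    then show ?thesis by (simp add: C_def matrix_mult_scaleR power_add mult.commute)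
  qed
  have C_onorm: "mat_onorm (C n y) = mat_onorm (T ** L y n ** T) / r ^ n" for n y
    using rn[of n] by (simp add: C_def mat_onorm_scaleR divide_inverse mult.commute)
  \<comment> \<open>The seminorm of each product equals \<open>r ^ n\<close>; comparing it with the
    Frobenius norm of the normalised block leaves this constant. It keeps 0 out of
    \<open>S\<close>.\<close>
  define b where "b = lo / (hi * K2)"
  have b: "0 < b" using lo(1) hi(1) K2(1) by (simp add: b_def)
  have lower: "b \<le> norm (C n x)" for n
  proof -
    have "r ^ n \<le> hi / lo * mat_onorm (T ** L x n ** T)" using op_seminorm_le_onorm[of "L x n"] ext by simp
    then have "lo \<le> hi * mat_onorm (C n x)" using lo(1) hi(1) rn[of n] by (simp add: C_onorm field_simps)
    also have "\<dots> \<le> hi * (K2 * norm (C n x))" using hi(1) by (intro mult_left_mono K2) auto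
    finally show ?thesis using hi(1) K2(1) by (simp add: b_def field_simps)
  qed
  define R where "R = K1 * (hi / lo * mat_onorm T)"
  have upper: "norm (C n x) \<le> R" for n
  proof -
    have "mat_onorm (T ** L x n ** T) \<le> hi / lo * mat_onorm T * r ^ n"
      using onorm_le_op_seminorm[of "L x n"] ext by simp
    then have "mat_onorm (C n x) \<le> hi / lo * mat_onorm T"
      using rn[of n] unfolding C_onorm by (subst pos_divide_le_eq) auto
    then show ?thesis using K1 unfolding R_def by (meson less_imp_le mult_left_mono order_trans)
  qed
  \<comment> \<open>The return of the orbit to \<open>x\<close> and the closeness of the block to
    \<open>Q\<close> are required at the same time t. This is what allows two such times to be
    composed.\<close>
  define S where "S = {Q. \<forall>\<epsilon>>0. \<forall>M. \<exists>t\<ge>M. dist ((shift ^^ t) x) x < \<epsilon> \<and> dist (C t x) Q < \<epsilon>}"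
  have S_dest: "\<exists>t\<ge>M. dist ((shift ^^ t) x) x < \<epsilon> \<and> dist (C t x) Q < \<epsilon>" if "Q \<in> S" "0 < \<epsilon>" for Q \<epsilon> M
    using that unfolding S_def by blast
  have S_bound: "norm Q \<le> R + 1" if Q: "Q \<in> S" for Q
  proof -
    obtain t where "dist (C t x) Q < 1" using S_dest[OF Q, of 1] by auto
    then show ?thesis using upper[of t] norm_triangle_sub[of Q "C t x"] by (simp add: dist_norm norm_minus_commute)
  qed
  have S_nonzero: "Q \<noteq> 0" if Q: "Q \<in> S" for Q
  proof
    assume "Q = 0"
    then obtain t where "dist (C t x) 0 < b" using S_dest[OF Q b] by auto
    then show False using lower[of t] by simp
  qed
  have "closed S"
  proof (subst closed_sequential_limits, intro allI impI, elim conjE)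
    fix q Q assume q: "\<forall>n. q n \<in> S" and lim: "q \<longlonglongrightarrow> Q"
    show "Q \<in> S"
      unfolding S_def
    proof (intro CollectI allI impI)
      fix \<epsilon> :: real and M :: nat assume \<epsilon>: "0 < \<epsilon>"
      have "\<forall>\<^sub>F n in sequentially. dist (q n) Q < \<epsilon> / 2" using lim by (rule tendstoD) (use \<epsilon> in simp)
      then obtain n where n: "dist (q n) Q < \<epsilon> / 2" by (auto simp: eventually_sequentially)
      have "q n \<in> S" "0 < \<epsilon> / 2" using q \<epsilon> by auto
      from S_dest[OF this] obtain t where t: "t \<ge> M" "dist ((shift ^^ t) x) x < \<epsilon> / 2" "dist (C t x) (q n) < \<epsilon> / 2"
        by blast
      have "dist (C t x) Q < \<epsilon>" using t(3) n dist_triangle[of "C t x" Q "q n"] by simp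
      then show "\<exists>t\<ge>M. dist ((shift ^^ t) x) x < \<epsilon> \<and> dist (C t x) Q < \<epsilon>" using t \<epsilon> by (intro exI[of _ t]) auto
    qed
  qed
  moreover have "bounded S" using S_bound by (auto simp: bounded_iff)
  ultimately have cS: "compact S" by (simp add: compact_eq_bounded_closed)
  have S_ne: "S \<noteq> {}"
  proof -
    obtain q where q: "strict_mono q" "(\<lambda>j. (shift ^^ q j) x) \<longlonglongrightarrow> x" using rec unfolding recurrent_def by blast
    have "compact (cball 0 R :: (complex ^ 'd ^ 'd) set)" by simp
    then have "seq_compact (cball 0 R :: (complex ^ 'd ^ 'd) set)" by (rule compact_imp_seq_compact)
    then obtain Q s where s: "strict_mono s" "(\<lambda>j. C (q (s j)) x) \<longlonglongrightarrow> Q"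
      using seq_compact_subseq[of "cball 0 R" "\<lambda>j. C (q j) x"] upper by (metis mem_cball_0)
    have "Q \<in> S"
      unfolding S_def
    proof (intro CollectI allI impI)
      fix \<epsilon> :: real and M :: nat assume \<epsilon>: "0 < \<epsilon>"
      have "(\<lambda>j. (shift ^^ q (s j)) x) \<longlonglongrightarrow> x" using LIMSEQ_subseq_LIMSEQ[OF q(2) s(1)] by (simp add: comp_def)
      from tendstoD[OF this \<epsilon>] tendstoD[OF s(2) \<epsilon>] eventually_ge_at_top[of M]
      have "\<forall>\<^sub>F j in sequentially. M \<le> q (s j) \<and> dist ((shift ^^ q (s j)) x) x < \<epsilon> \<and> dist (C (q (s j)) x) Q < \<epsilon>"
      proof eventually_elim
        case (elim j)
        then show ?case using seq_suble[OF q(1), of "s j"] seq_suble[OF s(1), of j] by simp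
      qed
      then show "\<exists>t\<ge>M. dist ((shift ^^ t) x) x < \<epsilon> \<and> dist (C t x) Q < \<epsilon>"
        by (auto simp: eventually_sequentially)
    qed
    then show ?thesis by blast
  qed
  have S_mult: "P ** Q \<in> S" if PQ: "P \<in> S" "Q \<in> S" for P Q
    unfolding S_def
  proof (intro CollectI allI impI)
    fix \<epsilon> :: real and M :: nat assume \<epsilon>: "0 < \<epsilon>"
    have "((\<lambda>q. q) \<longlongrightarrow> (P, Q)) (nhds (P, Q))" by (rule filterlim_ident)
    from tendsto_matrix_mult[OF tendsto_fst[OF this] tendsto_snd[OF this]]
    have "((\<lambda>q. fst q ** snd q) \<longlongrightarrow> P ** Q) (nhds (P, Q))" by simp
    from tendstoD[OF this \<epsilon>] obtain d where d: "0 < d"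
      "\<And>X Y. dist (X, Y) (P, Q) < d \<Longrightarrow> dist (X ** Y) (P ** Q) < \<epsilon>"
      unfolding eventually_nhds_metric by auto
    have d': "dist (X ** Y) (P ** Q) < \<epsilon>" if "dist X P < d / 2" "dist Y Q < d / 2" for X Y
    proof (rule d(2))
      have "dist (X, Y) (P, Q) \<le> dist X P + dist Y Q" unfolding dist_Pair_Pair by (rule sqrt_sum_squares_le_sum) auto
      then show "dist (X, Y) (P, Q) < d" using that by linarith
    qed
    \<comment> \<open>The order of choice matters: the block of length \<open>t1\<close> is applied
      after \<open>t2\<close> steps, at a point near \<open>x\<close> but different from it. So
      \<open>t1\<close> is fixed first, then a neighbourhood of \<open>x\<close> on which this block
      hardly changes, and only then a return time \<open>t2\<close> into that neighbourhood.\<close>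
    obtain t1 where t1: "t1 \<ge> M" "dist ((shift ^^ t1) x) x < min (\<epsilon> / 2) (d / 4)" "dist (C t1 x) P < min (\<epsilon> / 2) (d / 4)"
      using S_dest[OF PQ(1), of "min (\<epsilon> / 2) (d / 4)" M] \<epsilon> d(1) by auto
    have cC: "continuous_on UNIV (C t1)"
      unfolding C_def by (intro continuous_intros continuous_L)
    have "((\<lambda>y. C t1 y) \<longlongrightarrow> C t1 x) (nhds x)" "((\<lambda>y. (shift ^^ t1) y) \<longlongrightarrow> (shift ^^ t1) x) (nhds x)"
      by (rule continuous_on_UNIV_nhds[OF cC], rule continuous_on_UNIV_nhds[OF continuous_on_shift])
    then have "\<forall>\<^sub>F y in nhds x. dist (C t1 y) (C t1 x) < d / 4 \<and> dist ((shift ^^ t1) y) ((shift ^^ t1) x) < \<epsilon> / 2"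
      using d(1) \<epsilon> by (intro eventually_conj tendstoD) auto
    then obtain e where e: "0 < e" "\<And>y. dist y x < e \<Longrightarrow> dist (C t1 y) (C t1 x) < d / 4 \<and> dist ((shift ^^ t1) y) ((shift ^^ t1) x) < \<epsilon> / 2"
      unfolding eventually_nhds_metric by blast
    obtain t2 where t2: "t2 \<ge> M" "dist ((shift ^^ t2) x) x < min e (d / 2)" "dist (C t2 x) Q < min e (d / 2)"
      using S_dest[OF PQ(2), of "min e (d / 2)" M] e(1) d(1) by auto
    let ?y = "(shift ^^ t2) x"
    have y: "dist (C t1 ?y) (C t1 x) < d / 4" "dist ((shift ^^ t1) ?y) ((shift ^^ t1) x) < \<epsilon> / 2"
      using e(2)[of ?y] t2(2) by auto
    have "dist (C t1 ?y) P < d / 2" using y(1) t1(3) dist_triangle[of "C t1 ?y" P "C t1 x"] by simp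
    then have "dist (C (t2 + t1) x) (P ** Q) < \<epsilon>" unfolding C_add using t2(3) by (intro d') auto
    moreover have "dist ((shift ^^ (t2 + t1)) x) x < \<epsilon>"
      using y(2) t1(2) dist_triangle[of "(shift ^^ t1) ?y" x "(shift ^^ t1) x"] by (simp add: shift_funpow_add)
    ultimately show "\<exists>t\<ge>M. dist ((shift ^^ t) x) x < \<epsilon> \<and> dist (C t x) (P ** Q) < \<epsilon>"
      using t1(1) by (intro exI[of _ "t2 + t1"]) auto
  qed
  obtain E where E: "E \<in> S" "E ** E = E" by (rule compact_matrix_semigroup_idempotent[OF cS S_ne S_mult])
  obtain v where v: "E *v v \<noteq> 0" using S_nonzero[OF E(1)] by (metis matrix_eq matrix_vector_mult_0)
  have "E *v (E *v v) = 1 *s (E *v v)" by (simp add: matrix_vector_mul_assoc E(2))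
  then have det1: "det (mat 1 - E) = 0" using v eigenvalue_iff_det[of E 1] by blast
  have "\<exists>t\<ge>M. dist (C t x) E < inverse (real (Suc M))" for M
    using S_dest[OF E(1), of "inverse (real (Suc M))" M] by (auto simp del: of_nat_Suc)
  then obtain t where t: "\<And>M. t M \<ge> M" "\<And>M. dist (C (t M) x) E < inverse (real (Suc M))" by metis
  have "(\<lambda>M. C (t M) x) \<longlonglongrightarrow> E"
    by (rule metric_tendsto_imp_tendsto[OF LIMSEQ_inverse_real_of_nat])
       (use t(2) in \<open>auto intro!: always_eventually less_imp_le simp del: of_nat_Suc\<close>)
  from eigenvalues_lower_semicontinuous[OF this det1 \<delta>(1)] eventually_ge_at_top[of N]
  have "\<forall>\<^sub>F M in sequentially. N \<le> M \<and> (\<exists>z. cmod (z - 1) < \<delta> \<and> det (mat z - C (t M) x) = 0)"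
    by eventually_elim auto
  then obtain M z where M: "N \<le> M" "cmod (z - 1) < \<delta>" "det (mat z - C (t M) x) = 0"
    by (auto simp: eventually_sequentially)
  have z: "1 - \<delta> \<le> cmod z" using M(2) norm_triangle_ineq2[of 1 "1 - z"] by (simp add: norm_minus_commute)
  then have z0: "z \<noteq> 0" using \<delta>(2) by auto
  \<comment> \<open>Undoing the normalisation. The eigenvalue is nonzero because
    \<open>\<delta> < 1\<close>, so the last clause of \<open>block\<close> lifts it to the full
    product.\<close>
  let ?n = "t M" and ?c = "of_real (r ^ t M) * z"
  obtain w where w: "w \<noteq> 0" "C ?n x *v w = z *s w" using M(3) eigenvalue_iff_det by blast
  have "T *v (L x ?n *v (T *v w)) = (T ** L x ?n ** T) *v w" by (simp add: matrix_vector_mul_assoc[symmetric])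
  also have "T ** L x ?n ** T = r ^ ?n *\<^sub>R C ?n x" using jsr_pos by (simp add: C_def)
  also have "(r ^ ?n *\<^sub>R C ?n x) *v w = r ^ ?n *\<^sub>R (C ?n x *v w)"
    by (simp add: vec_eq_iff matrix_vector_mult_def scaleR_sum_right)
  also have "\<dots> = ?c *s w" by (simp add: w(2) vec_eq_iff scaleR_conv_of_real[where 'a = complex])
  finally have "T *v (L x ?n *v (T *v w)) = ?c *s w" .
  moreover have "?c \<noteq> 0" using z0 rn[of ?n] jsr_pos by simp
  ultimately obtain u where "u \<noteq> 0" "L x ?n *v u = ?c *s u"
    using T w(1) unfolding block_def by blast
  then have "det (mat ?c - L x ?n) = 0" using eigenvalue_iff_det by blast
  then have "cmod ?c \<le> mat_spectral_radius (L x ?n)" by (rule mat_spectral_radius_ge)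
  then have "r ^ ?n * cmod z \<le> mat_spectral_radius (L x ?n)" using jsr_pos by (simp add: norm_mult norm_power)
  moreover have "(1 - \<delta>) * r ^ ?n \<le> r ^ ?n * cmod z" using z rn[of ?n] by (simp add: mult.commute mult_left_mono)
  ultimately show ?thesis using t(1)[of M] M(1) by (intro exI[of _ ?n]) auto
qed

lemma limsup_spectral_radius_recurrent:
  assumes "recurrent x" "block T p" "\<And>n. op_seminorm T p (L x n) = r ^ n"
  shows "limsup (\<lambda>n. ereal (r powi (- int n) * mat_spectral_radius (L x n))) = 1"
proof (rule antisym)
  let ?f = "\<lambda>n. r powi (- int n) * mat_spectral_radius (L x n)"
  have f: "?f n = mat_spectral_radius (L x n) / r ^ n" for n
    by (simp add: power_int_minus divide_inverse mult.commute)
  have rn: "0 < r ^ n" for n using jsr_pos by simp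
  show "limsup (\<lambda>n. ereal (?f n)) \<le> 1"
  proof (rule Limsup_bounded)
    show "\<forall>\<^sub>F n in sequentially. ereal (?f n) \<le> 1"
      using eventually_ge_at_top[of 1]
    proof eventually_elim
      case (elim n)
      then show ?case unfolding f using mat_spectral_radius_cocycle_le[OF elim, of x] rn[of n] by simp
    qed
  qed
  show "1 \<le> limsup (\<lambda>n. ereal (?f n))"
  proof (rule ccontr)
    assume "\<not> ?thesis"
    then have "limsup (\<lambda>n. ereal (?f n)) < 1" by simp
    then obtain c where c: "limsup (\<lambda>n. ereal (?f n)) < ereal c" "ereal c < 1"
      using ereal_dense2 by blast
    \<comment> \<open>The 1/2 keeps \<open>\<delta>\<close> below 1 also when c is not
      positive.\<close>
    define \<delta> where "\<delta> = min (1 - c) (1 / 2)"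
    have \<delta>: "0 < \<delta>" "\<delta> < 1" "c \<le> 1 - \<delta>" using c(2) by (auto simp: \<delta>_def)
    have "\<forall>\<^sub>F n in sequentially. ereal (?f n) < ereal c" by (rule Limsup_lessD[OF c(1)])
    then obtain N where N: "\<And>n. N \<le> n \<Longrightarrow> ?f n < c" by (auto simp: eventually_sequentially)
    obtain t where t: "N \<le> t" "(1 - \<delta>) * r ^ t \<le> mat_spectral_radius (L x t)"
      using spectral_radius_at_recurrent_point[OF assms \<delta>(1,2)] by blast
    then have "1 - \<delta> \<le> ?f t" unfolding f using rn[of t] by (simp add: pos_le_divide_eq)
    then show False using N[OF t(1)] \<delta>(3) by linarith
  qed
qed

end

theorem theorem2p3:
  fixes AA :: "(complex ^ 'd ^ 'd) set"
    and A :: "'i::metric_space \<Rightarrow> complex ^ 'd ^ 'd"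
    and Z :: "(nat \<Rightarrow> 'i) set"
  assumes "compact AA"
    and "0 < joint_spectral_radius AA"
    and "index_set_for A AA"
    and "Z = mather_set A"
  shows
    "((\<exists>\<mu>\<in>invariant_measures. Z = msupport \<mu>) \<and> compact Z \<and> Z \<noteq> {} \<and> shift ` Z = Z) \<and>
     (\<forall>\<mu>\<in>invariant_measures. \<mu> \<in> maximising_measures A \<longleftrightarrow> emeasure \<mu> Z = 1) \<and>
     (\<forall>x\<in>Z. recurrent x \<longrightarrow>
           limsup (\<lambda>n. ereal (joint_spectral_radius AA powi (- int n) * mat_spectral_radius (cocycle A x n))) = 1) \<and>
     ((\<forall>x\<in>Z. strongly_extremal A x) \<and>
         (relatively_product_bounded AA \<longrightarrow>
            (\<forall>N. extremal_norm AA N \<longrightarrow>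
               (\<forall>x\<in>Z. \<forall>n\<ge>1. induced_norm N (cocycle A x n) = joint_spectral_radius AA ^ n)))) \<and>
     (\<forall>d. Metric_space UNIV d \<and> Metric_space.mtopology UNIV d = (euclidean :: (nat \<Rightarrow> 'i) topology) \<longrightarrow>
           (\<forall>z. weakly_extremal A z \<longrightarrow>
              (\<lambda>n. 1 / real n * (\<Sum>k<n. Inf {d ((shift ^^ k) z) y |y. y \<in> Z})) \<longlonglongrightarrow> 0))"
proof -
  have A: "compact (UNIV :: 'i set)" "continuous_on UNIV A" "range A = AA"
    using assms(3) by (auto simp: index_set_for_def)
  interpret matrix_cocycle A
    by unfold_locales (use A assms(2) in auto)
  obtain \<Phi> where \<Phi>: "finite \<Phi>" "\<And>T p. (T, p) \<in> \<Phi> \<Longrightarrow> block T p" "dominated UNIV \<Phi>"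
    by (rule dominating_blocks_exist) (rule that)
  interpret cocycle_blocks A \<Phi>
    by unfold_locales (use \<Phi> in auto)
  have Z: "Z = mather_set A" by fact
  obtain \<mu> where \<mu>: "\<mu> \<in> maximising_measures A" "mather_set A = msupport \<mu>"
    by (rule mather_set_eq_msupport) (rule that)
  have \<mu>_inv: "\<mu> \<in> invariant_measures" using \<mu>(1) by (simp add: maximising_measures_def)
  have compact_Z: "compact Z"
    using compact_Int_closed[OF compact_seq closed_mather_set] by (simp add: Z)
  have shift_Z: "shift ` Z = Z"
    unfolding Z \<mu>(2) by (rule msupport_shift_image[OF A(1) \<mu>_inv])
  have rec: "limsup (\<lambda>n. ereal (joint_spectral_radius AA powi (- int n) * mat_spectral_radius (cocycle A x n))) = 1"
    if x: "x \<in> Z" "recurrent x" for x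
  proof -
    have "x \<in> extremal_points" using x(1) mather_set_subset by (auto simp: Z)
    then obtain T p where T: "(T, p) \<in> \<Phi>" "\<And>n. op_seminorm T p (cocycle A x n) = joint_spectral_radius (range A) ^ n"
      by (auto simp: extremal_points_def)
    show ?thesis
      using limsup_spectral_radius_recurrent[OF x(2) \<Phi>(2)[OF T(1)] T(2)] unfolding A(3) .
  qed
  have avg: "(\<lambda>n. 1 / real n * (\<Sum>k<n. Inf {d ((shift ^^ k) z) y |y. y \<in> Z})) \<longlonglongrightarrow> 0"
    if d: "Metric_space UNIV d" "Metric_space.mtopology UNIV d = (euclidean :: (nat \<Rightarrow> 'i) topology)"
      and z: "weakly_extremal A z" for d z
  proof -
    note D = continuous_on_distance_to_set[OF d mather_set_nonempty]
    show ?thesis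
      using weakly_extremal_average_zero[OF z D] by (simp add: Z)
  qed
  show ?thesis
  proof (intro conjI ballI allI impI)
    show "\<exists>\<mu>\<in>invariant_measures. Z = msupport \<mu>" using Z \<mu>(2) \<mu>_inv by blast
    show "compact Z" by (rule compact_Z)
    show "Z \<noteq> {}" unfolding Z by (rule mather_set_nonempty)
    show "shift ` Z = Z" by (rule shift_Z)
    show "\<nu> \<in> maximising_measures A \<longleftrightarrow> emeasure \<nu> Z = 1" if "\<nu> \<in> invariant_measures" for \<nu>
      unfolding Z by (rule maximising_iff_mather_set[OF that])
    show "limsup (\<lambda>n. ereal (joint_spectral_radius AA powi (- int n) * mat_spectral_radius (cocycle A x n))) = 1"
      if "x \<in> Z" "recurrent x" for x
      by (rule rec[OF that])
    show "strongly_extremal A x" if "x \<in> Z" for x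
      using that unfolding Z by (rule strongly_extremal_mather_set)
    show "induced_norm N (cocycle A x n) = joint_spectral_radius AA ^ n"
      if "extremal_norm AA N" "x \<in> Z" "1 \<le> n" for N x n
      using extremal_norm_mather_set[of N x n] that unfolding Z A(3) by blast
    show "(\<lambda>n. 1 / real n * (\<Sum>k<n. Inf {d ((shift ^^ k) z) y |y. y \<in> Z})) \<longlonglongrightarrow> 0"
      if "Metric_space UNIV d \<and> Metric_space.mtopology UNIV d = (euclidean :: (nat \<Rightarrow> 'i) topology)"
        "weakly_extremal A z" for d z
      using that by (intro avg) auto
  qed
qed

end
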